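(* Let $1\le q<\infty$ and $r>0$. The play operator $\mathcal{P}_r:X\times\mathbb{R}\to L^q(a,b)$ is Bouligand differentiable, with Bouligand derivative $\mathcal{P}_r'[[u;z_0];[h;y]]$ given by the recursion $$(w_k^\Delta)'((u,z_0);(h,y))=(P^{I_k})'\big((u,w_{k-1}^\Delta(u,z_0));(h,(w_{k-1}^\Delta)'((u,z_0);(h,y)))\big)(t_k),$$ $$\mathcal{P}_r'[[u;z_0];[h;y]](t)=(P^{I_k})'\big((u,w_{k-1}^\Delta(u,z_0));(h,(w_{k-1}^\Delta)'((u,z_0);(h,y)))\big)(t),\quad t\in I_k,\ 1\le k\le N,$$ where $\Delta=\{t_k\}_{0\le k\le N}$ is any partition of $[a,b]$ with $\operatorname{osc}_{I_k}(u)<r$ for all $k$. For every $(u,z_0)\in X\times\mathbb{R}$ it satisfies the remainder estimate $$\big\|\mathcal{P}_r[u+h;z_0+y]-\mathcal{P}_r[u;z_0]-\mathcal{P}_r'[[u;z_0];[h;y]]\big\|_{L^q(a,b)}\le\rho_{(u,z_0)}(\|h\|_\infty+|y|)\,\|(h,y)\|_{X\times\mathbb{R}}$$ for all $h\in X$, $y\in\mathbb{R}$, where $\rho_{(u,z_0)}(\delta)\downarrow0$ as $\delta\downarrow0$ and $\rho_{(u,z_0)}$ is uniformly bounded in $(u,z_0)$.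
   Context: Fix $a<b$, $r>0$. $X$ is either $C^{0,\alpha}[a,b]$ with $0<\alpha\le1$ and norm $|u(a)|+\sup_{s\ne t}|u(t)-u(s)|/|t-s|^\alpha$, or $W^{1,\gamma}(a,b)$ with $1<\gamma\le\infty$ and norm $|u(a)|+\|u'\|_{L^\gamma}$. $X\times\mathbb{R}$ carries a product norm, e.g. $\|h\|_X+|y|$. $\operatorname{osc}_I(u)=\sup_{s,t\in I}|u(t)-u(s)|$. Bouligand derivative: $F:U\to B$ ($A,B$ normed, $U\subset A$ open) is Bouligand differentiable at $u$ if the directional derivative $F'(u;h)=\lim_{\lambda\downarrow0}(F(u+\lambda h)-F(u))/\lambda$ exists for all $h\in A$ and $\lim_{h\to0}\|F(u+h)-F(u)-F'(u;h)\|/\|h\|=0$; then $F'(u;h)$ is called its Bouligand derivative at $u$ in the direction $h$. Play operator. Let $\pi_r(z)=\max\{-r,\min\{r,z\}\}$. For continuous piecewise monotone $u:[a,b]\to\mathbb{R}$ (monotone on each interval of a partition $a=s_0<\dots<s_m=b$) and $z_0\in\mathbb{R}$, $w=\mathcal{P}_r[u;z_0]$ is defined by $w(a)=u(a)-\pi_r(z_0)$ and successively $w(t)=\max\{u(t)-r,\min\{u(t)+r,w(s_i)\}\}$ for $s_i<t\le s_{i+1}$. $\mathcal{P}_r$ is Lipschitz for the maximum norm and is extended uniquely by continuity to $\mathcal{P}_r:C[a,b]\times\mathbb{R}\to C[a,b]$. Interval objects. For a compact interval $I\subset[a,b]$, $u\in C(I)$, $t\in I$: $(F^Iu)(t)=\max_{s\in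 I,s\le t}u(s)$, $M^I(u,t)=\{s\in I:s\le t,\ u(s)=(F^Iu)(t)\}$. For $(u,p)\in C(I)\times\mathbb{R}$ with $\operatorname{osc}_Iu<r$ let $P_+^I(u,p)=p+\max\{0,F^I(u-r-p)\}$ and $P_-^I(u,p)=p-\max\{0,F^I(-u-r+p)\}$ (pointwise in $t$); let $Z_+^I$ be the set of such $(u,p)$ with $u-P_+^I(u,p)>-r$ on $I$ and $Z_-^I$ the set of such $(u,p)$ with $u-P_-^I(u,p)<r$ on $I$. Every $(u,p)$ with $\operatorname{osc}_Iu<r$ lies in $Z_+^I\cup Z_-^I$, and $P_+^I(u,p)=P_-^I(u,p)=p$ on $Z_+^I\cap Z_-^I$; set $P^I=P_\pm^I$ on $Z_\pm^I$. Let $\beta'(x;y)=0$ if $x<0$, or $x=0$ and $y\le0$; $\beta'(x;y)=y$ if $x>0$, or $x=0$ and $y>0$. The derivative of $P^I$ is $(P^I)'((u,p);(h,\eta))(t)=\eta+\beta'\big(\max_{s\in I,s\le t}(u(s)-r-p);\ \max_{s\in M^I(u,t)}(h(s)-\eta)\big)$ on $Z_+^I$, and $(P^I)'((u,p);(h,\eta))(t)=\eta-\beta'\big(\max_{s\in I,s\le t}(-u(s)-r+p);\ \max_{s\in M^I(-u,t)}(-h(s)+\eta)\big)$ on $Z_-^I$ (both equal $\eta$ on $Z_+^I\cap Z_-^I$). Partition objects. For a partition $a=t_0<\dots<t_N=b$ with intervals $I_k=[t_{k-1},t_k]$ and $u$ with $\operatorname{osc}_{I_k}(u)<r$ for all $k$: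 $w_0^\Delta(u,z_0)=u(a)-\pi_r(z_0)$, $w_k^\Delta(u,z_0)=P^{I_k}(u|_{I_k},w_{k-1}^\Delta(u,z_0))(t_k)$, and $(w_0^\Delta)'((u,z_0);(h,y))=h(a)-\pi_r'(z_0;y)$, where $\pi_r'(z;y)$ is the directional derivative of $\pi_r$: $y$ if $|z|<r$, $0$ if $|z|>r$, $\min\{y,0\}$ if $z=r$, $\max\{y,0\}$ if $z=-r$. Restrictions of $u,h$ to $I_k$ are understood in $P^{I_k}$ and $(P^{I_k})'$. *)

theory Defs
  imports
    "HOL-Analysis.Analysis"
    "HOL-Library.Function_Algebras"
    "HOL-Probability.Essential_Supremum"
begin

section \<open>Function spaces on an interval\<close>

text \<open>
  Function spaces over \<open>[a,b]\<close> are given by a carrier (a linear subspace of \<open>real \<Rightarrow> real\<close>, with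
  pointwise operations) and a norm functional. Values outside \<open>[a,b]\<close> are irrelevant: functions
  agreeing on \<open>[a,b]\<close> (for \<open>L\<^sup>p\<close>: almost everywhere on \<open>(a,b)\<close>) represent the same element, so the
  norm functionals are seminorms on the carriers.
\<close>

instantiation "fun" :: (type, real_vector) real_vector
begin

definition scaleR_fun :: "real \<Rightarrow> ('a \<Rightarrow> 'b) \<Rightarrow> 'a \<Rightarrow> 'b" where
  "scaleR_fun c f = (\<lambda>x. c *\<^sub>R f x)"

instance
  by standard (auto simp: scaleR_fun_def fun_eq_iff scaleR_add_right scaleR_add_left)

end

definition Lp_space :: "real \<Rightarrow> real \<Rightarrow> ennreal \<Rightarrow> (real \<Rightarrow> real) set" where
  "Lp_space a b p =
     {f \<in> borel_measurable (lebesgue_on {a<..<b}).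
        if p = \<infinity> then esssup (lebesgue_on {a<..<b}) (\<lambda>x. ennreal \<bar>f x\<bar>) < \<infinity>
        else integrable (lebesgue_on {a<..<b}) (\<lambda>x. \<bar>f x\<bar> powr enn2real p)}"

definition Lp_norm :: "real \<Rightarrow> real \<Rightarrow> ennreal \<Rightarrow> (real \<Rightarrow> real) \<Rightarrow> real" where
  "Lp_norm a b p f =
     (if p = \<infinity> then enn2real (esssup (lebesgue_on {a<..<b}) (\<lambda>x. ennreal \<bar>f x\<bar>))
      else (LINT x|lebesgue_on {a<..<b}. \<bar>f x\<bar> powr enn2real p) powr (1 / enn2real p))"

definition sup_norm :: "real \<Rightarrow> real \<Rightarrow> (real \<Rightarrow> real) \<Rightarrow> real" where
  "sup_norm a b f = (SUP t\<in>{a..b}. \<bar>f t\<bar>)"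

definition hoelder_space :: "real \<Rightarrow> real \<Rightarrow> real \<Rightarrow> (real \<Rightarrow> real) set" where
  "hoelder_space a b \<alpha> =
     {u. \<exists>C. \<forall>s\<in>{a..b}. \<forall>t\<in>{a..b}. \<bar>u t - u s\<bar> \<le> C * \<bar>t - s\<bar> powr \<alpha>}"

definition hoelder_norm :: "real \<Rightarrow> real \<Rightarrow> real \<Rightarrow> (real \<Rightarrow> real) \<Rightarrow> real" where
  "hoelder_norm a b \<alpha> u =
     \<bar>u a\<bar> + Sup {\<bar>u t - u s\<bar> / \<bar>t - s\<bar> powr \<alpha> | s t. s \<in> {a..b} \<and> t \<in> {a..b} \<and> s \<noteq> t}"

definition test_function :: "real \<Rightarrow> real \<Rightarrow> (real \<Rightarrow> real) \<Rightarrow> bool" where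
  "test_function a b \<phi> \<longleftrightarrow>
     (\<forall>n x. (deriv ^^ n) \<phi> differentiable (at x)) \<and>
     (\<exists>c d. a < c \<and> d < b \<and> (\<forall>x. x \<notin> {c..d} \<longrightarrow> \<phi> x = 0))"

definition weak_derivative :: "real \<Rightarrow> real \<Rightarrow> (real \<Rightarrow> real) \<Rightarrow> (real \<Rightarrow> real) \<Rightarrow> bool" where
  "weak_derivative a b u v \<longleftrightarrow>
     (\<forall>\<phi>. test_function a b \<phi> \<longrightarrow>
        (LINT x|lebesgue_on {a<..<b}. u x * deriv \<phi> x) =
        - (LINT x|lebesgue_on {a<..<b}. v x * \<phi> x))"

text \<open>Elements of \<open>W\<^sup>1\<^sup>,\<^sup>\<gamma>(a,b)\<close> are identified with their continuous representatives on \<open>[a,b]\<close>.\<close>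

definition sobolev_space :: "real \<Rightarrow> real \<Rightarrow> ennreal \<Rightarrow> (real \<Rightarrow> real) set" where
  "sobolev_space a b \<gamma> =
     {u. continuous_on {a..b} u \<and> (\<exists>v\<in>Lp_space a b \<gamma>. weak_derivative a b u v)}"

definition sobolev_norm :: "real \<Rightarrow> real \<Rightarrow> ennreal \<Rightarrow> (real \<Rightarrow> real) \<Rightarrow> real" where
  "sobolev_norm a b \<gamma> u =
     \<bar>u a\<bar> + Lp_norm a b \<gamma> (SOME v. v \<in> Lp_space a b \<gamma> \<and> weak_derivative a b u v)"

text \<open>
  A product norm on \<open>X \<times> \<real>\<close> is any norm that is equivalent to \<open>\<parallel>h\<parallel>\<^sub>X + \<bar>y\<bar>\<close>. Definiteness (up to the
  identification above) follows from the equivalence.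
\<close>

definition product_norm ::
  "(real \<Rightarrow> real) set \<Rightarrow> ((real \<Rightarrow> real) \<Rightarrow> real) \<Rightarrow> ((real \<Rightarrow> real) \<times> real \<Rightarrow> real) \<Rightarrow> bool" where
  "product_norm X normX N \<longleftrightarrow>
     (\<forall>p\<in>X \<times> UNIV. \<forall>p'\<in>X \<times> UNIV. N (p + p') \<le> N p + N p') \<and>
     (\<forall>p\<in>X \<times> UNIV. \<forall>c. N (c *\<^sub>R p) = \<bar>c\<bar> * N p) \<and>
     (\<exists>c>0. \<exists>C>0. \<forall>h\<in>X. \<forall>y.
        c * (normX h + \<bar>y\<bar>) \<le> N (h, y) \<and> N (h, y) \<le> C * (normX h + \<bar>y\<bar>))"

section \<open>Bouligand derivative\<close>

text \<open>
  \<open>F\<close> maps the open subset \<open>U\<close> of the normed space \<open>(A, normA)\<close> into the normed space \<open>(B, normB)\<close>,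
  and \<open>D\<close> is its Bouligand derivative at \<open>u\<close>.
\<close>

definition has_bouligand_derivative_at ::
  "'a::real_vector set \<Rightarrow> ('a \<Rightarrow> real) \<Rightarrow> 'a set \<Rightarrow> 'b::real_vector set \<Rightarrow> ('b \<Rightarrow> real) \<Rightarrow>
   ('a \<Rightarrow> 'b) \<Rightarrow> 'a \<Rightarrow> ('a \<Rightarrow> 'b) \<Rightarrow> bool" where
  "has_bouligand_derivative_at A normA U B normB F u D \<longleftrightarrow>
     U \<subseteq> A \<and> (\<forall>v\<in>U. \<exists>e>0. \<forall>w\<in>A. normA (w - v) < e \<longrightarrow> w \<in> U) \<and>
     (\<forall>v\<in>U. F v \<in> B) \<and> u \<in> U \<and>
     (\<forall>h\<in>A. D h \<in> B \<and>
        ((\<lambda>l. normB ((F (u + l *\<^sub>R h) - F u) /\<^sub>R l - D h)) \<longlongrightarrow> 0) (at_right 0)) \<and>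
     (\<forall>e>0. \<exists>d>0. \<forall>h\<in>A. u + h \<in> U \<and> 0 < normA h \<and> normA h < d \<longrightarrow>
        normB (F (u + h) - F u - D h) / normA h \<le> e)"

section \<open>The play operator\<close>

definition proj :: "real \<Rightarrow> real \<Rightarrow> real" where
  "proj r z = max (- r) (min r z)"

definition proj_deriv :: "real \<Rightarrow> real \<Rightarrow> real \<Rightarrow> real" where
  "proj_deriv r z y =
     (if \<bar>z\<bar> < r then y else if z = r then min y 0 else if z = - r then max y 0 else 0)"

definition is_partition :: "real \<Rightarrow> real \<Rightarrow> nat \<Rightarrow> (nat \<Rightarrow> real) \<Rightarrow> bool" where
  "is_partition a b m s \<longleftrightarrow> s 0 = a \<and> s m = b \<and> (\<forall>i<m. s i < s (Suc i))"

text \<open>\<open>w\<close> is the output of the play for the continuous piecewise monotone input \<open>u\<close>.\<close>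

definition pm_play :: "real \<Rightarrow> real \<Rightarrow> real \<Rightarrow> (real \<Rightarrow> real) \<Rightarrow> real \<Rightarrow> (real \<Rightarrow> real) \<Rightarrow> bool" where
  "pm_play a b r u z0 w \<longleftrightarrow>
     continuous_on {a..b} u \<and>
     (\<exists>m s. is_partition a b m s \<and>
        (\<forall>i<m. mono_on {s i..s (Suc i)} u \<or> antimono_on {s i..s (Suc i)} u) \<and>
        w a = u a - proj r z0 \<and>
        (\<forall>i<m. \<forall>t\<in>{s i<..s (Suc i)}. w t = max (u t - r) (min (u t + r) (w (s i)))))"

text \<open>
  Extension by continuity to \<open>C[a,b] \<times> \<real>\<close>: the common uniform limit of the outputs along all
  piecewise monotone approximations of \<open>u\<close> and all approximations of \<open>z0\<close>.
  The value \<open>0\<close> outside \<open>[a,b]\<close> is a convention that makes the limit unique as a function on \<open>real\<close>.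
\<close>

definition play :: "real \<Rightarrow> real \<Rightarrow> real \<Rightarrow> (real \<Rightarrow> real) \<Rightarrow> real \<Rightarrow> real \<Rightarrow> real" where
  "play a b r u z0 = (THE w.
     (\<forall>t. t \<notin> {a..b} \<longrightarrow> w t = 0) \<and>
     (\<forall>U Z W. (\<forall>n. pm_play a b r (U n) (Z n) (W n)) \<and>
        uniform_limit {a..b} U u sequentially \<and> Z \<longlonglongrightarrow> z0 \<longrightarrow>
        uniform_limit {a..b} W w sequentially))"

section \<open>The play on intervals of small oscillation\<close>

definition osc :: "real set \<Rightarrow> (real \<Rightarrow> real) \<Rightarrow> real" where
  "osc I u = Sup {\<bar>u t - u s\<bar> | s t. s \<in> I \<and> t \<in> I}"

text \<open>The suprema below are taken of continuous functions over compact sets, i.e. are maxima.\<close>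

definition cummax :: "real set \<Rightarrow> (real \<Rightarrow> real) \<Rightarrow> real \<Rightarrow> real" where
  "cummax I u t = (SUP s\<in>{s\<in>I. s \<le> t}. u s)"

definition argmax_set :: "real set \<Rightarrow> (real \<Rightarrow> real) \<Rightarrow> real \<Rightarrow> real set" where
  "argmax_set I u t = {s\<in>I. s \<le> t \<and> u s = cummax I u t}"

definition P_plus :: "real \<Rightarrow> real set \<Rightarrow> (real \<Rightarrow> real) \<Rightarrow> real \<Rightarrow> real \<Rightarrow> real" where
  "P_plus r I u p t = p + max 0 (cummax I (\<lambda>s. u s - r - p) t)"

definition P_minus :: "real \<Rightarrow> real set \<Rightarrow> (real \<Rightarrow> real) \<Rightarrow> real \<Rightarrow> real \<Rightarrow> real" where
  "P_minus r I u p t = p - max 0 (cummax I (\<lambda>s. - u s - r + p) t)"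

definition Z_plus :: "real \<Rightarrow> real set \<Rightarrow> ((real \<Rightarrow> real) \<times> real) set" where
  "Z_plus r I =
     {(u, p). continuous_on I u \<and> osc I u < r \<and> (\<forall>t\<in>I. u t - P_plus r I u p t > - r)}"

text \<open>
  When \<open>osc I u < r\<close>, any pair outside \<open>Z_plus\<close> lies in the corresponding set \<open>Z_minus\<close>
  (where \<open>u - P_minus < r\<close> on \<open>I\<close>), and on the intersection of the two sets the \<open>plus\<close> and \<open>minus\<close>
  expressions coincide; hence case distinction on \<open>Z_plus\<close> suffices.
\<close>

definition P_loc :: "real \<Rightarrow> real set \<Rightarrow> (real \<Rightarrow> real) \<Rightarrow> real \<Rightarrow> real \<Rightarrow> real" where
  "P_loc r I u p = (if (u, p) \<in> Z_plus r I then P_plus r I u p else P_minus r I u p)"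

definition pos_deriv :: "real \<Rightarrow> real \<Rightarrow> real" where
  "pos_deriv x y = (if x < 0 \<or> (x = 0 \<and> y \<le> 0) then 0 else y)"

definition P_loc_deriv ::
  "real \<Rightarrow> real set \<Rightarrow> (real \<Rightarrow> real) \<times> real \<Rightarrow> (real \<Rightarrow> real) \<times> real \<Rightarrow> real \<Rightarrow> real" where
  "P_loc_deriv r I = (\<lambda>(u, p) (h, \<eta>) t.
     if (u, p) \<in> Z_plus r I
     then \<eta> + pos_deriv (SUP s\<in>{s\<in>I. s \<le> t}. u s - r - p)
                        (SUP s\<in>argmax_set I u t. h s - \<eta>)
     else \<eta> - pos_deriv (SUP s\<in>{s\<in>I. s \<le> t}. - u s - r + p)
                        (SUP s\<in>argmax_set I (\<lambda>s. - u s) t. - h s + \<eta>))"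

section \<open>Recursion over a partition\<close>

primrec w_node :: "real \<Rightarrow> (nat \<Rightarrow> real) \<Rightarrow> (real \<Rightarrow> real) \<Rightarrow> real \<Rightarrow> nat \<Rightarrow> real" where
  "w_node r \<tau> u z0 0 = u (\<tau> 0) - proj r z0"
| "w_node r \<tau> u z0 (Suc k) = P_loc r {\<tau> k..\<tau> (Suc k)} u (w_node r \<tau> u z0 k) (\<tau> (Suc k))"

primrec w_node_deriv ::
  "real \<Rightarrow> (nat \<Rightarrow> real) \<Rightarrow> (real \<Rightarrow> real) \<times> real \<Rightarrow> (real \<Rightarrow> real) \<times> real \<Rightarrow> nat \<Rightarrow> real" where
  "w_node_deriv r \<tau> uz hy 0 = fst hy (\<tau> 0) - proj_deriv r (snd uz) (snd hy)"
| "w_node_deriv r \<tau> uz hy (Suc k) =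
     P_loc_deriv r {\<tau> k..\<tau> (Suc k)} (fst uz, w_node r \<tau> (fst uz) (snd uz) k)
       (fst hy, w_node_deriv r \<tau> uz hy k) (\<tau> (Suc k))"

text \<open>
  \<open>d\<close> is given on \<open>[a,b]\<close> by the recursion, for any partition of \<open>[a,b]\<close> on whose intervals \<open>u\<close>
  oscillates by less than \<open>r\<close>. The index \<open>k\<close> stands for the interval \<open>I\<^sub>k\<^sub>+\<^sub>1\<close>.
\<close>

definition given_by_recursion ::
  "real \<Rightarrow> real \<Rightarrow> real \<Rightarrow> (real \<Rightarrow> real) \<times> real \<Rightarrow> (real \<Rightarrow> real) \<times> real \<Rightarrow> (real \<Rightarrow> real) \<Rightarrow> bool" where
  "given_by_recursion a b r uz hy d \<longleftrightarrow>
     (\<forall>N \<tau>. is_partition a b N \<tau> \<and> (\<forall>k<N. osc {\<tau> k..\<tau> (Suc k)} (fst uz) < r) \<longrightarrow>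
        (\<forall>k<N. \<forall>t\<in>{\<tau> k..\<tau> (Suc k)}.
           d t = P_loc_deriv r {\<tau> k..\<tau> (Suc k)} (fst uz, w_node r \<tau> (fst uz) (snd uz) k)
                   (fst hy, w_node_deriv r \<tau> uz hy k) t))"

end

theory Submission
  imports Defs "HOL-Computational_Algebra.Polynomial"
begin

text \<open>
  On every interval \<open>[s,t]\<close> where \<open>u\<close> oscillates by less than \<open>2r\<close>, the play moves \<open>w s\<close> to the nearest
  point of \<open>[max u - r, min u + r]\<close>. Hence the value of the play at a fixed time is a finite composition
  of running maxima of \<open>\<plusminus>u\<close> and positive parts. Both are differentiable with a remainder that is
  small relative to \<open>N (h, y)\<close> as soon as \<open>\<parallel>h\<parallel>\<^sub>\<infinity> + \<bar>y\<bar>\<close> is small: for the maximum, near-maximizers of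
  \<open>u\<close> are close to maximizers, and the unit ball of \<open>X\<close> is equicontinuous (for Sobolev spaces by the
  fundamental theorem of calculus for weak derivatives, obtained from smooth test functions that approximate
  an indicator function).

  The resulting derivative is the pointwise limit of difference quotients, which makes it measurable and
  independent of the partition. Applying dominated convergence to sequences of increments turns the pointwise
  remainder estimates into the estimate in \<open>L\<^sup>q\<close>; working with sequences avoids measurability questions
  for suprema over uncountably many increments.
\<close>

section \<open>Characterization of the play by local clamping\<close>

text \<open>Two norms are forced on the proof. The maximum over a fixed interval is in general not
  Bouligand differentiable for the sup norm: a maximizer of \<open>u + h\<close> lies near the
  maximizers of \<open>u\<close>, but not among them, so the remainder is governed by the
  oscillation of \<open>h\<close> over short distances and not by its size. Hence remainders are
  compared with \<open>N\<close>, whereas closeness of maximizers only needs a small sup norm. The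
  thresholds are not uniform in time: where the running maximum of \<open>u\<close> reaches the edge
  at which the play starts to move, the derivative may jump in \<open>t\<close>. The pointwise
  estimates therefore do not combine to a uniform one, and integration with finite exponent is
  essential. Oscillation below \<open>2 * r\<close> keeps the clamping interval nondegenerate, which
  makes the clamp a sum of two positive parts of which at most one is active. Oscillation of
  \<open>u\<close> below \<open>r\<close> implies this, with room for perturbations. So one formula
  covers \<open>Z_plus\<close> and its complement, for \<open>u\<close> and all nearby
  inputs.\<close>

lemma is_partition_mono:
  assumes "is_partition a b m s" "i \<le> j" "j \<le> m"
  shows "s i \<le> s j"
  using assms(2,3)
proof (induction j)
  case (Suc j)
  then show ?case using assms(1) less_imp_le[of "s j" "s (Suc j)"] unfolding is_partition_def by (cases "i = Suc j") auto
qed auto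

section \<open>Extrema of continuous functions over compact windows\<close>

lemma compact_attains_SUP:
  fixes f :: "'a::topological_space \<Rightarrow> real"
  assumes "compact S" "S \<noteq> {}" "continuous_on S f"
  obtains x where "x \<in> S" "f x = (SUP x\<in>S. f x)" "bdd_above (f ` S)"
proof -
  obtain x where x: "x \<in> S" "\<And>y. y \<in> S \<Longrightarrow> f y \<le> f x"
    using continuous_attains_sup[OF assms] by blast
  have "(SUP x\<in>S. f x) = f x"
    by (rule cSup_eq_maximum) (use x in auto)
  moreover have "bdd_above (f ` S)" using x by (auto simp: bdd_above_def)
  ultimately show ?thesis using x that by simp
qed

definition icc_max :: "(real \<Rightarrow> real) \<Rightarrow> real \<Rightarrow> real \<Rightarrow> real" where
  "icc_max u s t = (SUP x\<in>{s..t}. u x)"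

text \<open>Reducing minima to maxima of \<open>- u\<close> lets the expansion of the maximum serve
  both edges of the play.\<close>

definition icc_min :: "(real \<Rightarrow> real) \<Rightarrow> real \<Rightarrow> real \<Rightarrow> real" where
  "icc_min u s t = - icc_max (\<lambda>x. - u x) s t"

lemma icc_max_attained:
  assumes "continuous_on {s..t} u" "s \<le> t"
  obtains x where "x \<in> {s..t}" "u x = icc_max u s t"
  using compact_attains_SUP[of "{s..t}" u] assms unfolding icc_max_def by force

lemma icc_max_upper:
  assumes "continuous_on {s..t} u" "x \<in> {s..t}"
  shows "u x \<le> icc_max u s t"
  unfolding icc_max_def
  by (rule cSUP_upper[OF assms(2) bounded_imp_bdd_above[OF compact_imp_bounded]])
     (rule compact_continuous_image[OF assms(1) compact_Icc])

lemma icc_min_attained: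
  assumes "continuous_on {s..t} u" "s \<le> t"
  obtains x where "x \<in> {s..t}" "u x = icc_min u s t"
  using icc_max_attained[of s t "\<lambda>x. - u x"] assms unfolding icc_min_def
  by (metis add.inverse_inverse continuous_on_minus)

lemma icc_min_lower:
  assumes "continuous_on {s..t} u" "x \<in> {s..t}"
  shows "icc_min u s t \<le> u x"
  using icc_max_upper[of s t "\<lambda>x. - u x" x] assms continuous_on_minus unfolding icc_min_def by force

lemma icc_max_eqI:
  assumes "continuous_on {s..t} u" "x \<in> {s..t}" "\<And>y. y \<in> {s..t} \<Longrightarrow> u y \<le> u x"
  shows "icc_max u s t = u x"
  using icc_max_attained[OF assms(1)] icc_max_upper[OF assms(1,2)] assms
  by (metis antisym atLeastAtMost_iff order_trans)

lemma icc_min_eqI: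
  assumes "continuous_on {s..t} u" "x \<in> {s..t}" "\<And>y. y \<in> {s..t} \<Longrightarrow> u x \<le> u y"
  shows "icc_min u s t = u x"
  using icc_min_attained[OF assms(1)] icc_min_lower[OF assms(1,2)] assms
  by (metis antisym atLeastAtMost_iff order_trans)

lemma icc_max_refl [simp]: "icc_max u t t = u t"
  by (simp add: icc_max_def)

lemma icc_min_refl [simp]: "icc_min u t t = u t"
  by (simp add: icc_min_def)

lemma icc_max_split:
  assumes "continuous_on {s..t} u" "s \<le> x" "x \<le> t"
  shows "icc_max u s t = max (icc_max u s x) (icc_max u x t)"
proof -
  have c: "continuous_on {s..x} u" "continuous_on {x..t} u"
    using assms by (auto intro: continuous_on_subset)
  obtain y1 where y1: "y1 \<in> {s..x}" "u y1 = icc_max u s x" using icc_max_attained[OF c(1)] assms by blast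
  obtain y2 where y2: "y2 \<in> {x..t}" "u y2 = icc_max u x t" using icc_max_attained[OF c(2)] assms by blast
  obtain y where y: "y \<in> {s..t}" "u y = icc_max u s t" using icc_max_attained[OF assms(1)] assms by force
  have "y \<in> {s..x} \<or> y \<in> {x..t}" using y by auto
  then have "icc_max u s t \<le> max (icc_max u s x) (icc_max u x t)"
    using icc_max_upper[OF c(1), of y] icc_max_upper[OF c(2), of y] y by auto
  moreover have "icc_max u s x \<le> icc_max u s t" "icc_max u x t \<le> icc_max u s t"
    using icc_max_upper[OF assms(1), of y1] icc_max_upper[OF assms(1), of y2] y1 y2 assms by auto
  ultimately show ?thesis by linarith
qed

lemma icc_min_split:
  assumes "continuous_on {s..t} u" "s \<le> x" "x \<le> t"
  shows "icc_min u s t = min (icc_min u s x) (icc_min u x t)"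
  using icc_max_split[of s t "\<lambda>x. - u x" x] assms continuous_on_minus[OF assms(1)]
  unfolding icc_min_def by linarith

lemma icc_max_dist_le:
  assumes "continuous_on {s..t} u" "continuous_on {s..t} v" "s \<le> t"
    and "\<And>x. x \<in> {s..t} \<Longrightarrow> \<bar>u x - v x\<bar> \<le> e"
  shows "\<bar>icc_max u s t - icc_max v s t\<bar> \<le> e"
proof -
  obtain x where x: "x \<in> {s..t}" "u x = icc_max u s t" using icc_max_attained[OF assms(1,3)] .
  obtain y where y: "y \<in> {s..t}" "v y = icc_max v s t" using icc_max_attained[OF assms(2,3)] .
  show ?thesis
    using icc_max_upper[OF assms(1) y(1)] icc_max_upper[OF assms(2) x(1)] assms(4)[OF x(1)] assms(4)[OF y(1)] x y
    by linarith
qed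

lemma icc_min_dist_le:
  assumes "continuous_on {s..t} u" "continuous_on {s..t} v" "s \<le> t"
    and "\<And>x. x \<in> {s..t} \<Longrightarrow> \<bar>u x - v x\<bar> \<le> e"
  shows "\<bar>icc_min u s t - icc_min v s t\<bar> \<le> e"
  using icc_max_dist_le[of s t "\<lambda>x. - u x" "\<lambda>x. - v x" e] assms unfolding icc_min_def
  by (force intro!: continuous_on_minus)

text \<open>An intrinsic form of the play, free of monotone partitions, so it makes sense for every
  continuous input. The strict bound \<open>2 * r\<close> is an open condition on the input, which
  is what lets the clamp rule survive uniform limits.\<close>

definition is_play :: "real \<Rightarrow> real \<Rightarrow> real \<Rightarrow> (real \<Rightarrow> real) \<Rightarrow> (real \<Rightarrow> real) \<Rightarrow> bool" where
  "is_play a b r u w \<longleftrightarrow>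
     (\<forall>t\<in>{a..b}. \<bar>u t - w t\<bar> \<le> r) \<and>
     (\<forall>s t. a \<le> s \<longrightarrow> s \<le> t \<longrightarrow> t \<le> b \<longrightarrow> icc_max u s t - icc_min u s t < 2 * r \<longrightarrow>
        w t = max (icc_max u s t - r) (min (icc_min u s t + r) (w s)))"

text \<open>For monotone \<open>u\<close> the extrema over \<open>[s,t]\<close> sit at the end
  points, and clamping from \<open>c\<close> to \<open>s\<close> and then to \<open>t\<close> agrees
  with clamping from \<open>c\<close> to \<open>t\<close> directly.\<close>

lemma is_play_monotone_piece:
  assumes cont: "continuous_on {c..d} u" and mon: "mono_on {c..d} u \<or> antimono_on {c..d} u"
    and "c \<le> d" "r > 0" and wc: "\<bar>u c - w c\<bar> \<le> r"
    and w: "\<And>t. t \<in> {c<..d} \<Longrightarrow> w t = max (u t - r) (min (u t + r) (w c))"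
  shows "is_play c d r u w"
  unfolding is_play_def
proof (intro conjI ballI allI impI)
  \<comment> \<open>The rule is given on \<open>{c<..d}\<close> only; at \<open>c\<close> itself the
    clamp is inactive by \<open>wc\<close>.\<close>
  have w': "w t = max (u t - r) (min (u t + r) (w c))" if "t \<in> {c..d}" for t
    using w[of t] that wc by (cases "t = c") auto
  show "\<bar>u t - w t\<bar> \<le> r" if "t \<in> {c..d}" for t
    using w'[OF that] \<open>r > 0\<close> by (auto simp: max_def min_def abs_if)
  fix s t assume st: "c \<le> s" "s \<le> t" "t \<le> d" and small: "icc_max u s t - icc_min u s t < 2 * r"
  have cst: "continuous_on {s..t} u" using cont st by (auto intro: continuous_on_subset)
  from mon show "w t = max (icc_max u s t - r) (min (icc_min u s t + r) (w s))"
  proof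
    assume m: "mono_on {c..d} u"
    have "icc_max u s t = u t" by (rule icc_max_eqI[OF cst]) (use st m in \<open>auto simp: mono_on_def\<close>)
    moreover have "icc_min u s t = u s" by (rule icc_min_eqI[OF cst]) (use st m in \<open>auto simp: mono_on_def\<close>)
    moreover have "u c \<le> u s" "u s \<le> u t" using st m by (auto simp: mono_on_def)
    ultimately show ?thesis using w'[of s] w'[of t] st wc \<open>r > 0\<close> small
      by (auto simp: max_def min_def abs_if split: if_splits)
  next
    assume m: "antimono_on {c..d} u"
    have m': "u y \<le> u x" if "x \<le> y" "c \<le> x" "y \<le> d" for x y
      using m that by (auto simp: monotone_on_def)
    have "icc_max u s t = u s" by (rule icc_max_eqI[OF cst]) (use st m' in auto)
    moreover have "icc_min u s t = u t" by (rule icc_min_eqI[OF cst]) (use st m' in auto)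
    moreover have "u s \<le> u c" "u t \<le> u s" using st m' by auto
    ultimately show ?thesis using w'[of s] w'[of t] st wc \<open>r > 0\<close> small
      by (auto simp: max_def min_def abs_if split: if_splits)
  qed
qed

text \<open>Projecting onto two intervals of the line in turn is projecting onto their intersection,
  provided the latter is nonempty. Oscillation below \<open>2 * r\<close> over all of
  \<open>[s,t]\<close> guarantees that, and the intersection is the clamping interval of
  \<open>[s,t]\<close>.\<close>

lemma is_play_concat:
  assumes cont: "continuous_on {a..b} u" and "a \<le> c" "c \<le> b"
    and l: "is_play a c r u w" and rr: "is_play c b r u w"
  shows "is_play a b r u w"
  unfolding is_play_def
proof (intro conjI ballI allI impI)
  show "\<bar>u t - w t\<bar> \<le> r" if "t \<in> {a..b}" for t
    using that l rr unfolding is_play_def by (cases "t \<le> c") auto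
  fix s t assume st: "a \<le> s" "s \<le> t" "t \<le> b" and small: "icc_max u s t - icc_min u s t < 2 * r"
  show "w t = max (icc_max u s t - r) (min (icc_min u s t + r) (w s))"
  proof (cases "t \<le> c \<or> c \<le> s")
    case True
    then show ?thesis using st l rr small unfolding is_play_def by fastforce
  next
    case False
    have cst: "continuous_on {s..t} u" using cont st by (auto intro: continuous_on_subset)
    have M: "icc_max u s t = max (icc_max u s c) (icc_max u c t)" "icc_min u s t = min (icc_min u s c) (icc_min u c t)"
      using icc_max_split[OF cst, of c] icc_min_split[OF cst, of c] False by auto
    have 1: "icc_max u s c - icc_min u s c < 2 * r" "icc_max u c t - icc_min u c t < 2 * r" using M small by linarith+
    have "w c = max (icc_max u s c - r) (min (icc_min u s c + r) (w s))"
      using l st False 1 unfolding is_play_def by auto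
    moreover have "w t = max (icc_max u c t - r) (min (icc_min u c t + r) (w c))"
      using rr st False 1 unfolding is_play_def by auto
    ultimately show ?thesis using M small by linarith
  qed
qed

lemma pm_play_is_play:
  assumes "pm_play a b r u z w" "r > 0"
  shows "is_play a b r u w" "w a = u a - proj r z" "continuous_on {a..b} u"
proof -
  show cont: "continuous_on {a..b} u" and wa: "w a = u a - proj r z"
    using assms(1) unfolding pm_play_def by auto
  obtain m s where p: "is_partition a b m s"
    and mon: "\<And>i. i < m \<Longrightarrow> mono_on {s i..s (Suc i)} u \<or> antimono_on {s i..s (Suc i)} u"
    and w: "\<And>i t. i < m \<Longrightarrow> t \<in> {s i<..s (Suc i)} \<Longrightarrow> w t = max (u t - r) (min (u t + r) (w (s i)))"
    using assms(1) unfolding pm_play_def by blast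
  have s0: "s 0 = a" "s m = b" and inc: "\<And>i. i < m \<Longrightarrow> s i < s (Suc i)"
    using p unfolding is_partition_def by auto
  note mono = is_partition_mono[OF p]
  have "is_play a (s k) r u w" if "k \<le> m" for k
    using that
  proof (induction k)
    case 0
    have "is_play a a r u w" unfolding is_play_def
    proof (intro conjI ballI allI impI)
      show "\<bar>u t - w t\<bar> \<le> r" if "t \<in> {a..a}" for t
        using that wa assms(2) by (auto simp: proj_def)
      fix x y assume "a \<le> x" "x \<le> y" "y \<le> a"
      then have "x = a" "y = a" by auto
      then show "w y = max (icc_max u x y - r) (min (icc_min u x y + r) (w x))"
        using wa assms(2) by (simp add: proj_def max_def min_def)
    qed
    then show ?case using s0 by simp
  next
    case (Suc k)
    then have IH: "is_play a (s k) r u w" by auto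
    have k: "a \<le> s k" "s k < s (Suc k)" "s (Suc k) \<le> b"
      using mono[of 0 k] mono[of "Suc k" m] inc[of k] Suc s0 by auto
    have "is_play (s k) (s (Suc k)) r u w"
    proof (rule is_play_monotone_piece)
      show "continuous_on {s k..s (Suc k)} u" using cont k by (auto intro: continuous_on_subset)
      show "\<bar>u (s k) - w (s k)\<bar> \<le> r" using IH k unfolding is_play_def by auto
    qed (use mon[of k] w[of k] k Suc.prems assms(2) in auto)
    moreover have "continuous_on {a..s (Suc k)} u" using cont k by (auto intro: continuous_on_subset)
    ultimately show ?case using is_play_concat[OF _ _ _ IH] k by auto
  qed
  from this[of m] show "is_play a b r u w" using s0 by auto
qed

section \<open>Play of continuous inputs\<close>

lemma small_oscillation:
  fixes u :: "real \<Rightarrow> real"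
  assumes "continuous_on {a..b} u" "e > 0"
  obtains d where "d > 0" "\<And>s t. a \<le> s \<Longrightarrow> s \<le> t \<Longrightarrow> t \<le> b \<Longrightarrow> t - s \<le> d \<Longrightarrow> icc_max u s t - icc_min u s t < e"
proof -
  have "uniformly_continuous_on {a..b} u"
    using assms by (auto intro: compact_uniformly_continuous)
  then obtain d where d: "d > 0"
    "\<And>x y. x \<in> {a..b} \<Longrightarrow> y \<in> {a..b} \<Longrightarrow> dist y x < d \<Longrightarrow> dist (u y) (u x) < e"
    using assms(2) unfolding uniformly_continuous_on_def by metis
  show thesis
  proof (rule that[of "d / 2"])
    show "d / 2 > 0" using d by simp
    fix s t assume st: "a \<le> s" "s \<le> t" "t \<le> b" "t - s \<le> d / 2"
    have c: "continuous_on {s..t} u" using assms(1) st by (auto intro: continuous_on_subset)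
    obtain x where x: "x \<in> {s..t}" "u x = icc_max u s t" using icc_max_attained[OF c st(2)] .
    obtain y where y: "y \<in> {s..t}" "u y = icc_min u s t" using icc_min_attained[OF c st(2)] .
    have "dist (u x) (u y) < e"
      by (rule d(2)) (use x y st d(1) in \<open>auto simp: dist_real_def\<close>)
    then show "icc_max u s t - icc_min u s t < e" using x y by (simp add: dist_real_def)
  qed
qed

text \<open>The clamp is nonexpansive in its two bounds and its start value jointly, for the maximum
  of the three errors. So a step does not enlarge the error, and after any number of steps the
  Lipschitz constant is still 1.\<close>

lemma is_play_stable:
  assumes w1: "is_play a b r u1 w1" and w2: "is_play a b r u2 w2"
    and c1: "continuous_on {a..b} u1" and c2: "continuous_on {a..b} u2"
    and "r > 0" "\<And>t. t \<in> {a..b} \<Longrightarrow> \<bar>u1 t - u2 t\<bar> \<le> e" "\<bar>w1 a - w2 a\<bar> \<le> e"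
    and "t \<in> {a..b}"
  shows "\<bar>w1 t - w2 t\<bar> \<le> e"
proof -
  have r2: "2 * r > 0" using \<open>r > 0\<close> by simp
  obtain d1 where d1: "d1 > 0" "\<And>s t. a \<le> s \<Longrightarrow> s \<le> t \<Longrightarrow> t \<le> b \<Longrightarrow> t - s \<le> d1 \<Longrightarrow> icc_max u1 s t - icc_min u1 s t < 2 * r"
    using small_oscillation[OF c1 r2] by blast
  obtain d2 where d2: "d2 > 0" "\<And>s t. a \<le> s \<Longrightarrow> s \<le> t \<Longrightarrow> t \<le> b \<Longrightarrow> t - s \<le> d2 \<Longrightarrow> icc_max u2 s t - icc_min u2 s t < 2 * r"
    using small_oscillation[OF c2 r2] by blast
  define d where "d = min d1 d2"
  have "d > 0" using d1 d2 by (simp add: d_def)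
  \<comment> \<open>Induction on the number of steps of length \<open>d\<close>, on which both
    inputs oscillate by less than \<open>2 * r\<close>.\<close>
  have claim: "\<forall>t\<in>{a..b}. t \<le> a + real n * d \<longrightarrow> \<bar>w1 t - w2 t\<bar> \<le> e" for n
  proof (induction n)
    case 0
    then show ?case using assms by auto
  next
    case (Suc n)
    show ?case
    proof (intro ballI impI)
      fix t assume t: "t \<in> {a..b}" "t \<le> a + real (Suc n) * d"
      define s where "s = max a (t - d)"
      have s: "a \<le> s" "s \<le> t" "t \<le> b" "t - s \<le> d" using t \<open>d > 0\<close> by (auto simp: s_def)
      have "\<bar>w1 s - w2 s\<bar> \<le> e"
        using Suc.IH s t assms(7) by (auto simp: s_def max_def algebra_simps split: if_splits)
      moreover have "w1 t = max (icc_max u1 s t - r) (min (icc_min u1 s t + r) (w1 s))"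
        using w1 d1(2)[of s t] s unfolding is_play_def d_def by auto
      moreover have "w2 t = max (icc_max u2 s t - r) (min (icc_min u2 s t + r) (w2 s))"
        using w2 d2(2)[of s t] s unfolding is_play_def d_def by auto
      moreover have cs: "continuous_on {s..t} u1" "continuous_on {s..t} u2"
        using c1 c2 s by (auto intro: continuous_on_subset)
      have "\<bar>icc_max u1 s t - icc_max u2 s t\<bar> \<le> e" "\<bar>icc_min u1 s t - icc_min u2 s t\<bar> \<le> e"
        using assms(6) s icc_max_dist_le[OF cs s(2)] icc_min_dist_le[OF cs s(2)] by auto
      ultimately show "\<bar>w1 t - w2 t\<bar> \<le> e" by (auto simp: max_def min_def abs_if split: if_splits)
    qed
  qed
  obtain n where "(t - a) / d \<le> real n" using real_arch_simple by blast
  then have "t \<le> a + real n * d" using \<open>d > 0\<close> by (simp add: field_simps)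
  with claim[of n] assms(8) show ?thesis by auto
qed

text \<open>Since \<open>w s\<close> lies within \<open>r\<close> of \<open>u s\<close>, the clamp
  moves it by at most the oscillation of \<open>u\<close> on \<open>[s,t]\<close>.\<close>

lemma is_play_continuous:
  assumes w: "is_play a b r u w" and c: "continuous_on {a..b} u" and "r > 0"
  shows "continuous_on {a..b} w"
proof -
  have ucont: "\<exists>d>0. \<forall>s\<in>{a..b}. \<forall>t\<in>{a..b}. s \<le> t \<and> t - s < d \<longrightarrow> \<bar>w t - w s\<bar> < e" if "e > 0" for e
  proof -
    have "min e (2 * r) > 0" using that \<open>r > 0\<close> by simp
    then obtain d where d: "d > 0" "\<And>s t. a \<le> s \<Longrightarrow> s \<le> t \<Longrightarrow> t \<le> b \<Longrightarrow> t - s \<le> d \<Longrightarrow> icc_max u s t - icc_min u s t < min e (2 * r)"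
      using small_oscillation[OF c] by blast
    have "\<bar>w t - w s\<bar> < e" if st: "s \<in> {a..b}" "t \<in> {a..b}" "s \<le> t" "t - s < d" for s t
    proof -
      have o: "icc_max u s t - icc_min u s t < min e (2 * r)" using d(2)[of s t] st by auto
      then have "w t = max (icc_max u s t - r) (min (icc_min u s t + r) (w s))"
        using w st unfolding is_play_def by auto
      moreover have "\<bar>u s - w s\<bar> \<le> r" using w st unfolding is_play_def by auto
      moreover have cs: "continuous_on {s..t} u" using c st by (auto intro: continuous_on_subset)
      have "u s \<le> icc_max u s t" "icc_min u s t \<le> u s"
        using icc_max_upper[OF cs] icc_min_lower[OF cs] st by auto
      ultimately show ?thesis using o \<open>e > 0\<close> by (auto simp: max_def min_def abs_if split: if_splits)
    qed
    then show ?thesis using d(1) by blast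
  qed
  show ?thesis unfolding continuous_on_iff
  proof (intro ballI allI impI)
    fix x e :: real assume x: "x \<in> {a..b}" "e > 0"
    obtain d where "d > 0" and d: "\<forall>s\<in>{a..b}. \<forall>t\<in>{a..b}. s \<le> t \<and> t - s < d \<longrightarrow> \<bar>w t - w s\<bar> < e"
      using ucont[OF x(2)] by blast
    have "dist (w y) (w x) < e" if y: "y \<in> {a..b}" "dist y x < d" for y
      using d[rule_format, of x y] d[rule_format, of y x] x y 
      by (cases "x \<le> y") (auto simp: dist_real_def abs_minus_commute)
    then show "\<exists>d>0. \<forall>x'\<in>{a..b}. dist x' x < d \<longrightarrow> dist (w x') (w x) < e" using \<open>d > 0\<close> by blast
  qed
qed

section \<open>Approximation by piecewise monotone inputs\<close>

lemma pm_play_exists: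
  assumes c: "continuous_on {a..b} u" and p: "is_partition a b m s"
    and mon: "\<And>i. i < m \<Longrightarrow> mono_on {s i..s (Suc i)} u \<or> antimono_on {s i..s (Suc i)} u"
  shows "\<exists>w. pm_play a b r u z w"
proof -
  have s0: "s 0 = a" and inc: "\<And>i. i < m \<Longrightarrow> s i < s (Suc i)"
    using p unfolding is_partition_def by auto
  note mono = is_partition_mono[OF p]
  have "\<exists>w. w a = u a - proj r z \<and>
          (\<forall>i<k. \<forall>t\<in>{s i<..s (Suc i)}. w t = max (u t - r) (min (u t + r) (w (s i))))" if "k \<le> m" for k
    using that
  proof (induction k)
    case 0
    then show ?case by auto
  next
    case (Suc k)
    then obtain w where w: "w a = u a - proj r z"
      "\<And>i t. i < k \<Longrightarrow> t \<in> {s i<..s (Suc i)} \<Longrightarrow> w t = max (u t - r) (min (u t + r) (w (s i)))"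
      by auto
    define w' where "w' t = (if t \<le> s k then w t else max (u t - r) (min (u t + r) (w (s k))))" for t
    have "a \<le> s k" using mono[of 0 k] s0 Suc.prems by auto
    then have "w' a = u a - proj r z" by (simp add: w'_def w)
    moreover have "w' t = max (u t - r) (min (u t + r) (w' (s i)))" if it: "i < Suc k" "t \<in> {s i<..s (Suc i)}" for i t
    proof (cases "i = k")
      case True
      then show ?thesis using it by (auto simp: w'_def)
    next
      case False
      then have "i < k" "s (Suc i) \<le> s k" "s i \<le> s k" using it mono[of "Suc i" k] mono[of i k] Suc.prems by auto
      then show ?thesis using w(2)[of i t] it by (auto simp: w'_def)
    qed
    ultimately show ?case by blast
  qed
  from this[of m] show ?thesis using c p mon unfolding pm_play_def by blast
qed

text \<open>Linear interpolation on a uniform grid: each cell is monotone, and on a cell both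
  \<open>U\<close> and \<open>u\<close> take values between the extrema of \<open>u\<close>, which
  differ by less than \<open>e\<close>.\<close>

lemma piecewise_linear_approximation:
  fixes u :: "real \<Rightarrow> real"
  assumes c: "continuous_on {a..b} u" and "a < b" "e > 0"
  obtains U m s where "continuous_on {a..b} U" "is_partition a b m s"
    "\<And>i. i < m \<Longrightarrow> mono_on {s i..s (Suc i)} U \<or> antimono_on {s i..s (Suc i)} U"
    "\<And>t. t \<in> {a..b} \<Longrightarrow> \<bar>U t - u t\<bar> \<le> e"
proof -
  obtain d where d: "d > 0" "\<And>s t. a \<le> s \<Longrightarrow> s \<le> t \<Longrightarrow> t \<le> b \<Longrightarrow> t - s \<le> d \<Longrightarrow> icc_max u s t - icc_min u s t < e"
    using small_oscillation[OF c \<open>e > 0\<close>] by blast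
  obtain n where n: "(b - a) / d < real n" using reals_Archimedean2 by blast
  have "(b - a) / d > 0" using d \<open>a < b\<close> by simp
  then have n0: "real n > 0" using n by linarith
  define h where "h = (b - a) / real n"
  have h: "h > 0" "h \<le> d" using n n0 \<open>a < b\<close> d by (auto simp: h_def field_simps)
  define s where "s i = a + real i * h" for i
  have sS: "s (Suc i) = s i + h" for i by (simp add: s_def algebra_simps)
  have s0: "s 0 = a" "s n = b" using n0 by (auto simp: s_def h_def)
  have smono: "s i \<le> s j" if "i \<le> j" for i j using that h by (auto simp: s_def mult_right_mono)
  define L where "L i t = u (s i) + (t - s i) / h * (u (s (Suc i)) - u (s i))" for i t
  define U where "U t = L (nat \<lfloor>(t - a) / h\<rfloor>) t" for t
  have UL: "U t = L i t" if t: "t \<in> {s i..s (Suc i)}" for i t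
  proof (cases "t = s (Suc i)")
    \<comment> \<open>At the right end of cell \<open>i\<close> the floor already selects cell
      \<open>Suc i\<close>; both interpolants have the same value there.\<close>
    case True
    then have "(t - a) / h = of_nat (Suc i)" using h by (simp add: s_def)
    then have "nat \<lfloor>(t - a) / h\<rfloor> = Suc i" by (simp only: floor_of_nat nat_int)
    then show ?thesis using True h sS[of i] unfolding U_def L_def by simp
  next
    case False
    have "\<lfloor>(t - a) / h\<rfloor> = int i"
      by (rule floor_unique) (use t False h in \<open>auto simp: s_def field_simps\<close>)
    then show ?thesis unfolding U_def by simp
  qed
  have Lcont: "continuous_on {s i..s (Suc i)} U" for i
  proof -
    have "continuous_on {s i..s (Suc i)} (L i)" unfolding L_def using h by (auto intro!: continuous_intros)
    then show ?thesis using UL[of _ i] continuous_on_cong[of "{s i..s (Suc i)}" "{s i..s (Suc i)}" U "L i"] by auto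
  qed
  have "continuous_on {a..s k} U" for k
  proof (induction k)
    case 0
    then show ?case using s0 by simp
  next
    case (Suc k)
    have "{a..s (Suc k)} = {a..s k} \<union> {s k..s (Suc k)}"
      using smono[of 0 k] smono[of k "Suc k"] s0 by auto
    then show ?case using continuous_on_closed_Un[of "{a..s k}" "{s k..s (Suc k)}" U] Suc Lcont[of k] by auto
  qed
  from this[of n] have cU: "continuous_on {a..b} U" using s0 by simp
  have part: "is_partition a b n s" using s0 h sS unfolding is_partition_def by auto
  have mon: "mono_on {s i..s (Suc i)} U \<or> antimono_on {s i..s (Suc i)} U" for i
  proof (cases "u (s i) \<le> u (s (Suc i))")
    case True
    then have "mono_on {s i..s (Suc i)} U" using h
      by (auto simp: mono_on_def UL[of _ i] L_def intro!: mult_right_mono divide_right_mono)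
    then show ?thesis ..
  next
    case False
    then have "antimono_on {s i..s (Suc i)} U" using h
      by (auto simp: monotone_on_def UL[of _ i] L_def intro!: mult_right_mono_neg divide_right_mono)
    then show ?thesis ..
  qed
  have near: "\<bar>U t - u t\<bar> \<le> e" if t: "t \<in> {a..b}" for t
  proof -
    have "\<exists>i<n. t \<in> {s i..s (Suc i)}"
    \<comment> \<open>At \<open>b\<close> the floor would select cell \<open>n\<close>, which lies
      beyond the last one.\<close>
    proof (cases "t = b")
      case True
      then show ?thesis using n0 s0 sS h smono[of "n - 1" n] by (intro exI[of _ "n - 1"]) auto
    next
      case False
      define i where "i = nat \<lfloor>(t - a) / h\<rfloor>"
      have "(t - a) / h \<ge> 0" using t h by auto
      then have "real i = of_int \<lfloor>(t - a) / h\<rfloor>" unfolding i_def by simp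
      then have i: "real i \<le> (t - a) / h" "(t - a) / h < real i + 1" by linarith+
      have "t < b" using t False by auto
      then have "(t - a) / h < real n" using h n0 by (simp add: h_def field_simps)
      then have "i < n" using i by linarith
      then show ?thesis using i h by (intro exI[of _ i]) (auto simp: s_def field_simps)
    qed
    then obtain i where i: "i < n" "t \<in> {s i..s (Suc i)}" by blast
    have si: "a \<le> s i" "s i \<le> s (Suc i)" "s (Suc i) \<le> b"
      using smono[of 0 i] smono[of i "Suc i"] smono[of "Suc i" n] s0 i by auto
    have cc: "continuous_on {s i..s (Suc i)} u" using c si by (auto intro: continuous_on_subset)
    have o: "icc_max u (s i) (s (Suc i)) - icc_min u (s i) (s (Suc i)) < e" using d(2)[of "s i" "s (Suc i)"] si sS[of i] h by auto
    have B: "u x \<in> {icc_min u (s i) (s (Suc i))..icc_max u (s i) (s (Suc i))}" if "x \<in> {s i..s (Suc i)}" for x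
      using icc_max_upper[OF cc that] icc_min_lower[OF cc that] by auto
    define l where "l = (t - s i) / h"
    have l: "0 \<le> l" "l \<le> 1" using i h sS[of i] by (auto simp: l_def field_simps)
    have "U t = (1 - l) * u (s i) + l * u (s (Suc i))" using UL[OF i(2)] by (simp add: L_def l_def algebra_simps)
    moreover have "(1 - l) * u (s i) + l * u (s (Suc i)) \<in> {icc_min u (s i) (s (Suc i))..icc_max u (s i) (s (Suc i))}"
      using convexD[OF convex_real_interval(5)[of "icc_min u (s i) (s (Suc i))" "icc_max u (s i) (s (Suc i))"] B[of "s i"] B[of "s (Suc i)"], of "1 - l" l] l si by auto
    ultimately show ?thesis using B[OF i(2)] o by auto
  qed
  show thesis using that[OF cU part mon near] by blast
qed

lemma pm_play_sequence:
  fixes u :: "real \<Rightarrow> real"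
  assumes c: "continuous_on {a..b} u" and "a < b"
  obtains U W where "\<And>n. pm_play a b r (U n) z (W n)"
    "\<And>n t. t \<in> {a..b} \<Longrightarrow> \<bar>U n t - u t\<bar> \<le> 1 / real (Suc n)"
proof -
  have "\<exists>U w. pm_play a b r U z w \<and> (\<forall>t\<in>{a..b}. \<bar>U t - u t\<bar> \<le> 1 / real (Suc n))" for n
  proof -
    obtain U m s where U: "continuous_on {a..b} U" "is_partition a b m s"
    "\<And>i. i < m \<Longrightarrow> mono_on {s i..s (Suc i)} U \<or> antimono_on {s i..s (Suc i)} U"
    "\<And>t. t \<in> {a..b} \<Longrightarrow> \<bar>U t - u t\<bar> \<le> 1 / real (Suc n)"
      using piecewise_linear_approximation[OF c \<open>a < b\<close>, of "1 / real (Suc n)"] by auto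
    then show ?thesis using pm_play_exists[OF U(1-3)] by blast
  qed
  then show thesis using that by metis
qed

lemma proj_lipschitz: "\<bar>proj r z - proj r z'\<bar> \<le> \<bar>z - z'\<bar>"
  unfolding proj_def by (auto simp: max_def min_def)

text \<open>Stability makes the outputs of the approximations Cauchy at every time. If
  \<open>u\<close> oscillates by less than \<open>2 * r\<close> on \<open>[s,t]\<close>, so do
  eventually its approximations, and the clamp rule passes to the limit.\<close>

lemma is_play_exists:
  assumes c: "continuous_on {a..b} u" and "a < b" "r > 0"
  obtains w where "is_play a b r u w" "w a = u a - proj r z"
proof -
  obtain U W where UW: "\<And>n. pm_play a b r (U n) z (W n)"
    "\<And>n t. t \<in> {a..b} \<Longrightarrow> \<bar>U n t - u t\<bar> \<le> 1 / real (Suc n)"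
    using pm_play_sequence[OF c \<open>a < b\<close>] by metis
  note W = pm_play_is_play[OF UW(1) \<open>r > 0\<close>]
  have U_lim: "(\<lambda>n. U n t) \<longlonglongrightarrow> u t" if "t \<in> {a..b}" for t
  proof -
    have "(\<lambda>n. U n t - u t) \<longlonglongrightarrow> 0"
      by (rule Lim_null_comparison[OF _ LIMSEQ_Suc[OF lim_1_over_n]]) (use UW(2)[OF that] in auto)
    then show ?thesis by (simp add: LIM_zero_iff)
  qed
  have dW: "\<bar>W n t - W m t\<bar> \<le> 1 / real (Suc n) + 1 / real (Suc m)" if "t \<in> {a..b}" for n m t
  proof (rule is_play_stable[OF W(1) W(1) W(3) W(3) \<open>r > 0\<close> _ _ that])
    show dU: "\<bar>U n t - U m t\<bar> \<le> 1 / real (Suc n) + 1 / real (Suc m)" if "t \<in> {a..b}" for t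
      using UW(2)[OF that, of n] UW(2)[OF that, of m] by linarith
    show "\<bar>W n a - W m a\<bar> \<le> 1 / real (Suc n) + 1 / real (Suc m)"
      using dU[of a] \<open>a < b\<close> by (simp add: W(2))
  qed
  have "convergent (\<lambda>n. W n t)" if t: "t \<in> {a..b}" for t
  proof (rule Cauchy_convergent, rule CauchyI)
    fix e :: real assume "e > 0"
    then obtain M where M: "1 / real (Suc M) < e / 2" using nat_approx_posE[of "e/2"] by auto
    have "norm (W m t - W n t) < e" if mn: "m \<ge> M" "n \<ge> M" for m n
    proof -
      have "1 / real (Suc m) \<le> 1 / real (Suc M)" "1 / real (Suc n) \<le> 1 / real (Suc M)"
        using mn by (auto simp: field_simps)
      then show ?thesis using dW[OF t, of m n] M by (simp del: of_nat_Suc)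
    qed
    then show "\<exists>M. \<forall>m\<ge>M. \<forall>n\<ge>M. norm (W m t - W n t) < e" by blast
  qed
  then have W_lim: "(\<lambda>n. W n t) \<longlonglongrightarrow> lim (\<lambda>n. W n t)" if "t \<in> {a..b}" for t
    using that by (simp add: convergent_LIMSEQ_iff)
  define w where "w t = lim (\<lambda>n. W n t)" for t
  note W_lim = W_lim[folded w_def]
  have a: "a \<in> {a..b}" using \<open>a < b\<close> by auto
  have "w a = u a - proj r z"
    by (rule LIMSEQ_unique[OF W_lim[OF a]]) (use U_lim[OF a] in \<open>auto simp: W(2) intro!: tendsto_intros\<close>)
  moreover have "is_play a b r u w"
    unfolding is_play_def
  proof (intro conjI ballI allI impI)
    fix t assume t: "t \<in> {a..b}"
    have "(\<lambda>n. \<bar>U n t - W n t\<bar>) \<longlonglongrightarrow> \<bar>u t - w t\<bar>" by (intro tendsto_intros U_lim W_lim t)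
    then show "\<bar>u t - w t\<bar> \<le> r"
      by (rule LIMSEQ_le_const2) (use W(1) t in \<open>auto simp: is_play_def\<close>)
  next
    fix s t assume st: "a \<le> s" "s \<le> t" "t \<le> b" and small: "icc_max u s t - icc_min u s t < 2 * r"
    have cs: "continuous_on {s..t} (U n)" "continuous_on {s..t} u" for n
      using W(3)[of n] c st by (auto intro: continuous_on_subset)
    have x0: "(\<lambda>n. 1 / real (Suc n)) \<longlonglongrightarrow> 0" using LIMSEQ_Suc[OF lim_1_over_n] .
    have "(\<lambda>n. icc_max (U n) s t - icc_max u s t) \<longlonglongrightarrow> 0"
      by (rule Lim_null_comparison[OF always_eventually x0])
         (use icc_max_dist_le[OF cs st(2)] UW(2) st in auto)
    then have 1: "(\<lambda>n. icc_max (U n) s t) \<longlonglongrightarrow> icc_max u s t" by (simp add: LIM_zero_iff)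
    have "(\<lambda>n. icc_min (U n) s t - icc_min u s t) \<longlonglongrightarrow> 0"
      by (rule Lim_null_comparison[OF always_eventually x0])
         (use icc_min_dist_le[OF cs st(2)] UW(2) st in auto)
    then have 2: "(\<lambda>n. icc_min (U n) s t) \<longlonglongrightarrow> icc_min u s t" by (simp add: LIM_zero_iff)
    have "\<forall>\<^sub>F n in sequentially. icc_max (U n) s t - icc_min (U n) s t < 2 * r"
      by (rule order_tendstoD(2)[OF tendsto_diff[OF 1 2] small])
    then have ev: "\<forall>\<^sub>F n in sequentially. W n t = max (icc_max (U n) s t - r) (min (icc_min (U n) s t + r) (W n s))"
      by eventually_elim (use W(1) st in \<open>auto simp: is_play_def\<close>)
    have "(\<lambda>n. max (icc_max (U n) s t - r) (min (icc_min (U n) s t + r) (W n s))) \<longlonglongrightarrow>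
             max (icc_max u s t - r) (min (icc_min u s t + r) (w s))"
      by (intro tendsto_intros 1 2 W_lim) (use st in auto)
    then have "(\<lambda>n. W n t) \<longlonglongrightarrow> max (icc_max u s t - r) (min (icc_min u s t + r) (w s))"
      using tendsto_cong[OF ev] by simp
    then show "w t = max (icc_max u s t - r) (min (icc_min u s t + r) (w s))"
      using LIMSEQ_unique W_lim[of t] st by auto
  qed
  ultimately show thesis using that by blast
qed

text \<open>Resolves the definite description behind \<open>play\<close>; from here on only
  \<open>is_play\<close> and the initial value are used. By stability an \<open>is_play\<close>
  output is the uniform limit along every approximation of the data.\<close>

lemma play_is_play:
  assumes c: "continuous_on {a..b} u" and "a < b" "r > 0"
  shows "is_play a b r u (play a b r u z)" "play a b r u z a = u a - proj r z"
proof -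
  obtain w1 where w1: "is_play a b r u w1" "w1 a = u a - proj r z"
    using is_play_exists[OF assms] by blast
  define w where "w t = (if t \<in> {a..b} then w1 t else 0)" for t
  have w: "is_play a b r u w" "w a = u a - proj r z"
    using w1 \<open>a < b\<close> unfolding w_def is_play_def by auto
  have conv: "uniform_limit {a..b} W w sequentially"
    if pm: "\<And>n. pm_play a b r (U n) (Z n) (W n)" and U: "uniform_limit {a..b} U u sequentially"
      and Z: "Z \<longlonglongrightarrow> z" for U Z W
  proof (rule uniform_limitI)
    fix e :: real assume "e > 0"
    then have "e / 3 > 0" by simp
    have "\<forall>\<^sub>F n in sequentially. \<forall>t\<in>{a..b}. dist (U n t) (u t) < e / 3"
      using uniform_limitD[OF U \<open>e / 3 > 0\<close>] .
    moreover have "\<forall>\<^sub>F n in sequentially. dist (Z n) z < e / 3"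
      using tendstoD[OF Z \<open>e / 3 > 0\<close>] .
    ultimately show "\<forall>\<^sub>F n in sequentially. \<forall>t\<in>{a..b}. dist (W n t) (w t) < e"
    proof eventually_elim
      case (elim n)
      note W = pm_play_is_play[OF pm \<open>r > 0\<close>]
      \<comment> \<open>At \<open>a\<close> the errors of the input and of the projected initial
        value add up, each below \<open>e / 3\<close>.\<close>
      have "\<bar>W n t - w t\<bar> \<le> 2 * (e / 3)" if "t \<in> {a..b}" for t
      proof (rule is_play_stable[OF W(1) w(1) W(3) c \<open>r > 0\<close> _ _ that])
        show "\<bar>U n t - u t\<bar> \<le> 2 * (e / 3)" if "t \<in> {a..b}" for t
          using elim(1) that \<open>e > 0\<close> by (force simp: dist_real_def)
        have "\<bar>U n a - u a\<bar> < e / 3" using elim(1) \<open>a < b\<close> by (auto simp: dist_real_def)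
        moreover have "\<bar>proj r (Z n) - proj r z\<bar> < e / 3"
          using proj_lipschitz[of r "Z n" z] elim(2) by (simp add: dist_real_def)
        ultimately show "\<bar>W n a - w a\<bar> \<le> 2 * (e / 3)" unfolding W(2) w(2) by linarith
      qed
      then show ?case using \<open>e > 0\<close> by (force simp: dist_real_def)
    qed
  qed
  have "play a b r u z = w"
    unfolding play_def
  proof (rule the_equality)
    show "(\<forall>t. t \<notin> {a..b} \<longrightarrow> w t = 0) \<and> (\<forall>U Z W. (\<forall>n. pm_play a b r (U n) (Z n) (W n)) \<and>
        uniform_limit {a..b} U u sequentially \<and> Z \<longlonglongrightarrow> z \<longrightarrow> uniform_limit {a..b} W w sequentially)"
      using conv by (auto simp: w_def)
    fix w' assume w': "(\<forall>t. t \<notin> {a..b} \<longrightarrow> w' t = 0) \<and> (\<forall>U Z W. (\<forall>n. pm_play a b r (U n) (Z n) (W n)) \<and>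
        uniform_limit {a..b} U u sequentially \<and> Z \<longlonglongrightarrow> z \<longrightarrow> uniform_limit {a..b} W w' sequentially)"
    \<comment> \<open>Uniqueness needs one actual approximating sequence; otherwise the limit
      condition on \<open>w'\<close> would be vacuous.\<close>
    obtain U W where UW: "\<And>n. pm_play a b r (U n) z (W n)"
      "\<And>n t. t \<in> {a..b} \<Longrightarrow> \<bar>U n t - u t\<bar> \<le> 1 / real (Suc n)"
      using pm_play_sequence[OF c \<open>a < b\<close>] by metis
    have U: "uniform_limit {a..b} U u sequentially"
    proof (rule uniform_limitI)
      fix e :: real assume "e > 0"
      then have "\<forall>\<^sub>F n in sequentially. 1 / real (Suc n) < e"
        using order_tendstoD(2)[OF LIMSEQ_Suc[OF lim_1_over_n]] by blast
      then show "\<forall>\<^sub>F n in sequentially. \<forall>t\<in>{a..b}. dist (U n t) (u t) < e"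
      proof eventually_elim
        case (elim n)
        then show ?case using UW(2)[of _ n] by (simp add: dist_real_def del: of_nat_Suc) (meson atLeastAtMost_iff order_le_less_trans)
      qed
    qed
    have "uniform_limit {a..b} W w sequentially" using conv[OF UW(1) U tendsto_const] .
    moreover have "(\<forall>n. pm_play a b r (U n) ((\<lambda>_. z) n) (W n)) \<and> uniform_limit {a..b} U u sequentially \<and> ((\<lambda>_. z) \<longlonglongrightarrow> z)"
      using UW(1) U by simp
    then have "uniform_limit {a..b} W w' sequentially" using w' by fast
    ultimately have "w' t = w t" if "t \<in> {a..b}" for t
      using that tendsto_uniform_limitI LIMSEQ_unique by metis
    then show "w' = w" using w' by (auto simp: w_def fun_eq_iff)
  qed
  then show "is_play a b r u (play a b r u z)" "play a b r u z a = u a - proj r z"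
    using w by simp_all
qed

section \<open>Local formulas and expansions\<close>

lemma SUP_add_const:
  fixes f :: "'a \<Rightarrow> real"
  assumes "S \<noteq> {}" "bdd_above (f ` S)"
  shows "(SUP x\<in>S. f x + k) = (SUP x\<in>S. f x) + k"
  using continuous_at_Sup_mono[of "\<lambda>x. x + k" "f ` S"] assms
  by (simp add: monoI image_image continuous_intros)

lemma SUP_mult_const:
  fixes f :: "'a \<Rightarrow> real"
  assumes "S \<noteq> {}" "bdd_above (f ` S)" "0 \<le> l"
  shows "(SUP x\<in>S. l * f x) = l * (SUP x\<in>S. f x)"
  using continuous_at_Sup_mono[of "\<lambda>x. l * x" "f ` S"] assms
  by (simp add: monoI image_image continuous_intros mult_left_mono)

lemma cts_bdd_above_image:
  fixes f :: "real \<Rightarrow> real"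
  assumes "continuous_on {s..t} f" "S \<subseteq> {s..t}"
  shows "bdd_above (f ` S)"
proof -
  have "compact (f ` {s..t})" using assms(1) by (intro compact_continuous_image) auto
  then show ?thesis
    by (rule bdd_above_mono[OF bounded_imp_bdd_above[OF compact_imp_bounded] image_mono[OF assms(2)]])
qed

lemma sup_norm_upper:
  assumes "continuous_on {a..b} h" "t \<in> {a..b}"
  shows "\<bar>h t\<bar> \<le> sup_norm a b h"
  unfolding sup_norm_def
  by (rule cSUP_upper[OF assms(2) cts_bdd_above_image]) (use assms in \<open>auto intro!: continuous_intros\<close>)

text \<open>
  The filter \<open>F\<close> may express smallness of the increment in a weaker norm than the norm \<open>n\<close> that bounds the
  remainder.
\<close>

definition b_expansion :: "'a filter \<Rightarrow> ('a \<Rightarrow> real) \<Rightarrow> ('a \<Rightarrow> real) \<Rightarrow> real \<Rightarrow> ('a \<Rightarrow> real) \<Rightarrow> bool" where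
  "b_expansion F n f f0 D \<longleftrightarrow>
     (f \<longlongrightarrow> f0) F \<and> (\<forall>e>0. \<forall>\<^sub>F p in F. \<bar>f p - f0 - D p\<bar> \<le> e * n p)"

section \<open>Calculus of first-order expansions\<close>

lemma b_expansionI:
  assumes "(f \<longlongrightarrow> f0) F" "\<And>e. e > 0 \<Longrightarrow> \<forall>\<^sub>F p in F. \<bar>f p - f0 - D p\<bar> \<le> e * n p"
  shows "b_expansion F n f f0 D"
  using assms unfolding b_expansion_def by blast

lemma b_expansionD:
  assumes "b_expansion F n f f0 D"
  shows "(f \<longlongrightarrow> f0) F" "e > 0 \<Longrightarrow> \<forall>\<^sub>F p in F. \<bar>f p - f0 - D p\<bar> \<le> e * n p"
  using assms unfolding b_expansion_def by blast+

lemma b_expansion_cong: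
  assumes "b_expansion F n f f0 D" "\<forall>\<^sub>F p in F. f p = g p" "f0 = g0" "\<forall>\<^sub>F p in F. D p = E p"
  shows "b_expansion F n g g0 E"
proof (rule b_expansionI)
  show "(g \<longlongrightarrow> g0) F" using b_expansionD(1)[OF assms(1)] tendsto_cong[OF assms(2)] assms(3) by simp
  fix e :: real assume "e > 0"
  from b_expansionD(2)[OF assms(1) this] assms(2,4)
  show "\<forall>\<^sub>F p in F. \<bar>g p - g0 - E p\<bar> \<le> e * n p"
    by eventually_elim (use assms(3) in simp)
qed

lemma b_expansion_add:
  assumes "b_expansion F n f f0 D" "b_expansion F n g g0 E"
  shows "b_expansion F n (\<lambda>p. f p + g p) (f0 + g0) (\<lambda>p. D p + E p)"
proof (rule b_expansionI)
  show "((\<lambda>p. f p + g p) \<longlongrightarrow> f0 + g0) F"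
    by (intro tendsto_add b_expansionD(1)[OF assms(1)] b_expansionD(1)[OF assms(2)])
  fix e :: real assume "e > 0"
  then have "e / 2 > 0" by simp
  from b_expansionD(2)[OF assms(1) this] b_expansionD(2)[OF assms(2) this]
  show "\<forall>\<^sub>F p in F. \<bar>f p + g p - (f0 + g0) - (D p + E p)\<bar> \<le> e * n p"
    by eventually_elim arith
qed

lemma b_expansion_diff:
  assumes "b_expansion F n f f0 D" "b_expansion F n g g0 E"
  shows "b_expansion F n (\<lambda>p. f p - g p) (f0 - g0) (\<lambda>p. D p - E p)"
proof (rule b_expansionI)
  show "((\<lambda>p. f p - g p) \<longlongrightarrow> f0 - g0) F"
    by (intro tendsto_diff b_expansionD(1)[OF assms(1)] b_expansionD(1)[OF assms(2)])
  fix e :: real assume "e > 0"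
  then have "e / 2 > 0" by simp
  from b_expansionD(2)[OF assms(1) this] b_expansionD(2)[OF assms(2) this]
  show "\<forall>\<^sub>F p in F. \<bar>f p - g p - (f0 - g0) - (D p - E p)\<bar> \<le> e * n p"
    by eventually_elim arith
qed

lemma b_expansion_diff_const:
  assumes "b_expansion F n f f0 D"
  shows "b_expansion F n (\<lambda>p. f p - k) (f0 - k) D"
proof (rule b_expansionI)
  show "((\<lambda>p. f p - k) \<longlongrightarrow> f0 - k) F"
    by (intro tendsto_diff b_expansionD(1)[OF assms(1)] tendsto_const)
qed (use b_expansionD(2)[OF assms] in simp)

text \<open>For \<open>f0\<close> nonzero, convergence of \<open>f\<close> fixes the sign, and the
  positive part is locally affine. At \<open>f0 = 0\<close> the positive part is its own derivative
  and 1-Lipschitz, so it inherits the remainder of \<open>f\<close>. The convergence is a separate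
  clause of \<open>b_expansion\<close> because \<open>n p\<close> need not become small along
  \<open>F\<close>, so the remainder bound alone would not give it.\<close>

lemma b_expansion_max0:
  assumes "b_expansion F n f f0 D"
  shows "b_expansion F n (\<lambda>p. max 0 (f p)) (max 0 f0) (\<lambda>p. pos_deriv f0 (D p))"
proof (rule b_expansionI)
  note lim = b_expansionD(1)[OF assms]
  show "((\<lambda>p. max 0 (f p)) \<longlongrightarrow> max 0 f0) F"
    by (intro tendsto_max lim tendsto_const)
  fix e :: real assume "e > 0"
  note R = b_expansionD(2)[OF assms this]
  consider "f0 < 0" | "f0 = 0" | "f0 > 0" by linarith
  then show "\<forall>\<^sub>F p in F. \<bar>max 0 (f p) - max 0 f0 - pos_deriv f0 (D p)\<bar> \<le> e * n p"
  proof cases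
    case 1
    from order_tendstoD(2)[OF lim 1] R show ?thesis
      by eventually_elim (use 1 in \<open>auto simp: pos_deriv_def\<close>)
  next
    case 2
    from R show ?thesis
      by eventually_elim (use 2 in \<open>auto simp: pos_deriv_def max_def abs_if split: if_splits\<close>)
  next
    case 3
    from order_tendstoD(1)[OF lim 3] R show ?thesis
      by eventually_elim (use 3 in \<open>auto simp: pos_deriv_def\<close>)
  qed
qed

text \<open>The points at distance at least \<open>\<eta>\<close> from all maximizers form a compact
  set \<open>K\<close> without maximizers. If \<open>K\<close> is nonempty, the maximum of
  \<open>u\<close> over it stays below the overall maximum by a positive gap, which serves as
  \<open>d\<close>.\<close>

lemma near_maximizer:
  assumes c: "continuous_on {s..t} u" "s \<le> t" and "\<eta> > 0"
  obtains d where "d > 0" "\<And>x. x \<in> {s..t} \<Longrightarrow> u x > icc_max u s t - d \<Longrightarrow>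
     \<exists>m\<in>{s..t}. u m = icc_max u s t \<and> \<bar>x - m\<bar> < \<eta>"
proof -
  define M where "M = {m\<in>{s..t}. u m = icc_max u s t}"
  define K where "K = {s..t} \<inter> (\<Inter>m\<in>M. {x. \<eta> \<le> \<bar>x - m\<bar>})"
  have "compact K" unfolding K_def
    by (intro compact_Int_closed closed_INT ballI closed_Collect_le continuous_intros) auto
  have cK: "continuous_on K u" by (rule continuous_on_subset[OF c(1)]) (auto simp: K_def)
  show thesis
  proof (cases "K = {}")
    case True
    show thesis
    proof (rule that[of 1])
      fix x assume "x \<in> {s..t}"
      moreover from this True have "x \<notin> K" by simp
      ultimately show "\<exists>m\<in>{s..t}. u m = icc_max u s t \<and> \<bar>x - m\<bar> < \<eta>"
        by (auto simp: K_def M_def not_le)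
    qed simp
  next
    case False
    then obtain k where k: "k \<in> K" "\<And>x. x \<in> K \<Longrightarrow> u x \<le> u k"
      using continuous_attains_sup[OF \<open>compact K\<close> False cK] by blast
    have "k \<notin> M" using k(1) \<open>\<eta> > 0\<close> by (auto simp: K_def)
    moreover have "k \<in> {s..t}" using k(1) by (auto simp: K_def)
    moreover from this have "u k \<le> icc_max u s t" by (rule icc_max_upper[OF c(1)])
    ultimately have "u k < icc_max u s t" by (auto simp: M_def order_less_le)
    show thesis
    proof (rule that[of "icc_max u s t - u k"])
      fix x assume x: "x \<in> {s..t}" "u x > icc_max u s t - (icc_max u s t - u k)"
      then have "x \<notin> K" using k(2)[of x] by auto
      then show "\<exists>m\<in>{s..t}. u m = icc_max u s t \<and> \<bar>x - m\<bar> < \<eta>"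
        using x by (auto simp: K_def M_def not_le)
    qed (use \<open>u k < icc_max u s t\<close> in simp)
  qed
qed

text \<open>Danskin's formula with a quantitative remainder. Evaluating \<open>u + h\<close> at
  maximizers of \<open>u\<close> gives the lower bound. For the upper bound, a maximizer of
  \<open>u + h\<close> is a near-maximizer of \<open>u\<close>, hence \<open>\<eta>\<close>-close to
  a maximizer, and moving there changes \<open>h\<close> by at most \<open>E\<close>. The threshold
  \<open>d\<close> depends on \<open>u\<close> and \<open>\<eta>\<close> only, not on
  \<open>h\<close>.\<close>

lemma danskin_remainder:
  assumes c: "continuous_on {s..t} u" "s \<le> t" and "\<eta> > 0"
  obtains d where "d > 0" "\<And>h E. continuous_on {s..t} h \<Longrightarrow> (\<And>x. x \<in> {s..t} \<Longrightarrow> \<bar>h x\<bar> < d) \<Longrightarrow>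
     (\<And>x y. x \<in> {s..t} \<Longrightarrow> y \<in> {s..t} \<Longrightarrow> \<bar>x - y\<bar> < \<eta> \<Longrightarrow> \<bar>h x - h y\<bar> \<le> E) \<Longrightarrow>
     \<bar>icc_max (\<lambda>x. u x + h x) s t - icc_max u s t - (SUP m\<in>{m\<in>{s..t}. u m = icc_max u s t}. h m)\<bar> \<le> E"
proof -
  obtain d where "d > 0" and d: "\<And>x. x \<in> {s..t} \<Longrightarrow> u x > icc_max u s t - d \<Longrightarrow>
     \<exists>m\<in>{s..t}. u m = icc_max u s t \<and> \<bar>x - m\<bar> < \<eta>"
    using near_maximizer[OF assms] by blast
  show thesis
  \<comment> \<open>Halved because \<open>h\<close> is estimated at two points, a maximizer of
    \<open>u + h\<close> and one of \<open>u\<close>.\<close>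
  proof (rule that[of "d / 2"])
    fix h E
    assume ch: "continuous_on {s..t} h" and small: "\<And>x. x \<in> {s..t} \<Longrightarrow> \<bar>h x\<bar> < d / 2"
      and E: "\<And>x y. x \<in> {s..t} \<Longrightarrow> y \<in> {s..t} \<Longrightarrow> \<bar>x - y\<bar> < \<eta> \<Longrightarrow> \<bar>h x - h y\<bar> \<le> E"
    define M where "M = {m\<in>{s..t}. u m = icc_max u s t}"
    have bM: "bdd_above (h ` M)" by (rule cts_bdd_above_image[OF ch]) (auto simp: M_def)
    have neM: "M \<noteq> {}" using icc_max_attained[OF c] by (auto simp: M_def)
    have cs: "continuous_on {s..t} (\<lambda>x. u x + h x)" using c ch by (intro continuous_intros)
    have "(SUP m\<in>M. h m) \<le> icc_max (\<lambda>x. u x + h x) s t - icc_max u s t"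
    proof (rule cSUP_least[OF neM])
      fix m assume "m \<in> M"
      then show "h m \<le> icc_max (\<lambda>x. u x + h x) s t - icc_max u s t"
        using icc_max_upper[OF cs, of m] by (auto simp: M_def)
    qed
    moreover
    obtain x where x: "x \<in> {s..t}" "u x + h x = icc_max (\<lambda>x. u x + h x) s t"
      using icc_max_attained[OF cs c(2)] by blast
    obtain x' where x': "x' \<in> {s..t}" "u x' = icc_max u s t" using icc_max_attained[OF c] by blast
    have "u x' + h x' \<le> u x + h x" using icc_max_upper[OF cs x'(1)] x by simp
    then have "u x > icc_max u s t - d" using small[OF x(1)] small[OF x'(1)] x' by linarith
    then obtain m where m: "m \<in> {s..t}" "u m = icc_max u s t" "\<bar>x - m\<bar> < \<eta>" using d[OF x(1)] by blast
    then have "h m \<le> (SUP m\<in>M. h m)" by (intro cSUP_upper bM) (auto simp: M_def)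
    moreover have "\<bar>h x - h m\<bar> \<le> E" by (rule E[OF x(1) m(1,3)])
    moreover have "u x \<le> icc_max u s t" by (rule icc_max_upper[OF c(1) x(1)])
    moreover have "E \<ge> 0" using E[OF x(1) x(1)] \<open>\<eta> > 0\<close> by simp
    ultimately show "\<bar>icc_max (\<lambda>x. u x + h x) s t - icc_max u s t - (SUP m\<in>{m\<in>{s..t}. u m = icc_max u s t}. h m)\<bar> \<le> E"
      using x unfolding M_def by linarith
  qed (use \<open>d > 0\<close> in simp)
qed

text \<open>The clamp written as a sum, to which the rules for expansions apply. Oscillation below
  \<open>2 * r\<close> excludes that both positive parts are nonzero.\<close>

lemma is_play_formula:
  assumes "is_play a b r u w" "a \<le> s" "s \<le> t" "t \<le> b" "icc_max u s t - icc_min u s t < 2 * r"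
  shows "w t = w s + max 0 (icc_max u s t - r - w s) - max 0 (w s - icc_min u s t - r)"
proof -
  have "w t = max (icc_max u s t - r) (min (icc_min u s t + r) (w s))"
    using assms unfolding is_play_def by blast
  then show ?thesis using assms(5) by (auto simp: max_def min_def)
qed

section \<open>The local operators on intervals of small oscillation\<close>

lemma osc_upper:
  assumes "continuous_on {c..d} u" "x \<in> {c..d}" "y \<in> {c..d}"
  shows "u x - u y \<le> osc {c..d} u"
proof -
  have eq: "{\<bar>u t - u s\<bar> |s t. s \<in> {c..d} \<and> t \<in> {c..d}} = (\<lambda>(s, t). \<bar>u t - u s\<bar>) ` ({c..d} \<times> {c..d})"
    by (force simp: image_def)
  have "continuous_on ({c..d} \<times> {c..d}) (\<lambda>(s, t). \<bar>u t - u s\<bar>)"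
    unfolding case_prod_beta
    by (intro continuous_intros continuous_on_compose2[OF assms(1)]) auto
  then have "compact {\<bar>u t - u s\<bar> |s t. s \<in> {c..d} \<and> t \<in> {c..d}}"
    unfolding eq by (rule compact_continuous_image) (intro compact_Times compact_Icc)
  then have "bdd_above {\<bar>u t - u s\<bar> |s t. s \<in> {c..d} \<and> t \<in> {c..d}}"
    by (intro bounded_imp_bdd_above compact_imp_bounded)
  then have "\<bar>u x - u y\<bar> \<le> osc {c..d} u"
    unfolding osc_def by (rule cSup_upper[rotated]) (use assms in blast)
  then show ?thesis by linarith
qed

lemma osc_icc:
  assumes "continuous_on {c..d} u" "c \<le> s" "s \<le> t" "t \<le> d"
  shows "icc_max u s t - icc_min u s t \<le> osc {c..d} u"
proof -
  have cs: "continuous_on {s..t} u" using assms by (auto intro: continuous_on_subset)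
  obtain x where "x \<in> {s..t}" "u x = icc_max u s t" using icc_max_attained[OF cs assms(3)] .
  moreover obtain y where "y \<in> {s..t}" "u y = icc_min u s t" using icc_min_attained[OF cs assms(3)] .
  ultimately show ?thesis using osc_upper[OF assms(1), of x y] assms by simp
qed

lemma initial_segment: "t \<le> d \<Longrightarrow> {s\<in>{c..d}. s \<le> t} = {c..(t::real)}"
  by auto

lemma icc_max_shift:
  assumes "continuous_on {s..t} u" "s \<le> t"
  shows "icc_max (\<lambda>x. u x + k) s t = icc_max u s t + k"
  unfolding icc_max_def by (rule SUP_add_const) (use assms cts_bdd_above_image in auto)

lemma P_plus_eq:
  assumes "continuous_on {c..d} u" "t \<in> {c..d}"
  shows "P_plus r {c..d} u p t = p + max 0 (icc_max u c t - r - p)"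
proof -
  have "continuous_on {c..t} u" using assms by (auto intro: continuous_on_subset)
  from icc_max_shift[OF this, of "- r - p"] show ?thesis
    using assms initial_segment[of t d c] unfolding P_plus_def cummax_def icc_max_def by (simp add: algebra_simps)
qed

lemma P_minus_eq:
  assumes "continuous_on {c..d} u" "t \<in> {c..d}"
  shows "P_minus r {c..d} u p t = p - max 0 (p - icc_min u c t - r)"
proof -
  have "continuous_on {c..t} (\<lambda>x. - u x)" using assms by (auto intro!: continuous_intros intro: continuous_on_subset)
  from icc_max_shift[OF this, of "- r + p"] show ?thesis
    using assms initial_segment[of t d c] unfolding P_minus_def cummax_def icc_min_def icc_max_def by (simp add: algebra_simps)
qed

text \<open>If the positive part in \<open>P_plus\<close> is active, then
  \<open>u t - P_plus\<close> equals \<open>u t\<close> minus the running maximum plus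
  \<open>r\<close>, which is positive as \<open>u\<close> oscillates by less than \<open>r\<close>.
  So membership can only fail where \<open>P_plus\<close> still equals \<open>p\<close>.\<close>

lemma Z_plus_iff:
  assumes "continuous_on {c..d} u" "osc {c..d} u < r" "r > 0"
  shows "(u, p) \<in> Z_plus r {c..d} \<longleftrightarrow> (\<forall>t\<in>{c..d}. u t > p - r)"
proof -
  have "u t - P_plus r {c..d} u p t > - r \<longleftrightarrow> u t > p - r" if t: "t \<in> {c..d}" for t
  proof -
    have cs: "continuous_on {c..t} u" using assms t by (auto intro: continuous_on_subset)
    have "icc_min u c t \<le> u t" "icc_max u c t - icc_min u c t < r"
      using icc_min_lower[OF cs] osc_icc[OF assms(1), of c t] assms t by auto
    then show ?thesis unfolding P_plus_eq[OF assms(1) t] using \<open>r > 0\<close> by auto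
  qed
  then show ?thesis using assms unfolding Z_plus_def by auto
qed

text \<open>Tells which edge is out of reach. Off \<open>Z_plus\<close> some value of
  \<open>u\<close> is at most \<open>p - r\<close>; then all values stay below \<open>p\<close>, far
  from the upper edge \<open>p + r\<close>. Strictness makes \<open>pos_deriv\<close> vanish as
  well.\<close>

lemma Z_plus_bounds:
  assumes c: "continuous_on {c..d} u" and "osc {c..d} u < r" "r > 0" "t \<in> {c..d}"
  shows "(u, p) \<in> Z_plus r {c..d} \<Longrightarrow> p - icc_min u c t - r < 0"
    and "(u, p) \<notin> Z_plus r {c..d} \<Longrightarrow> icc_max u c t - r - p < 0"
proof -
  note Z = Z_plus_iff[OF assms(1-3), of p]
  have cs: "continuous_on {c..t} u" "c \<le> t" using assms by (auto intro: continuous_on_subset)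
  show "p - icc_min u c t - r < 0" if "(u, p) \<in> Z_plus r {c..d}"
  proof -
    obtain x where x: "x \<in> {c..t}" "u x = icc_min u c t" using icc_min_attained[OF cs] .
    have "x \<in> {c..d}" using x(1) assms(4) by simp
    then have "u x > p - r" using that Z by blast
    then show ?thesis using x(2) by linarith
  qed
  assume "(u, p) \<notin> Z_plus r {c..d}"
  then obtain x where x: "x \<in> {c..d}" "u x \<le> p - r" using Z by force
  obtain m where m: "m \<in> {c..t}" "u m = icc_max u c t" using icc_max_attained[OF cs] by blast
  have "u m - u x < r" using osc_upper[OF c, of m x] assms m x by auto
  then show "icc_max u c t - r - p < 0" using x m \<open>r > 0\<close> by linarith
qed

text \<open>The inactive positive part may be added back in either case, which produces exactly the
  right-hand side of \<open>is_play_formula\<close>.\<close>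

lemma P_loc_eq:
  assumes "continuous_on {c..d} u" "osc {c..d} u < r" "r > 0" "t \<in> {c..d}"
  shows "P_loc r {c..d} u p t = p + max 0 (icc_max u c t - r - p) - max 0 (p - icc_min u c t - r)"
proof (cases "(u, p) \<in> Z_plus r {c..d}")
  case True
  then show ?thesis using Z_plus_bounds(1)[OF assms True]
    by (simp add: P_loc_def P_plus_eq[OF assms(1,4)])
next
  case False
  then show ?thesis using Z_plus_bounds(2)[OF assms False]
    by (simp add: P_loc_def P_minus_eq[OF assms(1,4)])
qed

text \<open>The same merging of cases for the derivative. The maximizers are now taken over
  \<open>{c..t}\<close>, and \<open>\<eta>\<close> is pulled out of the suprema, to match the output
  of the expansion rules.\<close>

lemma P_loc_deriv_eq:
  assumes c: "continuous_on {c..d} u" and "osc {c..d} u < r" "r > 0" and t: "t \<in> {c..d}"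
    and ch: "continuous_on {c..d} h"
  shows "P_loc_deriv r {c..d} (u, p) (h, \<eta>) t =
    \<eta> + pos_deriv (icc_max u c t - r - p) ((SUP m\<in>{m\<in>{c..t}. u m = icc_max u c t}. h m) - \<eta>)
      - pos_deriv (p - icc_min u c t - r) (\<eta> + (SUP m\<in>{m\<in>{c..t}. - u m = icc_max (\<lambda>x. - u x) c t}. - h m))"
proof -
  have cs: "continuous_on {c..t} u" "continuous_on {c..t} (\<lambda>x. - u x)" "c \<le> t"
    using assms by (auto intro!: continuous_intros intro: continuous_on_subset)
  have chs: "continuous_on {c..t} h" "continuous_on {c..t} (\<lambda>x. - h x)"
    using assms by (auto intro!: continuous_intros intro: continuous_on_subset)
  have td: "t \<le> d" using t by simp
  have A: "argmax_set {c..d} v t = {m\<in>{c..t}. v m = icc_max v c t}" for v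
    using td unfolding argmax_set_def cummax_def icc_max_def initial_segment[OF td] by auto
  have S1: "(SUP s\<in>{s\<in>{c..d}. s \<le> t}. u s - r - p) = icc_max u c t - r - p"
    using icc_max_shift[OF cs(1,3), of "- r - p"] unfolding initial_segment[OF td] icc_max_def
    by (simp add: algebra_simps)
  have S2: "(SUP s\<in>{s\<in>{c..d}. s \<le> t}. - u s - r + p) = p - icc_min u c t - r"
    using icc_max_shift[OF cs(2,3), of "- r + p"] unfolding initial_segment[OF td] icc_min_def icc_max_def
    by (simp add: algebra_simps)
  have ne: "{m\<in>{c..t}. u m = icc_max u c t} \<noteq> {}" using icc_max_attained[OF cs(1,3)] by blast
  have ne2: "{m\<in>{c..t}. - u m = icc_max (\<lambda>x. - u x) c t} \<noteq> {}" using icc_max_attained[OF cs(2,3)] by blast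
  have S3: "(SUP m\<in>{m\<in>{c..t}. u m = icc_max u c t}. h m - \<eta>) = (SUP m\<in>{m\<in>{c..t}. u m = icc_max u c t}. h m) - \<eta>"
    using SUP_add_const[OF ne cts_bdd_above_image[OF chs(1) Collect_restrict], of "- \<eta>"] by simp
  have S4: "(SUP m\<in>{m\<in>{c..t}. - u m = icc_max (\<lambda>x. - u x) c t}. - h m + \<eta>) =
       \<eta> + (SUP m\<in>{m\<in>{c..t}. - u m = icc_max (\<lambda>x. - u x) c t}. - h m)"
    using SUP_add_const[OF ne2 cts_bdd_above_image[OF chs(2) Collect_restrict], of "\<eta>"] by simp
  show ?thesis
    unfolding P_loc_deriv_def prod.case A S1 S2 S3 S4
    using Z_plus_bounds[OF assms(1-4), of p] by (auto simp: pos_deriv_def)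
qed

section \<open>Positive homogeneity of the recursion\<close>

lemma pos_deriv_scale: "l > 0 \<Longrightarrow> pos_deriv x (l * y) = l * pos_deriv x y"
  unfolding pos_deriv_def by (auto simp: mult_le_0_iff zero_less_mult_iff)

lemma P_loc_deriv_scale:
  assumes "continuous_on {c..d} u" "osc {c..d} u < r" "r > 0" and t: "t \<in> {c..d}"
    and ch: "continuous_on {c..d} h" and "l > 0"
  shows "P_loc_deriv r {c..d} (u, p) (\<lambda>x. l * h x, l * \<eta>) t = l * P_loc_deriv r {c..d} (u, p) (h, \<eta>) t"
proof -
  have cs: "continuous_on {c..t} u" "continuous_on {c..t} (\<lambda>x. - u x)" "c \<le> t"
    using assms by (auto intro!: continuous_intros intro: continuous_on_subset)
  have chs: "continuous_on {c..t} h" "continuous_on {c..t} (\<lambda>x. - h x)"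
    using assms by (auto intro!: continuous_intros intro: continuous_on_subset)
  have clh: "continuous_on {c..d} (\<lambda>x. l * h x)" using ch by (intro continuous_intros)
  have ne: "{m\<in>{c..t}. u m = icc_max u c t} \<noteq> {}" using icc_max_attained[OF cs(1,3)] by blast
  have ne2: "{m\<in>{c..t}. - u m = icc_max (\<lambda>x. - u x) c t} \<noteq> {}" using icc_max_attained[OF cs(2,3)] by blast
  have S3: "(SUP m\<in>{m\<in>{c..t}. u m = icc_max u c t}. l * h m) = l * (SUP m\<in>{m\<in>{c..t}. u m = icc_max u c t}. h m)"
    using SUP_mult_const[OF ne cts_bdd_above_image[OF chs(1) Collect_restrict], of l] \<open>l > 0\<close> by simp
  have S4: "(SUP m\<in>{m\<in>{c..t}. - u m = icc_max (\<lambda>x. - u x) c t}. - (l * h m)) =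
       l * (SUP m\<in>{m\<in>{c..t}. - u m = icc_max (\<lambda>x. - u x) c t}. - h m)"
    using SUP_mult_const[OF ne2 cts_bdd_above_image[OF chs(2) Collect_restrict], of "l"] \<open>l > 0\<close> by simp
  show ?thesis
    unfolding P_loc_deriv_eq[OF assms(1-4) ch] P_loc_deriv_eq[OF assms(1-4) clh] S3 S4
      right_diff_distrib[symmetric] distrib_left[symmetric] pos_deriv_scale[OF \<open>l > 0\<close>] ..
qed

text \<open>Homogeneity is what turns an expansion into a directional derivative. Only positive
  factors are possible, since the derivative is not linear.\<close>

lemma w_node_deriv_scale:
  assumes c: "continuous_on {a..b} u" and ch: "continuous_on {a..b} h" and "r > 0" "l > 0"
    and p: "is_partition a b N \<tau>" and o: "\<And>k. k < N \<Longrightarrow> osc {\<tau> k..\<tau> (Suc k)} u < r" and "k \<le> N"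
    and sub: "\<And>k. k < N \<Longrightarrow> a \<le> \<tau> k \<and> \<tau> k < \<tau> (Suc k) \<and> \<tau> (Suc k) \<le> b"
  shows "w_node_deriv r \<tau> (u, z) (\<lambda>x. l * h x, l * y) k = l * w_node_deriv r \<tau> (u, z) (h, y) k"
  using \<open>k \<le> N\<close>
proof (induction k)
  case 0
  have "proj_deriv r z (l * y) = l * proj_deriv r z y"
    using \<open>l > 0\<close> by (auto simp: proj_deriv_def min_def max_def mult_le_0_iff zero_le_mult_iff)
  then show ?case by (simp add: algebra_simps)
next
  case (Suc k)
  have "continuous_on {\<tau> k..\<tau> (Suc k)} u" "continuous_on {\<tau> k..\<tau> (Suc k)} h"
    using c ch sub[of k] Suc.prems by (auto intro: continuous_on_subset)
  moreover have "\<tau> (Suc k) \<in> {\<tau> k..\<tau> (Suc k)}" using sub[of k] Suc.prems by auto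
  ultimately show ?case
    using Suc P_loc_deriv_scale[of "\<tau> k" "\<tau> (Suc k)" u r "\<tau> (Suc k)" h l] o[of k] \<open>r > 0\<close> \<open>l > 0\<close> by simp
qed

section \<open>Pointwise expansion of the play\<close>

lemma osc_le:
  assumes "continuous_on {c..d} u" "c \<le> d"
  shows "osc {c..d} u \<le> icc_max u c d - icc_min u c d"
  unfolding osc_def
proof (rule cSup_least)
  fix x assume "x \<in> {\<bar>u t - u s\<bar> |s t. s \<in> {c..d} \<and> t \<in> {c..d}}"
  then obtain s t where "x = \<bar>u t - u s\<bar>" "s \<in> {c..d}" "t \<in> {c..d}" by blast
  then show "x \<le> icc_max u c d - icc_min u c d"
    using icc_max_upper[OF assms(1), of s] icc_max_upper[OF assms(1), of t]
      icc_min_lower[OF assms(1), of s] icc_min_lower[OF assms(1), of t] by linarith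
qed (use assms(2) in auto)

lemma small_oscillation_partition:
  fixes u :: "real \<Rightarrow> real"
  assumes c: "continuous_on {a..b} u" and "a < b" "e > 0"
  obtains N \<tau> where "is_partition a b N \<tau>" "\<And>k. k < N \<Longrightarrow> osc {\<tau> k..\<tau> (Suc k)} u < e"
proof -
  obtain d where d: "d > 0" "\<And>s t. a \<le> s \<Longrightarrow> s \<le> t \<Longrightarrow> t \<le> b \<Longrightarrow> t - s \<le> d \<Longrightarrow> icc_max u s t - icc_min u s t < e"
    using small_oscillation[OF c \<open>e > 0\<close>] by blast
  obtain n where n: "(b - a) / d < real n" using reals_Archimedean2 by blast
  have "(b - a) / d > 0" using d \<open>a < b\<close> by simp
  then have n0: "real n > 0" using n by linarith
  define h where "h = (b - a) / real n"
  have h: "h > 0" "h \<le> d" using n n0 \<open>a < b\<close> d by (auto simp: h_def field_simps)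
  define s where "s i = a + real i * h" for i
  have sS: "s (Suc i) = s i + h" for i by (simp add: s_def algebra_simps)
  have s0: "s 0 = a" "s n = b" using n0 by (auto simp: s_def h_def)
  have p: "is_partition a b n s" using s0 sS h by (simp add: is_partition_def)
  have "osc {s k..s (Suc k)} u < e" if "k < n" for k
  proof -
    have "a \<le> s k" "s k \<le> s (Suc k)" "s (Suc k) \<le> b"
      using is_partition_mono[OF p, of 0 k] is_partition_mono[OF p, of "Suc k" n] that s0 sS[of k] h by auto
    moreover from this have "continuous_on {s k..s (Suc k)} u" using c by (auto intro: continuous_on_subset)
    ultimately show ?thesis using osc_le[of "s k" "s (Suc k)" u] d(2)[of "s k" "s (Suc k)"] sS[of k] h by linarith
  qed
  with p that show thesis by blast
qed

lemma partition_cover: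
  assumes p: "is_partition a b N \<tau>" and "t \<in> {a..b}" "a < b"
  obtains k where "k < N" "t \<in> {\<tau> k..\<tau> (Suc k)}"
proof -
  have "\<exists>k<n. t \<in> {\<tau> k..\<tau> (Suc k)}" if "t \<le> \<tau> n" "0 < n" "n \<le> N" for n
    using that
  proof (induction n)
    case (Suc n)
    show ?case
    proof (cases "t \<le> \<tau> n \<and> 0 < n")
      case True
      then show ?thesis using Suc by (auto intro: less_SucI)
    next
      case False
      then have "\<tau> n \<le> t" using p assms(2) unfolding is_partition_def by (cases "n = 0") auto
      then show ?thesis using Suc.prems by (intro exI[of _ n]) auto
    qed
  qed simp
  moreover have "0 < N" using p \<open>a < b\<close> unfolding is_partition_def by (cases N) auto
  ultimately show thesis using that assms(2) p unfolding is_partition_def by (metis atLeastAtMost_iff order_refl)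
qed

lemma sup_norm_nonneg: "a \<le> b \<Longrightarrow> continuous_on {a..b} h \<Longrightarrow> 0 \<le> sup_norm a b h"
  using sup_norm_upper[of a b h a] by simp

text \<open>\<open>proj r\<close> is piecewise affine, so the expansion is exact near
  \<open>z\<close>; each witness is at most the distance from \<open>z\<close> to any kink other
  than \<open>z\<close>.\<close>

lemma proj_expansion:
  assumes "r > 0"
  obtains d where "d > 0" "\<And>y. \<bar>y\<bar> < d \<Longrightarrow> proj r (z + y) = proj r z + proj_deriv r z y"
proof -
  consider "\<bar>z\<bar> < r" | "z = r" | "z = - r" | "\<bar>z\<bar> > r" by linarith
  then show thesis
  proof cases
    case 1
    show thesis by (rule that[of "r - \<bar>z\<bar>"]) (use 1 in \<open>auto simp: proj_def proj_deriv_def\<close>)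
  next
    case 2
    show thesis by (rule that[of r]) (use 2 assms in \<open>auto simp: proj_def proj_deriv_def\<close>)
  next
    case 3
    show thesis by (rule that[of r]) (use 3 assms in \<open>auto simp: proj_def proj_deriv_def\<close>)
  next
    case 4
    show thesis by (rule that[of "\<bar>z\<bar> - r"]) (use 4 assms in \<open>auto simp: proj_def proj_deriv_def\<close>)
  qed
qed

text \<open>The interface through which both kinds of spaces enter: \<open>N\<close> dominates the
  sup norm, and its unit ball is equicontinuous. The latter is stated homogeneously, so it yields
  remainders relative to \<open>N\<close> directly.\<close>

locale play_space =
  fixes a b r :: real and X :: "(real \<Rightarrow> real) set" and N :: "(real \<Rightarrow> real) \<times> real \<Rightarrow> real"
  assumes a_less_b: "a < b" and r_pos: "r > 0"
    and X_continuous: "h \<in> X \<Longrightarrow> continuous_on {a..b} h"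
    and X_scale: "h \<in> X \<Longrightarrow> l *\<^sub>R h \<in> X"
    and N_scale: "h \<in> X \<Longrightarrow> N (l *\<^sub>R (h, y)) = \<bar>l\<bar> * N (h, y)"
    and N_bound: "\<exists>K>0. \<forall>h\<in>X. \<forall>y. sup_norm a b h + \<bar>y\<bar> \<le> K * N (h, y)"
    and N_equicontinuous: "e > 0 \<Longrightarrow> \<exists>d>0. \<forall>h\<in>X. \<forall>y. \<forall>s\<in>{a..b}. \<forall>t\<in>{a..b}.
          \<bar>s - t\<bar> < d \<longrightarrow> \<bar>h s - h t\<bar> \<le> e * N (h, y)"
begin

definition msize :: "(real \<Rightarrow> real) \<times> real \<Rightarrow> real" where
  "msize p = sup_norm a b (fst p) + \<bar>snd p\<bar>"

text \<open>Neighbourhoods of zero are measured by \<open>msize\<close> and not by \<open>N\<close>;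
  this is why the final modulus can depend on the sup norm of \<open>h\<close> alone.\<close>

definition small :: "((real \<Rightarrow> real) \<times> real) filter" where
  "small = inf (filtercomap msize (nhds 0)) (principal (X \<times> UNIV))"

lemma msize_nonneg: "p \<in> X \<times> UNIV \<Longrightarrow> 0 \<le> msize p"
  using sup_norm_nonneg[OF less_imp_le[OF a_less_b]] X_continuous by (auto simp: msize_def)

lemma msize_upper: "p \<in> X \<times> UNIV \<Longrightarrow> t \<in> {a..b} \<Longrightarrow> \<bar>fst p t\<bar> \<le> msize p"
  using sup_norm_upper[OF X_continuous, of "fst p" t] by (auto simp: msize_def)

lemma msize_scale:
  assumes "p \<in> X \<times> UNIV"
  shows "msize (l *\<^sub>R p) = \<bar>l\<bar> * msize p"
proof -
  have c: "continuous_on {a..b} (fst p)" using assms X_continuous by auto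
  have "(SUP t\<in>{a..b}. \<bar>l\<bar> * \<bar>fst p t\<bar>) = \<bar>l\<bar> * (SUP t\<in>{a..b}. \<bar>fst p t\<bar>)"
    by (rule SUP_mult_const)
       (use a_less_b in \<open>auto intro!: cts_bdd_above_image[of a b] continuous_intros c\<close>)
  then show ?thesis
    by (simp add: msize_def sup_norm_def scaleR_fun_def abs_mult distrib_left)
qed

lemma N_bound_msize: obtains K where "K > 0" "\<And>p. p \<in> X \<times> UNIV \<Longrightarrow> msize p \<le> K * N p"
proof -
  obtain K where "K > 0" "\<forall>h\<in>X. \<forall>y. sup_norm a b h + \<bar>y\<bar> \<le> K * N (h, y)" using N_bound by blast
  then show thesis by (intro that[of K]) (auto simp: msize_def)
qed

lemma N_nonneg: "p \<in> X \<times> UNIV \<Longrightarrow> 0 \<le> N p"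
  using N_bound_msize msize_nonneg by (metis mult_pos_neg not_le order_trans)

lemma scale_mem: "p \<in> X \<times> UNIV \<Longrightarrow> l *\<^sub>R p \<in> X \<times> UNIV"
  using X_scale by (auto simp: mem_Times_iff)

lemma eventually_small:
  "eventually P small \<longleftrightarrow> (\<exists>d>0. \<forall>p\<in>X \<times> UNIV. msize p < d \<longrightarrow> P p)"
proof
  assume "eventually P small"
  then obtain Q where Q: "eventually Q (nhds 0)" "\<And>p. p \<in> X \<times> UNIV \<Longrightarrow> Q (msize p) \<Longrightarrow> P p"
    unfolding small_def eventually_inf_principal eventually_filtercomap by blast
  then obtain d where "d > 0" "\<And>x. dist x 0 < d \<Longrightarrow> Q x" unfolding eventually_nhds_metric by blast
  then show "\<exists>d>0. \<forall>p\<in>X \<times> UNIV. msize p < d \<longrightarrow> P p"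
    using Q(2) msize_nonneg by (intro exI[of _ d]) (auto simp: dist_real_def)
next
  assume "\<exists>d>0. \<forall>p\<in>X \<times> UNIV. msize p < d \<longrightarrow> P p"
  then obtain d where d: "d > 0" "\<forall>p\<in>X \<times> UNIV. msize p < d \<longrightarrow> P p" by blast
  have "eventually (\<lambda>x. x < d) (nhds 0)" using d(1) by (rule eventually_nhds_in_open[of "{..<d}" 0, simplified])
  then show "eventually P small"
    unfolding small_def eventually_inf_principal eventually_filtercomap using d(2) by blast
qed

lemma filterlim_small:
  assumes "\<And>n. p n \<in> X \<times> UNIV" "(\<lambda>n. msize (p n)) \<longlonglongrightarrow> 0"
  shows "filterlim p small sequentially"
  unfolding small_def filterlim_inf filterlim_principal filterlim_filtercomap_iff
  using assms by (auto simp: comp_def)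

text \<open>The two norms separate here: \<open>msize p < d\<close> brings the perturbed maximizer
  close to a maximizer of \<open>u\<close>, and equicontinuity supplies \<open>E = e * N p\<close>
  in \<open>danskin_remainder\<close>. The sign \<open>\<sigma>\<close> lets one statement serve
  \<open>u\<close> and \<open>- u\<close>.\<close>

lemma b_expansion_icc_max:
  assumes u: "continuous_on {a..b} u" and st: "a \<le> s" "s \<le> t" "t \<le> b" and \<sigma>: "\<bar>\<sigma>\<bar> = 1"
  shows "b_expansion small N (\<lambda>p. icc_max (\<lambda>x. u x + \<sigma> * fst p x) s t) (icc_max u s t)
           (\<lambda>p. SUP m\<in>{m\<in>{s..t}. u m = icc_max u s t}. \<sigma> * fst p m)"
proof (rule b_expansionI)
  have cs: "continuous_on {s..t} u" using u st by (auto intro: continuous_on_subset)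
  have ch: "continuous_on {s..t} (\<lambda>x. \<sigma> * fst p x)" if "p \<in> X \<times> UNIV" for p
    using X_continuous[of "fst p"] that st by (auto intro!: continuous_intros intro: continuous_on_subset)
  have up: "\<bar>\<sigma> * fst p x\<bar> \<le> msize p" if "p \<in> X \<times> UNIV" "x \<in> {s..t}" for p x
    using msize_upper[OF that(1), of x] that st \<sigma> by (auto simp: abs_mult)
  show "((\<lambda>p. icc_max (\<lambda>x. u x + \<sigma> * fst p x) s t) \<longlongrightarrow> icc_max u s t) small"
  proof (rule tendstoI)
    fix e :: real assume "e > 0"
    have "dist (icc_max (\<lambda>x. u x + \<sigma> * fst p x) s t) (icc_max u s t) < e" if "p \<in> X \<times> UNIV" "msize p < e" for p
      using icc_max_dist_le[OF continuous_on_add[OF cs ch[OF that(1)]] cs st(2), of "msize p"] up[OF that(1)] that(2)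
      by (simp add: dist_real_def)
    then show "\<forall>\<^sub>F p in small. dist (icc_max (\<lambda>x. u x + \<sigma> * fst p x) s t) (icc_max u s t) < e"
      unfolding eventually_small using \<open>e > 0\<close> by blast
  qed
  fix e :: real assume "e > 0"
  obtain \<eta> where \<eta>: "\<eta> > 0" "\<And>h y s t. h \<in> X \<Longrightarrow> s \<in> {a..b} \<Longrightarrow> t \<in> {a..b} \<Longrightarrow> \<bar>s - t\<bar> < \<eta> \<Longrightarrow> \<bar>h s - h t\<bar> \<le> e * N (h, y)"
    using N_equicontinuous[OF \<open>e > 0\<close>] by metis
  obtain d where "d > 0" and d: "\<And>h E. continuous_on {s..t} h \<Longrightarrow> (\<And>x. x \<in> {s..t} \<Longrightarrow> \<bar>h x\<bar> < d) \<Longrightarrow>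
     (\<And>x y. x \<in> {s..t} \<Longrightarrow> y \<in> {s..t} \<Longrightarrow> \<bar>x - y\<bar> < \<eta> \<Longrightarrow> \<bar>h x - h y\<bar> \<le> E) \<Longrightarrow>
     \<bar>icc_max (\<lambda>x. u x + h x) s t - icc_max u s t - (SUP m\<in>{m\<in>{s..t}. u m = icc_max u s t}. h m)\<bar> \<le> E"
    using danskin_remainder[OF cs st(2) \<eta>(1)] by blast
  have "\<bar>icc_max (\<lambda>x. u x + \<sigma> * fst p x) s t - icc_max u s t - (SUP m\<in>{m\<in>{s..t}. u m = icc_max u s t}. \<sigma> * fst p m)\<bar> \<le> e * N p"
    if p: "p \<in> X \<times> UNIV" "msize p < d" for p
  proof (rule d[OF ch[OF p(1)]])
    show "\<bar>\<sigma> * fst p x\<bar> < d" if "x \<in> {s..t}" for x using up[OF p(1) that] p(2) by simp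
    show "\<bar>\<sigma> * fst p x - \<sigma> * fst p y\<bar> \<le> e * N p" if "x \<in> {s..t}" "y \<in> {s..t}" "\<bar>x - y\<bar> < \<eta>" for x y
      using \<eta>(2)[of "fst p" x y "snd p"] that p(1) st \<sigma>
      by (auto simp: right_diff_distrib[symmetric] abs_mult)
  qed
  then show "\<forall>\<^sub>F p in small. \<bar>icc_max (\<lambda>x. u x + \<sigma> * fst p x) s t - icc_max u s t -
      (SUP m\<in>{m\<in>{s..t}. u m = icc_max u s t}. \<sigma> * fst p m)\<bar> \<le> e * N p"
    unfolding eventually_small using \<open>d > 0\<close> by blast
qed

abbreviation perturbed_play :: "(real \<Rightarrow> real) \<Rightarrow> real \<Rightarrow> (real \<Rightarrow> real) \<times> real \<Rightarrow> real \<Rightarrow> real" where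
  "perturbed_play u z p \<equiv> play a b r (u + fst p) (z + snd p)"

lemma continuous_plus:
  assumes "continuous_on {a..b} u" "p \<in> X \<times> UNIV"
  shows "continuous_on {a..b} (u + fst p)"
  using assms X_continuous[of "fst p"] unfolding plus_fun_def by (auto intro!: continuous_intros)

lemma eventually_small_mem: "\<forall>\<^sub>F p in small. p \<in> X \<times> UNIV"
  unfolding eventually_small by (intro exI[of _ 1]) auto

text \<open>On \<open>[c,t]\<close> the play and its perturbations obey the same formula in the
  start value and two maxima. Expanding it term by term, with \<open>D\<close> for the start value,
  reproduces \<open>P_loc_deriv_eq\<close>.\<close>

lemma b_expansion_play_step:
  assumes u: "continuous_on {a..b} u" and cd: "a \<le> c" "d \<le> b" and o: "osc {c..d} u < r" and t: "t \<in> {c..d}"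
    and D: "b_expansion small N (\<lambda>p. perturbed_play u z p c) (play a b r u z c) D"
  shows "P_loc r {c..d} u (play a b r u z c) t = play a b r u z t"
    and "b_expansion small N (\<lambda>p. perturbed_play u z p t) (play a b r u z t)
           (\<lambda>p. P_loc_deriv r {c..d} (u, play a b r u z c) (fst p, D p) t)"
proof -
  have ucd: "continuous_on {c..d} u" using u cd by (auto intro: continuous_on_subset)
  have act: "a \<le> c" "c \<le> t" "t \<le> b" using cd t by auto
  define w0 where "w0 = play a b r u z c"
  have sm: "icc_max u c t - icc_min u c t < 2 * r" using osc_icc[OF ucd, of c t] o t r_pos by auto
  note PL_eq = P_loc_eq[OF ucd o r_pos t, of w0]
  have base: "play a b r u z t = w0 + max 0 (icc_max u c t - r - w0) - max 0 (w0 - icc_min u c t - r)"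
    unfolding w0_def by (rule is_play_formula[OF play_is_play(1)[OF u a_less_b r_pos] act sm])
  then show P: "P_loc r {c..d} u (play a b r u z c) t = play a b r u z t"
    using PL_eq unfolding w0_def by simp
  \<comment> \<open>The factors \<open>1\<close> and \<open>- 1\<close> match the sign
    \<open>\<sigma>\<close> in \<open>b_expansion_icc_max\<close>.\<close>
  define D1 where "D1 p = (SUP m\<in>{m\<in>{c..t}. u m = icc_max u c t}. 1 * fst p m)" for p :: "(real \<Rightarrow> real) \<times> real"
  define D2 where "D2 p = (SUP m\<in>{m\<in>{c..t}. - u m = icc_max (\<lambda>x. - u x) c t}. - 1 * fst p m)" for p :: "(real \<Rightarrow> real) \<times> real"
  have b1: "b_expansion small N (\<lambda>p. icc_max (\<lambda>x. u x + 1 * fst p x) c t) (icc_max u c t) D1"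
    unfolding D1_def by (rule b_expansion_icc_max[OF u act]) simp
  have b2: "b_expansion small N (\<lambda>p. icc_max (\<lambda>x. - u x + - 1 * fst p x) c t) (icc_max (\<lambda>x. - u x) c t) D2"
    unfolding D2_def by (rule b_expansion_icc_max[OF continuous_on_minus[OF u] act]) simp
  note comb = b_expansion_diff[OF b_expansion_add[OF D b_expansion_max0[OF b_expansion_diff[OF b_expansion_diff_const[OF b1] D]]]
      b_expansion_max0[OF b_expansion_diff_const[OF b_expansion_add[OF D b2]]]]
  \<comment> \<open>This sum is the oscillation of the perturbed input on \<open>[c,t]\<close>; its
    limit lies below \<open>2 * r\<close>, so the formula eventually applies to the perturbed
    play.\<close>
  have "((\<lambda>p. icc_max (\<lambda>x. u x + 1 * fst p x) c t + icc_max (\<lambda>x. - u x + - 1 * fst p x) c t) \<longlongrightarrow> icc_max u c t + icc_max (\<lambda>x. - u x) c t) small"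
    by (intro tendsto_add b_expansionD(1)[OF b1] b_expansionD(1)[OF b2])
  from order_tendstoD(2)[OF this, of "2 * r"] sm
  have "\<forall>\<^sub>F p in small. icc_max (\<lambda>x. u x + 1 * fst p x) c t + icc_max (\<lambda>x. - u x + - 1 * fst p x) c t < 2 * r"
    by (simp add: icc_min_def)
  with eventually_small_mem
  have ev: "\<forall>\<^sub>F p in small. perturbed_play u z p c + max 0 (icc_max (\<lambda>x. u x + 1 * fst p x) c t - r - perturbed_play u z p c)
        - max 0 (perturbed_play u z p c + icc_max (\<lambda>x. - u x + - 1 * fst p x) c t - r) = perturbed_play u z p t"
  proof eventually_elim
    case (elim p)
    have "icc_max (u + fst p) c t - icc_min (u + fst p) c t < 2 * r"
      using elim(2) by (simp add: icc_min_def plus_fun_def)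
    from is_play_formula[OF play_is_play(1)[OF continuous_plus[OF u elim(1)] a_less_b r_pos] act this]
    show ?case by (simp add: icc_min_def plus_fun_def)
  qed
  have ev2: "\<forall>\<^sub>F p in small. D p + pos_deriv (icc_max u c t - r - w0) (D1 p - D p) -
        pos_deriv (w0 + icc_max (\<lambda>x. - u x) c t - r) (D p + D2 p)
      = P_loc_deriv r {c..d} (u, play a b r u z c) (fst p, D p) t"
    using eventually_small_mem
  proof eventually_elim
    case (elim p)
    have "continuous_on {c..d} (fst p)"
      using X_continuous[of "fst p"] elim cd by (auto intro: continuous_on_subset)
    from P_loc_deriv_eq[OF ucd o r_pos t this] show ?case by (simp add: w0_def D1_def D2_def icc_min_def)
  qed
  show "b_expansion small N (\<lambda>p. perturbed_play u z p t) (play a b r u z t)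
           (\<lambda>p. P_loc_deriv r {c..d} (u, play a b r u z c) (fst p, D p) t)"
    by (rule b_expansion_cong[OF comb ev _ ev2[unfolded w0_def]]) (simp add: base w0_def icc_min_def)
qed

lemma b_expansion_play_a:
  assumes u: "continuous_on {a..b} u"
  shows "b_expansion small N (\<lambda>p. perturbed_play u z p a) (play a b r u z a) (\<lambda>p. fst p a - proj_deriv r z (snd p))"
proof -
  have aab: "a \<in> {a..b}" using a_less_b by simp
  note init = play_is_play(2)[OF _ a_less_b r_pos]
  show ?thesis
  proof (rule b_expansionI)
    show "((\<lambda>p. perturbed_play u z p a) \<longlongrightarrow> play a b r u z a) small"
    proof (rule tendstoI)
      fix e :: real assume "e > 0"
      have "dist (perturbed_play u z p a) (play a b r u z a) < e" if p: "p \<in> X \<times> UNIV" "msize p < e" for p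
      proof -
        have "\<bar>fst p a\<bar> \<le> sup_norm a b (fst p)" using sup_norm_upper[OF X_continuous aab] p by auto
        then show ?thesis
          using init[OF continuous_plus[OF u p(1)], of "z + snd p"] init[OF u, of z] p(2)
            proj_lipschitz[of r "z + snd p" z]
          by (simp add: dist_real_def msize_def)
      qed
      then show "\<forall>\<^sub>F p in small. dist (perturbed_play u z p a) (play a b r u z a) < e"
        unfolding eventually_small using \<open>e > 0\<close> by blast
    qed
    fix e :: real assume "e > 0"
    obtain d where "d > 0" and d: "\<And>y. \<bar>y\<bar> < d \<Longrightarrow> proj r (z + y) = proj r z + proj_deriv r z y"
      using proj_expansion[OF r_pos] by blast
    have "\<bar>perturbed_play u z p a - play a b r u z a - (fst p a - proj_deriv r z (snd p))\<bar> \<le> e * N p"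
      if p: "p \<in> X \<times> UNIV" "msize p < d" for p
    proof -
      have "\<bar>snd p\<bar> < d"
        using p sup_norm_nonneg[OF less_imp_le[OF a_less_b] X_continuous, of "fst p"] by (auto simp: msize_def)
      then have "perturbed_play u z p a - play a b r u z a - (fst p a - proj_deriv r z (snd p)) = 0"
        using init[OF continuous_plus[OF u p(1)], of "z + snd p"] init[OF u, of z] d by simp
      then show ?thesis using N_nonneg[OF p(1)] \<open>e > 0\<close> by simp
    qed
    then show "\<forall>\<^sub>F p in small. \<bar>perturbed_play u z p a - play a b r u z a - (fst p a - proj_deriv r z (snd p))\<bar> \<le> e * N p"
      unfolding eventually_small using \<open>d > 0\<close> by blast
  qed
qed

lemma partition_points:
  assumes "is_partition a b M \<tau>" "k < M"
  shows "a \<le> \<tau> k \<and> \<tau> k < \<tau> (Suc k) \<and> \<tau> (Suc k) \<le> b"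
  using is_partition_mono[OF assms(1), of 0 k] is_partition_mono[OF assms(1), of "Suc k" M] assms
  unfolding is_partition_def by auto

text \<open>The identity for \<open>w_node\<close> is carried along because the derivative recursion
  is evaluated at the nodes, whereas the step lemma speaks of values of the play.\<close>

lemma b_expansion_play_node:
  assumes u: "continuous_on {a..b} u" and p: "is_partition a b M \<tau>"
    and o: "\<forall>k<M. osc {\<tau> k..\<tau> (Suc k)} u < r" and "k \<le> M"
  shows "w_node r \<tau> u z k = play a b r u z (\<tau> k) \<and>
    b_expansion small N (\<lambda>p. perturbed_play u z p (\<tau> k)) (play a b r u z (\<tau> k)) (\<lambda>p. w_node_deriv r \<tau> (u, z) p k)"
  using \<open>k \<le> M\<close>
proof (induction k)
  case 0
  have "\<tau> 0 = a" using p by (simp add: is_partition_def)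
  then show ?case using b_expansion_play_a[OF u, of z] play_is_play(2)[OF u a_less_b r_pos, of z]
    unfolding w_node.simps w_node_deriv.simps fst_conv snd_conv by metis
next
  case (Suc k)
  then have k: "k < M" by simp
  note pp = partition_points[OF p k]
  have t: "\<tau> (Suc k) \<in> {\<tau> k..\<tau> (Suc k)}" using pp by auto
  note IH = conjunct1[OF Suc.IH[OF less_imp_le[OF k]]] conjunct2[OF Suc.IH[OF less_imp_le[OF k]]]
  have "a \<le> \<tau> k" "\<tau> (Suc k) \<le> b" using pp by auto
  note step = b_expansion_play_step[OF u this o[rule_format, OF k] t IH(2)]
  show ?case unfolding w_node.simps w_node_deriv.simps fst_conv snd_conv IH(1)
    using step by (rule conjI)
qed

text \<open>Difference quotients along the step sizes \<open>1 / (n + 1)\<close>: a sequence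
  suffices to fix the value, and it makes the derivative a countable limit of continuous functions
  of \<open>t\<close>.\<close>

definition play_deriv :: "(real \<Rightarrow> real) \<Rightarrow> real \<Rightarrow> (real \<Rightarrow> real) \<times> real \<Rightarrow> real \<Rightarrow> real" where
  "play_deriv u z p t = lim (\<lambda>n. (perturbed_play u z (inverse (real (Suc n)) *\<^sub>R p) t - play a b r u z t) * real (Suc n))"

text \<open>Along a ray both \<open>msize\<close> and \<open>N\<close> scale with the step, so the
  remainder divided by the step is at most \<open>e' * N p\<close>.\<close>

lemma b_expansion_directional:
  assumes B: "b_expansion small N f f0 D" and p: "p \<in> X \<times> UNIV" and hom: "\<And>l. l > 0 \<Longrightarrow> D (l *\<^sub>R p) = l * D p"
  shows "(\<lambda>n. (f (inverse (real (Suc n)) *\<^sub>R p) - f0) * real (Suc n)) \<longlonglongrightarrow> D p"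
proof (rule tendstoI)
  fix e :: real assume "e > 0"
  define q where "q n = inverse (real (Suc n)) *\<^sub>R p" for n
  have q: "q n \<in> X \<times> UNIV" for n unfolding q_def using scale_mem[OF p] .
  have "(\<lambda>n. msize (q n)) = (\<lambda>n. inverse (real (Suc n)) * msize p)"
    unfolding q_def msize_scale[OF p] by (simp add: fun_eq_iff)
  also have "\<dots> \<longlonglongrightarrow> 0" using tendsto_mult_right[OF LIMSEQ_inverse_real_of_nat, of "msize p"] by simp
  finally have fl: "filterlim q small sequentially" by (intro filterlim_small q)
  \<comment> \<open>The summand 1 covers the case \<open>N p = 0\<close>.\<close>
  define e' where "e' = e / (N p + 1)"
  have "e' > 0" using \<open>e > 0\<close> N_nonneg[OF p] by (simp add: e'_def)
  have "\<forall>\<^sub>F n in sequentially. \<bar>f (q n) - f0 - D (q n)\<bar> \<le> e' * N (q n)"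
    using b_expansionD(2)[OF B \<open>e' > 0\<close>] fl unfolding filterlim_iff by blast
  then have "\<forall>\<^sub>F n in sequentially. dist ((f (q n) - f0) * real (Suc n)) (D p) < e"
  proof eventually_elim
    case (elim n)
    have Nq: "N (q n) = inverse (real (Suc n)) * N p" unfolding q_def
      using N_scale[of "fst p" "inverse (real (Suc n))" "snd p"] p by (simp add: mem_Times_iff)
    have "D (q n) * real (Suc n) = D p" unfolding q_def using hom[of "inverse (real (Suc n))"] by simp
    then have "\<bar>(f (q n) - f0) * real (Suc n) - D p\<bar> = \<bar>(f (q n) - f0 - D (q n)) * real (Suc n)\<bar>"
      by (simp only: left_diff_distrib)
    also have "\<dots> = \<bar>f (q n) - f0 - D (q n)\<bar> * real (Suc n)" by (simp only: abs_mult abs_of_nat)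
    also have "\<dots> \<le> e' * N (q n) * real (Suc n)" using elim by (intro mult_right_mono) auto
    also have "\<dots> = e' * N p" unfolding Nq by simp
    also have "\<dots> < e" using \<open>e > 0\<close> N_nonneg[OF p] by (simp add: e'_def field_simps)
    finally show ?case by (simp add: dist_real_def)
  qed
  then show "\<forall>\<^sub>F n in sequentially. dist ((f (inverse (real (Suc n)) *\<^sub>R p) - f0) * real (Suc n)) (D p) < e"
    by (simp add: q_def)
qed

lemma piece_scale:
  assumes u: "continuous_on {a..b} u" and P: "is_partition a b M \<tau>"
    and o: "\<forall>k<M. osc {\<tau> k..\<tau> (Suc k)} u < r" and k: "k < M" and t: "t \<in> {\<tau> k..\<tau> (Suc k)}"
    and p: "p \<in> X \<times> UNIV" and "l > 0"
  shows "P_loc_deriv r {\<tau> k..\<tau> (Suc k)} (u, w) (fst (l *\<^sub>R p), w_node_deriv r \<tau> (u, z) (l *\<^sub>R p) k) t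
     = l * P_loc_deriv r {\<tau> k..\<tau> (Suc k)} (u, w) (fst p, w_node_deriv r \<tau> (u, z) p k) t"
proof -
  have ch: "continuous_on {a..b} (fst p)" using p X_continuous by auto
  have 1: "l *\<^sub>R p = (\<lambda>x. l * fst p x, l * snd p)" by (cases p) (simp add: scaleR_fun_def)
  have 2: "w_node_deriv r \<tau> (u, z) (l *\<^sub>R p) k = l * w_node_deriv r \<tau> (u, z) p k"
    unfolding 1 using w_node_deriv_scale[OF u ch r_pos \<open>l > 0\<close> P o[rule_format], of k z "snd p"] partition_points[OF P] k by simp
  have "continuous_on {\<tau> k..\<tau> (Suc k)} u" "continuous_on {\<tau> k..\<tau> (Suc k)} (fst p)"
    using u ch partition_points[OF P k] by (auto intro: continuous_on_subset)
  from P_loc_deriv_scale[OF this(1) o[rule_format, OF k] r_pos t this(2) \<open>l > 0\<close>] show ?thesis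
    unfolding 2 by (simp add: scaleR_fun_def)
qed

lemma play_deriv_piece:
  fixes z :: real
  assumes u: "continuous_on {a..b} u" and P: "is_partition a b M \<tau>"
    and o: "\<forall>k<M. osc {\<tau> k..\<tau> (Suc k)} u < r" and k: "k < M" and t: "t \<in> {\<tau> k..\<tau> (Suc k)}"
  defines "D \<equiv> (\<lambda>p. P_loc_deriv r {\<tau> k..\<tau> (Suc k)} (u, w_node r \<tau> u z k) (fst p, w_node_deriv r \<tau> (u, z) p k) t)"
  shows "b_expansion small N (\<lambda>p. perturbed_play u z p t) (play a b r u z t) D"
    and "p \<in> X \<times> UNIV \<Longrightarrow> l > 0 \<Longrightarrow> D (l *\<^sub>R p) = l * D p"
    and "p \<in> X \<times> UNIV \<Longrightarrow>
      (\<lambda>n. (perturbed_play u z (inverse (real (Suc n)) *\<^sub>R p) t - play a b r u z t) * real (Suc n)) \<longlonglongrightarrow> D p"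
    and "p \<in> X \<times> UNIV \<Longrightarrow> play_deriv u z p t = D p"
proof -
  note pp = partition_points[OF P k]
  have node: "w_node r \<tau> u z k = play a b r u z (\<tau> k)"
    "b_expansion small N (\<lambda>p. perturbed_play u z p (\<tau> k)) (play a b r u z (\<tau> k)) (\<lambda>p. w_node_deriv r \<tau> (u, z) p k)"
    using b_expansion_play_node[OF u P o less_imp_le[OF k], of z] by (blast, blast)
  have pp': "a \<le> \<tau> k" "\<tau> (Suc k) \<le> b" using pp by auto
  show B: "b_expansion small N (\<lambda>p. perturbed_play u z p t) (play a b r u z t) D"
    unfolding D_def node(1) by (rule b_expansion_play_step(2)[OF u pp' o[rule_format, OF k] t node(2)])
  show hom: "D (l *\<^sub>R p) = l * D p" if "p \<in> X \<times> UNIV" "l > 0" for l p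
    unfolding D_def by (rule piece_scale[OF u P o k t that])
  show lim: "(\<lambda>n. (perturbed_play u z (inverse (real (Suc n)) *\<^sub>R p) t - play a b r u z t) * real (Suc n)) \<longlonglongrightarrow> D p"
    if "p \<in> X \<times> UNIV"
    using b_expansion_directional[OF B that hom[OF that]] .
  show "play_deriv u z p t = D p" if "p \<in> X \<times> UNIV" unfolding play_deriv_def using limI[OF lim[OF that]] .
qed

lemma play_deriv_props:
  assumes u: "continuous_on {a..b} u" and t: "t \<in> {a..b}"
  shows play_deriv_expansion: "b_expansion small N (\<lambda>p. perturbed_play u z p t) (play a b r u z t) (\<lambda>p. play_deriv u z p t)"
    and play_deriv_scale: "p \<in> X \<times> UNIV \<Longrightarrow> l > 0 \<Longrightarrow> play_deriv u z (l *\<^sub>R p) t = l * play_deriv u z p t"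
    and play_deriv_lim: "p \<in> X \<times> UNIV \<Longrightarrow>
      (\<lambda>n. (perturbed_play u z (inverse (real (Suc n)) *\<^sub>R p) t - play a b r u z t) * real (Suc n)) \<longlonglongrightarrow> play_deriv u z p t"
proof -
  obtain M \<tau> where P: "is_partition a b M \<tau>" and o: "\<forall>k<M. osc {\<tau> k..\<tau> (Suc k)} u < r"
    using small_oscillation_partition[OF u a_less_b r_pos] by blast
  obtain k where k: "k < M" "t \<in> {\<tau> k..\<tau> (Suc k)}" using partition_cover[OF P t a_less_b] .
  note D = play_deriv_piece[OF u P o k, where z = z]
  show "b_expansion small N (\<lambda>p. perturbed_play u z p t) (play a b r u z t) (\<lambda>p. play_deriv u z p t)"
    by (rule b_expansion_cong[OF D(1) _ refl eventually_mono[OF eventually_small_mem]]) (use D(4) in auto)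
  show "play_deriv u z (l *\<^sub>R p) t = l * play_deriv u z p t" if "p \<in> X \<times> UNIV" "l > 0"
    using D(2)[OF that] D(4)[OF that(1)] D(4)[OF scale_mem[OF that(1)]] by simp
  show "(\<lambda>n. (perturbed_play u z (inverse (real (Suc n)) *\<^sub>R p) t - play a b r u z t) * real (Suc n)) \<longlonglongrightarrow> play_deriv u z p t"
    if "p \<in> X \<times> UNIV" using D(3)[OF that] D(4)[OF that] by simp
qed

text \<open>Stability with \<open>e = msize p\<close>: at the start, the errors of the input and of
  the projected initial value add up, which is why \<open>msize\<close> is a sum.\<close>

lemma play_increment_bound:
  assumes u: "continuous_on {a..b} u" and t: "t \<in> {a..b}" and p: "p \<in> X \<times> UNIV"
  shows "\<bar>perturbed_play u z p t - play a b r u z t\<bar> \<le> msize p"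
proof (rule is_play_stable[OF play_is_play(1)[OF _ a_less_b r_pos] play_is_play(1)[OF _ a_less_b r_pos] _ u r_pos _ _ t])
  show cp: "continuous_on {a..b} (u + fst p)" "continuous_on {a..b} (u + fst p)" using continuous_plus[OF u p] by auto
  show "\<bar>(u + fst p) x - u x\<bar> \<le> msize p" if "x \<in> {a..b}" for x using msize_upper[OF p that] by simp
  have "\<bar>fst p a\<bar> \<le> sup_norm a b (fst p)"
    using sup_norm_upper[OF X_continuous, of "fst p" a] p a_less_b by auto
  then show "\<bar>perturbed_play u z p a - play a b r u z a\<bar> \<le> msize p"
    unfolding play_is_play(2)[OF cp(1) a_less_b r_pos] play_is_play(2)[OF u a_less_b r_pos]
    using proj_lipschitz[of r "z + snd p" z] by (simp add: msize_def)
qed (use u in auto)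

lemma play_deriv_bound:
  assumes u: "continuous_on {a..b} u" and t: "t \<in> {a..b}" and p: "p \<in> X \<times> UNIV"
  shows "\<bar>play_deriv u z p t\<bar> \<le> msize p"
proof (rule LIMSEQ_le_const2[OF tendsto_rabs[OF play_deriv_lim[OF u t p]]], intro exI allI impI)
  fix n
  have "\<bar>perturbed_play u z (inverse (real (Suc n)) *\<^sub>R p) t - play a b r u z t\<bar> \<le> inverse (real (Suc n)) * msize p"
    using play_increment_bound[OF u t scale_mem[OF p, of "inverse (real (Suc n))"], of z]
    unfolding msize_scale[OF p] by (simp only: abs_of_nonneg inverse_nonnegative_iff_nonnegative of_nat_0_le_iff)
  then have "\<bar>perturbed_play u z (inverse (real (Suc n)) *\<^sub>R p) t - play a b r u z t\<bar> * real (Suc n) \<le> inverse (real (Suc n)) * msize p * real (Suc n)"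
    by (rule mult_right_mono) simp
  also have "\<dots> = msize p" by simp
  finally show "\<bar>(perturbed_play u z (inverse (real (Suc n)) *\<^sub>R p) t - play a b r u z t) * real (Suc n)\<bar> \<le> msize p"
    by (simp only: abs_mult abs_of_nat)
qed

text \<open>The recursion prescribes values for every admissible partition, and twice at inner
  nodes. All prescriptions agree because each of them is the limit that defines
  \<open>play_deriv\<close>.\<close>

lemma play_deriv_given_by_recursion:
  assumes u: "continuous_on {a..b} u" and p: "p \<in> X \<times> UNIV"
  shows "given_by_recursion a b r (u, z) p (play_deriv u z p)"
  unfolding given_by_recursion_def using play_deriv_piece(4)[OF u _ _ _ _ p] by auto

end

section \<open>Estimates in \<open>L\<^sup>q\<close>\<close>

lemma finite_measure_interval: "finite_measure (lebesgue_on {a<..<b::real})"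
  by (rule finite_measure_lebesgue_on) simp

lemma measurable_continuous:
  assumes "continuous_on {a..b::real} f"
  shows "(f :: real \<Rightarrow> real) \<in> borel_measurable (lebesgue_on {a<..<b})"
  by (rule continuous_imp_measurable_on_sets_lebesgue)
     (use assms in \<open>auto intro: continuous_on_subset greaterThanLessThan_subseteq_atLeastAtMost_iff[THEN iffD2]\<close>)

lemma Lp_finite_exponent:
  assumes "1 \<le> q" "q < \<infinity>"
  shows "1 \<le> enn2real q" "q \<noteq> \<infinity>"
  using assms by (cases q; simp add: ennreal_1[symmetric] del: ennreal_1)+

lemma Lp_bounded:
  assumes q: "1 \<le> q" "q < \<infinity>" and f: "f \<in> borel_measurable (lebesgue_on {a<..<b})"
    and B: "\<And>x. x \<in> {a<..<b} \<Longrightarrow> \<bar>f x\<bar> \<le> B" and "0 \<le> B" "a < b"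
  shows "f \<in> Lp_space a b q" "Lp_norm a b q f \<le> B * (b - a) powr (1 / enn2real q)"
proof -
  interpret finite_measure "lebesgue_on {a<..<b}" by (rule finite_measure_interval)
  note q1 = Lp_finite_exponent[OF q]
  have bd: "\<bar>f x\<bar> powr enn2real q \<le> B powr enn2real q" if "x \<in> {a<..<b}" for x
    using B[OF that] q1 by (intro powr_mono2) auto
  have i: "integrable (lebesgue_on {a<..<b}) (\<lambda>x. \<bar>f x\<bar> powr enn2real q)"
    by (rule integrable_const_bound[of _ "B powr enn2real q"])
       (use bd f in \<open>auto intro!: AE_I2\<close>)
  then show "f \<in> Lp_space a b q" using f q1 by (simp add: Lp_space_def)
  have "(LINT x|lebesgue_on {a<..<b}. \<bar>f x\<bar> powr enn2real q) \<le> (LINT x|lebesgue_on {a<..<b}. B powr enn2real q)"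
    by (rule integral_mono[OF i]) (use bd in auto)
  also have "\<dots> = B powr enn2real q * (b - a)"
    using \<open>a < b\<close> by (simp add: measure_restrict_space)
  finally have "Lp_norm a b q f \<le> (B powr enn2real q * (b - a)) powr (1 / enn2real q)"
    using q1 unfolding Lp_norm_def by (auto intro!: powr_mono2 integral_nonneg_AE)
  also have "\<dots> = B * (b - a) powr (1 / enn2real q)"
    using q1 \<open>0 \<le> B\<close> \<open>a < b\<close> by (simp add: powr_mult powr_powr)
  finally show "Lp_norm a b q f \<le> B * (b - a) powr (1 / enn2real q)" .
qed

lemma Lp_norm_cong:
  assumes "q \<noteq> \<infinity>" "\<And>x. x \<in> {a<..<b} \<Longrightarrow> f x = g x"
  shows "Lp_norm a b q f = Lp_norm a b q g"
proof -
  have "(LINT x|lebesgue_on {a<..<b}. \<bar>f x\<bar> powr enn2real q) = (LINT x|lebesgue_on {a<..<b}. \<bar>g x\<bar> powr enn2real q)"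
    by (rule Bochner_Integration.integral_cong) (use assms in auto)
  then show ?thesis using assms(1) by (simp add: Lp_norm_def)
qed

lemma Lp_norm_nonneg: "0 \<le> Lp_norm a b q f"
  by (simp add: Lp_norm_def)

lemma Lp_norm_scale:
  assumes q: "1 \<le> q" "q < \<infinity>"
  shows "Lp_norm a b q (\<lambda>x. c * f x) = \<bar>c\<bar> * Lp_norm a b q f"
  using Lp_finite_exponent[OF q]
  by (simp add: Lp_norm_def abs_mult powr_mult powr_powr integral_nonneg_AE)

lemma Lp_norm_tendsto_0:
  assumes q: "1 \<le> q" "q < \<infinity>" and f: "\<And>n. f n \<in> borel_measurable (lebesgue_on {a<..<b})"
    and B: "\<And>n x. x \<in> {a<..<b} \<Longrightarrow> \<bar>f n x\<bar> \<le> B"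
    and lim: "\<And>x. x \<in> {a<..<b} \<Longrightarrow> (\<lambda>n. f n x) \<longlonglongrightarrow> 0"
  shows "(\<lambda>n. Lp_norm a b q (f n)) \<longlonglongrightarrow> 0"
proof -
  interpret finite_measure "lebesgue_on {a<..<b}" by (rule finite_measure_interval)
  note q1 = Lp_finite_exponent[OF q]
  have "(\<lambda>n. LINT x|lebesgue_on {a<..<b}. \<bar>f n x\<bar> powr enn2real q) \<longlonglongrightarrow> (LINT x|lebesgue_on {a<..<b}. 0)"
  proof (rule integral_dominated_convergence[where w = "\<lambda>_. B powr enn2real q"])
    show "AE x in lebesgue_on {a<..<b}. (\<lambda>n. \<bar>f n x\<bar> powr enn2real q) \<longlonglongrightarrow> 0"
      using q1 by (intro AE_I2 tendsto_zero_powrI[OF tendsto_rabs_zero[OF lim] tendsto_const]) auto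
    show "AE x in lebesgue_on {a<..<b}. norm (\<bar>f n x\<bar> powr enn2real q) \<le> B powr enn2real q" for n
      using q1 B by (auto intro!: AE_I2 powr_mono2)
  qed (use f in auto)
  then have "(\<lambda>n. (LINT x|lebesgue_on {a<..<b}. \<bar>f n x\<bar> powr enn2real q) powr (1 / enn2real q)) \<longlonglongrightarrow> 0"
    using q1 by (intro tendsto_zero_powrI[OF _ tendsto_const]) (auto simp: integral_nonneg_AE)
  then show ?thesis using q1 by (simp add: Lp_norm_def)
qed

section \<open>The remainder of the play in \<open>L\<^sup>q\<close> and its modulus\<close>

context play_space
begin

definition play_remainder :: "(real \<Rightarrow> real) \<Rightarrow> real \<Rightarrow> (real \<Rightarrow> real) \<times> real \<Rightarrow> real \<Rightarrow> real" where
  "play_remainder u z p t = perturbed_play u z p t - play a b r u z t - play_deriv u z p t"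

lemma play_continuous:
  assumes "continuous_on {a..b} u"
  shows "continuous_on {a..b} (play a b r u z)"
  by (rule is_play_continuous[OF play_is_play(1)[OF assms a_less_b r_pos] assms r_pos])

lemma play_deriv_measurable:
  assumes u: "continuous_on {a..b} u" and p: "p \<in> X \<times> UNIV"
  shows "play_deriv u z p \<in> borel_measurable (lebesgue_on {a<..<b})"
proof (rule borel_measurable_LIMSEQ_real)
  show "(\<lambda>n. (perturbed_play u z (inverse (real (Suc n)) *\<^sub>R p) t - play a b r u z t) * real (Suc n)) \<longlonglongrightarrow> play_deriv u z p t"
    if "t \<in> space (lebesgue_on {a<..<b})" for t
    using that by (intro play_deriv_lim[OF u _ p]) auto
  show "(\<lambda>t. (perturbed_play u z (inverse (real (Suc n)) *\<^sub>R p) t - play a b r u z t) * real (Suc n))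
          \<in> borel_measurable (lebesgue_on {a<..<b})" for n
    by (intro measurable_continuous continuous_intros play_continuous continuous_plus u scale_mem p)
qed

lemma play_remainder_measurable:
  assumes u: "continuous_on {a..b} u" and p: "p \<in> X \<times> UNIV"
  shows "play_remainder u z p \<in> borel_measurable (lebesgue_on {a<..<b})"
  unfolding play_remainder_def
  by (intro borel_measurable_diff play_deriv_measurable measurable_continuous play_continuous continuous_plus u p)

lemma play_remainder_bound:
  assumes u: "continuous_on {a..b} u" and t: "t \<in> {a..b}" and p: "p \<in> X \<times> UNIV"
  shows "\<bar>play_remainder u z p t\<bar> \<le> 2 * msize p"
  using play_increment_bound[OF assms, of z] play_deriv_bound[OF assms, of z] unfolding play_remainder_def by linarith

text \<open>A counterexample would give increments \<open>p n\<close> with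
  \<open>msize (p n)\<close> tending to 0 whose remainders, divided by \<open>N (p n)\<close>, have
  norm above \<open>e\<close>. These quotients are bounded by \<open>2 * K\<close> and tend to 0 at
  every time by the pointwise expansion, which contradicts dominated convergence.\<close>

lemma play_remainder_small:
  assumes q: "1 \<le> q" "q < \<infinity>" and u: "continuous_on {a..b} u" and "e > 0"
  obtains d where "d > 0" "\<And>p. p \<in> X \<times> UNIV \<Longrightarrow> msize p \<le> d \<Longrightarrow> Lp_norm a b q (play_remainder u z p) \<le> e * N p"
proof -
  have "\<exists>d>0. \<forall>p\<in>X \<times> UNIV. msize p \<le> d \<longrightarrow> Lp_norm a b q (play_remainder u z p) \<le> e * N p"
  proof (rule ccontr)
    assume neg: "\<not> ?thesis"
    have "\<exists>p\<in>X \<times> UNIV. msize p \<le> inverse (real (Suc n)) \<and> Lp_norm a b q (play_remainder u z p) > e * N p" for n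
    proof -
      have "inverse (real (Suc n)) > 0" by simp
      with neg show ?thesis by (meson not_less)
    qed
    then obtain p where p: "\<And>n. p n \<in> X \<times> UNIV" "\<And>n. msize (p n) \<le> inverse (real (Suc n))"
      "\<And>n. Lp_norm a b q (play_remainder u z (p n)) > e * N (p n)" by metis
    obtain K where K: "K > 0" "\<And>p. p \<in> X \<times> UNIV \<Longrightarrow> msize p \<le> K * N p" using N_bound_msize by blast
    have sub: "x \<in> {a..b}" if "x \<in> {a<..<b}" for x using that by auto
    \<comment> \<open>If \<open>N (p n)\<close> were 0, so would be \<open>msize (p n)\<close> and
      hence the remainder, against the strict inequality in the choice of
      \<open>p n\<close>.\<close>
    have Npos: "N (p n) > 0" for n
    proof (rule ccontr)
      assume "\<not> N (p n) > 0"
      then have N0: "N (p n) = 0" using N_nonneg[OF p(1)] by (simp add: order_class.order_eq_iff)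
      then have "msize (p n) \<le> 0" using K(2)[OF p(1)[of n]] by simp
      then have "\<bar>play_remainder u z (p n) x\<bar> \<le> 0" if "x \<in> {a<..<b}" for x
        using play_remainder_bound[OF u sub[OF that] p(1), of z n] by simp
      from Lp_bounded(2)[OF q play_remainder_measurable[OF u p(1)] this _ a_less_b]
      have "Lp_norm a b q (play_remainder u z (p n)) \<le> 0" by simp
      then show False using p(3)[of n] N0 by simp
    qed
    have "(\<lambda>n. Lp_norm a b q (\<lambda>x. inverse (N (p n)) * play_remainder u z (p n) x)) \<longlonglongrightarrow> 0"
    proof (rule Lp_norm_tendsto_0[OF q, where B = "2 * K"])
      show "(\<lambda>x. inverse (N (p n)) * play_remainder u z (p n) x) \<in> borel_measurable (lebesgue_on {a<..<b})" for n
        using play_remainder_measurable[OF u p(1)[of n]] by measurable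
    next
      fix n x assume x: "x \<in> {a<..<b}"
      have "\<bar>play_remainder u z (p n) x\<bar> \<le> 2 * K * N (p n)"
        using play_remainder_bound[OF u sub[OF x] p(1)[of n], of z] K(2)[OF p(1)[of n]] by simp
      then show "\<bar>inverse (N (p n)) * play_remainder u z (p n) x\<bar> \<le> 2 * K"
        using Npos[of n] by (simp add: abs_mult field_simps)
    next
      fix x assume x: "x \<in> {a<..<b}"
      have "(\<lambda>n. msize (p n)) \<longlonglongrightarrow> 0"
        by (rule tendsto_sandwich[OF _ _ tendsto_const LIMSEQ_inverse_real_of_nat])
           (use msize_nonneg[OF p(1)] p(2) in auto)
      then have fl: "filterlim p small sequentially" by (intro filterlim_small p)
      show "(\<lambda>n. inverse (N (p n)) * play_remainder u z (p n) x) \<longlonglongrightarrow> 0"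
      proof (rule tendstoI)
        fix e' :: real assume "e' > 0"
        then have "e' / 2 > 0" by simp
        have "\<forall>\<^sub>F n in sequentially. \<bar>play_remainder u z (p n) x\<bar> \<le> e' / 2 * N (p n)"
          using b_expansionD(2)[OF play_deriv_expansion[OF u sub[OF x], of z] \<open>e' / 2 > 0\<close>] fl unfolding filterlim_iff play_remainder_def by blast
        then show "\<forall>\<^sub>F n in sequentially. dist (inverse (N (p n)) * play_remainder u z (p n) x) 0 < e'"
        proof eventually_elim
          case (elim n)
          have "\<bar>play_remainder u z (p n) x\<bar> < e' * N (p n)"
            using elim mult_pos_pos[OF \<open>e' > 0\<close> Npos[of n]] by linarith
          then show ?case using Npos[of n] by (simp add: dist_real_def abs_mult field_simps)
        qed
      qed
    qed
    then have "\<forall>\<^sub>F n in sequentially. Lp_norm a b q (\<lambda>x. inverse (N (p n)) * play_remainder u z (p n) x) < e"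
      using \<open>e > 0\<close> by (rule order_tendstoD(2))
    then obtain n where "Lp_norm a b q (\<lambda>x. inverse (N (p n)) * play_remainder u z (p n) x) < e"
      by (meson eventually_sequentially order_refl)
    then have "inverse (N (p n)) * Lp_norm a b q (play_remainder u z (p n)) < e"
      unfolding Lp_norm_scale[OF q] using Npos[of n] by simp
    then show False using p(3)[of n] Npos[of n] by (simp add: field_simps)
  qed
  then show thesis using that by blast
qed

text \<open>Increments with \<open>N p = 0\<close> enter as \<open>0\<close> because \<open>x / 0 = 0\<close>; their remainder vanishes.\<close>

definition modulus :: "ennreal \<Rightarrow> (real \<Rightarrow> real) \<Rightarrow> real \<Rightarrow> real \<Rightarrow> real" where
  "modulus q u z \<delta> = Sup (insert 0 {Lp_norm a b q (play_remainder u z p) / N p |p. p \<in> X \<times> UNIV \<and> msize p \<le> \<delta>})"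

text \<open>The play and its derivative are both 1-Lipschitz-bounded by \<open>msize\<close>,
  whatever the base point, which gives the factor 2 and a constant independent of \<open>u\<close>
  and \<open>z\<close>.\<close>

lemma play_remainder_uniform_bound:
  assumes q: "1 \<le> q" "q < \<infinity>"
  obtains C where "C \<ge> 0" "\<And>u z p. continuous_on {a..b} u \<Longrightarrow> p \<in> X \<times> UNIV \<Longrightarrow>
     Lp_norm a b q (play_remainder u z p) \<le> C * N p"
proof -
  obtain K where K: "K > 0" "\<And>p. p \<in> X \<times> UNIV \<Longrightarrow> msize p \<le> K * N p" using N_bound_msize by blast
  have "Lp_norm a b q (play_remainder u z p) \<le> (2 * K * (b - a) powr (1 / enn2real q)) * N p"
    if u: "continuous_on {a..b} u" and p: "p \<in> X \<times> UNIV" for u z p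
  proof -
    have "Lp_norm a b q (play_remainder u z p) \<le> (2 * K * N p) * (b - a) powr (1 / enn2real q)"
    proof (rule Lp_bounded(2)[OF q play_remainder_measurable[OF u p]])
      show "\<bar>play_remainder u z p x\<bar> \<le> 2 * K * N p" if "x \<in> {a<..<b}" for x
        using play_remainder_bound[OF u _ p, of x z] K(2)[OF p] that by auto
      show "0 \<le> 2 * K * N p" using K(1) N_nonneg[OF p] by simp
    qed (rule a_less_b)
    then show ?thesis by (simp add: mult_ac)
  qed
  then show thesis using that[of "2 * K * (b - a) powr (1 / enn2real q)"] K(1) by simp
qed

text \<open>Monotonicity holds since the set of admissible increments grows with
  \<open>\<delta>\<close>; the element 0 inserted in \<open>modulus\<close> keeps the set nonempty
  and the supremum nonnegative for every \<open>\<delta>\<close>.\<close>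

lemma modulus_props:
  assumes q: "1 \<le> q" "q < \<infinity>" and u: "continuous_on {a..b} u"
    and C: "C \<ge> 0" "\<forall>p\<in>X \<times> UNIV. Lp_norm a b q (play_remainder u z p) \<le> C * N p"
  shows "\<And>p \<delta>. p \<in> X \<times> UNIV \<Longrightarrow> msize p \<le> \<delta> \<Longrightarrow>
      Lp_norm a b q (play_remainder u z p) \<le> modulus q u z \<delta> * N p"
    and "\<And>\<delta>. 0 \<le> modulus q u z \<delta>"
    and "\<And>\<delta>. modulus q u z \<delta> \<le> C"
    and "mono_on {0..} (modulus q u z)"
    and "(modulus q u z \<longlongrightarrow> 0) (at_right 0)"
proof -
  let ?S = "\<lambda>\<delta>. insert 0 {Lp_norm a b q (play_remainder u z p) / N p |p. p \<in> X \<times> UNIV \<and> msize p \<le> \<delta>}"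
  have ratio: "Lp_norm a b q (play_remainder u z p) / N p \<le> c" if "p \<in> X \<times> UNIV" "c \<ge> 0" "Lp_norm a b q (play_remainder u z p) \<le> c * N p" for p c
    using that N_nonneg[OF that(1)] by (cases "N p = 0") (auto simp: divide_le_eq)
  have ub: "x \<le> C" if "x \<in> ?S \<delta>" for x \<delta>
    using that C ratio by auto
  have bdd: "bdd_above (?S \<delta>)" for \<delta> using ub unfolding bdd_above_def by blast
  show nn: "0 \<le> modulus q u z \<delta>" for \<delta> unfolding modulus_def by (rule cSup_upper[OF _ bdd]) simp
  show "modulus q u z \<delta> \<le> C" for \<delta> unfolding modulus_def by (rule cSup_least) (use ub in blast)+
  show "Lp_norm a b q (play_remainder u z p) \<le> modulus q u z \<delta> * N p" if p: "p \<in> X \<times> UNIV" "msize p \<le> \<delta>" for p \<delta>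
  proof -
    have "Lp_norm a b q (play_remainder u z p) / N p \<le> modulus q u z \<delta>"
      unfolding modulus_def by (rule cSup_upper[OF _ bdd]) (use p in blast)
    \<comment> \<open>For \<open>N p = 0\<close> the ratio carries no information; there the a
      priori bound with \<open>C\<close> forces the norm to be at most 0.\<close>
    then show ?thesis using bspec[OF C(2) p(1)] N_nonneg[OF p(1)] by (cases "N p = 0") (auto simp: divide_le_eq)
  qed
  show "mono_on {0..} (modulus q u z)"
  proof (rule mono_onI)
    fix x y :: real assume "x \<le> y"
    then show "modulus q u z x \<le> modulus q u z y" unfolding modulus_def
      by (intro cSup_subset_mono bdd) force+
  qed
  show "(modulus q u z \<longlongrightarrow> 0) (at_right 0)"
  proof (rule tendstoI)
    fix e :: real assume "e > 0"
    then have "e / 2 > 0" by simp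
    obtain d where d: "d > 0" "\<And>p. p \<in> X \<times> UNIV \<Longrightarrow> msize p \<le> d \<Longrightarrow> Lp_norm a b q (play_remainder u z p) \<le> e / 2 * N p"
      using play_remainder_small[OF q u \<open>e / 2 > 0\<close>, of z] by blast
    have "dist (modulus q u z \<delta>) 0 < e" if "0 < \<delta>" "\<delta> < d" for \<delta>
    proof -
      have "x \<le> e / 2" if "x \<in> ?S \<delta>" for x
      proof (cases "x = 0")
        case False
        then obtain p where "x = Lp_norm a b q (play_remainder u z p) / N p" "p \<in> X \<times> UNIV" "msize p \<le> \<delta>"
          using \<open>x \<in> ?S \<delta>\<close> by blast
        then show ?thesis using ratio[of p "e / 2"] d(2)[of p] \<open>e > 0\<close> \<open>\<delta> < d\<close> by simp
      qed (use \<open>e > 0\<close> in simp)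
      then have "modulus q u z \<delta> \<le> e / 2" unfolding modulus_def by (intro cSup_least) blast+
      then show ?thesis using nn[of \<delta>] \<open>e > 0\<close> by (simp add: dist_real_def)
    qed
    then show "\<forall>\<^sub>F \<delta> in at_right 0. dist (modulus q u z \<delta>) 0 < e"
      unfolding eventually_at_right_field using d(1) by blast
  qed
qed

lemma play_mem_Lp:
  assumes q: "1 \<le> q" "q < \<infinity>" and u: "continuous_on {a..b} u"
  shows "play a b r u z \<in> Lp_space a b q"
proof -
  have c: "continuous_on {a..b} (play a b r u z)" by (rule play_continuous[OF u])
  show ?thesis
  proof (rule Lp_bounded(1)[OF q measurable_continuous[OF c]])
    show "\<bar>play a b r u z x\<bar> \<le> sup_norm a b (play a b r u z)" if "x \<in> {a<..<b}" for x
      using that by (intro sup_norm_upper[OF c]) auto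
  qed (use sup_norm_nonneg[OF _ c] a_less_b in auto)
qed

lemma play_deriv_mem_Lp:
  assumes q: "1 \<le> q" "q < \<infinity>" and u: "continuous_on {a..b} u" and p: "p \<in> X \<times> UNIV"
  shows "play_deriv u z p \<in> Lp_space a b q"
  by (rule Lp_bounded(1)[OF q play_deriv_measurable[OF u p]])
     (use play_deriv_bound[OF u _ p] msize_nonneg[OF p] a_less_b in auto)

lemma play_bouligand:
  assumes q: "1 \<le> q" "q < \<infinity>" and uz: "uz \<in> X \<times> UNIV"
  shows "has_bouligand_derivative_at (X \<times> UNIV) N (X \<times> UNIV) (Lp_space a b q) (Lp_norm a b q)
           (\<lambda>(v, \<zeta>). play a b r v \<zeta>) uz (play_deriv (fst uz) (snd uz))"
proof -
  define u where "u = fst uz"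
  define z where "z = snd uz"
  have u: "continuous_on {a..b} u" using uz X_continuous by (auto simp: u_def)
  obtain C where C: "C \<ge> 0" "\<And>u z p. continuous_on {a..b} u \<Longrightarrow> p \<in> X \<times> UNIV \<Longrightarrow>
     Lp_norm a b q (play_remainder u z p) \<le> C * N p" using play_remainder_uniform_bound[OF q] by blast
  have "\<forall>p\<in>X \<times> UNIV. Lp_norm a b q (play_remainder u z p) \<le> C * N p" using C(2)[OF u] by blast
  note M = modulus_props[OF q u C(1) this]
  have F: "(\<lambda>(v, \<zeta>). play a b r v \<zeta>) (uz + p) = perturbed_play u z p" for p
    by (simp add: case_prod_beta u_def z_def)
  have F0: "(\<lambda>(v, \<zeta>). play a b r v \<zeta>) uz = play a b r u z"
    by (simp add: case_prod_beta u_def z_def)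
  have rem: "perturbed_play u z p - play a b r u z - play_deriv u z p = play_remainder u z p" for p
    by (simp add: fun_eq_iff play_remainder_def)
  have dir: "((\<lambda>l. Lp_norm a b q ((perturbed_play u z (l *\<^sub>R p) - play a b r u z) /\<^sub>R l - play_deriv u z p)) \<longlongrightarrow> 0) (at_right 0)"
    if p: "p \<in> X \<times> UNIV" for p
  proof (rule tendsto_sandwich[OF always_eventually eventually_mono[OF eventually_at_right_less] tendsto_const])
    show "\<forall>l. 0 \<le> Lp_norm a b q ((perturbed_play u z (l *\<^sub>R p) - play a b r u z) /\<^sub>R l - play_deriv u z p)"
      by (simp add: Lp_norm_nonneg)
    \<comment> \<open>By homogeneity the left-hand side is the remainder at
      \<open>l *\<^sub>R p\<close> divided by \<open>l\<close>. The argument uses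
      \<open>msize p + 1\<close> instead of \<open>msize p\<close> to stay strictly positive, as the
      limit of \<open>modulus\<close> is only known from the right of 0.\<close>
    show "Lp_norm a b q ((perturbed_play u z (l *\<^sub>R p) - play a b r u z) /\<^sub>R l - play_deriv u z p) \<le> modulus q u z (l * (msize p + 1)) * N p"
      if "0 < l" for l
    proof -
      have "Lp_norm a b q ((perturbed_play u z (l *\<^sub>R p) - play a b r u z) /\<^sub>R l - play_deriv u z p) =
          Lp_norm a b q (\<lambda>x. inverse l * play_remainder u z (l *\<^sub>R p) x)"
        by (rule Lp_norm_cong[OF Lp_finite_exponent(2)[OF q]])
           (use play_deriv_scale[OF u _ p \<open>0 < l\<close>, of _ z] \<open>0 < l\<close> in \<open>auto simp: scaleR_fun_def play_remainder_def algebra_simps\<close>)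
      also have "\<dots> = inverse l * Lp_norm a b q (play_remainder u z (l *\<^sub>R p))"
        unfolding Lp_norm_scale[OF q] using that by simp
      also have "\<dots> \<le> inverse l * (modulus q u z (l * (msize p + 1)) * N (l *\<^sub>R p))"
        using that msize_scale[OF p, of l]
        by (intro mult_left_mono M(1) scale_mem p) (auto simp: algebra_simps)
      also have "\<dots> = modulus q u z (l * (msize p + 1)) * N p"
        using N_scale[of "fst p" l "snd p"] p that by (simp add: mem_Times_iff)
      finally show ?thesis .
    qed
    have "((\<lambda>l::real. l * (msize p + 1)) \<longlongrightarrow> 0 * (msize p + 1)) (at_right 0)"
      by (intro tendsto_intros)
    then have "filterlim (\<lambda>l. l * (msize p + 1)) (at_right 0) (at_right (0::real))"
      unfolding filterlim_at using msize_nonneg[OF p]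
      by (auto simp: eventually_at_filter intro!: always_eventually)
    from filterlim_compose[OF M(5) this]
    have "((\<lambda>l. modulus q u z (l * (msize p + 1))) \<longlongrightarrow> 0) (at_right 0)" .
    from tendsto_mult_right[OF this, of "N p"]
    show "((\<lambda>l. modulus q u z (l * (msize p + 1)) * N p) \<longlongrightarrow> 0) (at_right 0)" by simp
  qed
  have bou: "\<exists>d>0. \<forall>h\<in>X \<times> UNIV. uz + h \<in> X \<times> UNIV \<and> 0 < N h \<and> N h < d \<longrightarrow> Lp_norm a b q (play_remainder u z h) / N h \<le> e"
    if "e > 0" for e
  proof -
    obtain d where d: "d > 0" "\<And>p. p \<in> X \<times> UNIV \<Longrightarrow> msize p \<le> d \<Longrightarrow> Lp_norm a b q (play_remainder u z p) \<le> e * N p"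
      using play_remainder_small[OF q u \<open>e > 0\<close>, of z] by blast
    obtain K where K: "K > 0" "\<And>p. p \<in> X \<times> UNIV \<Longrightarrow> msize p \<le> K * N p" using N_bound_msize by blast
    \<comment> \<open>The radius \<open>d / K\<close> converts smallness in \<open>N\<close> into
      smallness of \<open>msize\<close>.\<close>
    have "Lp_norm a b q (play_remainder u z h) / N h \<le> e" if h: "h \<in> X \<times> UNIV" "0 < N h" "N h < d / K" for h
    proof -
      have "K * N h \<le> d" using h(3) K(1) by (simp add: field_simps)
      then show ?thesis using d(2)[OF h(1)] K(2)[OF h(1)] h(2) by (simp add: divide_le_eq)
    qed
    then show ?thesis using d(1) K(1) by (intro exI[of _ "d / K"]) auto
  qed
  show ?thesis
    unfolding has_bouligand_derivative_at_def F F0 u_def[symmetric] z_def[symmetric] rem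
  proof (intro conjI)
    show "\<forall>v\<in>X \<times> UNIV. (\<lambda>(v, \<zeta>). play a b r v \<zeta>) v \<in> Lp_space a b q"
      using play_mem_Lp[OF q X_continuous] by auto
    show "\<forall>v\<in>X \<times> UNIV. \<exists>e>0. \<forall>w\<in>X \<times> UNIV. N (w - v) < e \<longrightarrow> w \<in> X \<times> UNIV"
      by (auto intro!: exI[of _ 1])
    show "\<forall>h\<in>X \<times> UNIV. play_deriv u z h \<in> Lp_space a b q \<and>
        ((\<lambda>l. Lp_norm a b q ((perturbed_play u z (l *\<^sub>R h) - play a b r u z) /\<^sub>R l - play_deriv u z h)) \<longlongrightarrow> 0) (at_right 0)"
      using dir play_deriv_mem_Lp[OF q u] by blast
    show "\<forall>e>0. \<exists>d>0. \<forall>h\<in>X \<times> UNIV. uz + h \<in> X \<times> UNIV \<and> 0 < N h \<and> N h < d \<longrightarrow> Lp_norm a b q (play_remainder u z h) / N h \<le> e"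
      using bou by blast
  qed (use uz in auto)
qed

theorem play_bouligand_estimate:
  assumes q: "1 \<le> q" "q < \<infinity>"
  shows "\<exists>(P' :: (real \<Rightarrow> real) \<times> real \<Rightarrow> (real \<Rightarrow> real) \<times> real \<Rightarrow> real \<Rightarrow> real)
          (\<rho> :: (real \<Rightarrow> real) \<times> real \<Rightarrow> real \<Rightarrow> real) (C :: real).
      (\<forall>uz \<in> X \<times> UNIV.
         has_bouligand_derivative_at (X \<times> UNIV) N (X \<times> UNIV) (Lp_space a b q) (Lp_norm a b q)
           (\<lambda>(v, \<zeta>). play a b r v \<zeta>) uz (P' uz) \<and>
         (\<forall>hy \<in> X \<times> UNIV. given_by_recursion a b r uz hy (P' uz hy)) \<and>
         (\<forall>h \<in> X. \<forall>y.
            Lp_norm a b q (play a b r (fst uz + h) (snd uz + y) - play a b r (fst uz) (snd uz)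
                             - P' uz (h, y))
              \<le> \<rho> uz (sup_norm a b h + \<bar>y\<bar>) * N (h, y)) \<and>
         mono_on {0..} (\<rho> uz) \<and> (\<rho> uz \<longlongrightarrow> 0) (at_right 0) \<and>
         (\<forall>\<delta>\<ge>0. 0 \<le> \<rho> uz \<delta> \<and> \<rho> uz \<delta> \<le> C))"
proof -
  obtain C where C: "C \<ge> 0" "\<And>u z p. continuous_on {a..b} u \<Longrightarrow> p \<in> X \<times> UNIV \<Longrightarrow>
     Lp_norm a b q (play_remainder u z p) \<le> C * N p" using play_remainder_uniform_bound[OF q] by blast
  show ?thesis
  proof (intro exI[of _ "\<lambda>uz. play_deriv (fst uz) (snd uz)"] exI[of _ "\<lambda>uz. modulus q (fst uz) (snd uz)"] exI[of _ C] ballI conjI)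
    fix uz :: "(real \<Rightarrow> real) \<times> real" assume uz: "uz \<in> X \<times> UNIV"
    then have u: "continuous_on {a..b} (fst uz)" using X_continuous by auto
    have "\<forall>p\<in>X \<times> UNIV. Lp_norm a b q (play_remainder (fst uz) (snd uz) p) \<le> C * N p" using C(2)[OF u] by blast
    note M = modulus_props[OF q u C(1) this]
    show "has_bouligand_derivative_at (X \<times> UNIV) N (X \<times> UNIV) (Lp_space a b q) (Lp_norm a b q)
           (\<lambda>(v, \<zeta>). play a b r v \<zeta>) uz (play_deriv (fst uz) (snd uz))"
      by (rule play_bouligand[OF q uz])
    show "given_by_recursion a b r uz hy (play_deriv (fst uz) (snd uz) hy)" if "hy \<in> X \<times> UNIV" for hy
      using play_deriv_given_by_recursion[OF u that, of "snd uz"] by simp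
    show "mono_on {0..} (modulus q (fst uz) (snd uz))" "(modulus q (fst uz) (snd uz) \<longlongrightarrow> 0) (at_right 0)"
      by (rule M(4), rule M(5))
    show "\<forall>\<delta>\<ge>0. 0 \<le> modulus q (fst uz) (snd uz) \<delta> \<and> modulus q (fst uz) (snd uz) \<delta> \<le> C"
      using M(2,3) by blast
    show "\<forall>y. Lp_norm a b q (play a b r (fst uz + h) (snd uz + y) - play a b r (fst uz) (snd uz)
          - play_deriv (fst uz) (snd uz) (h, y)) \<le> modulus q (fst uz) (snd uz) (sup_norm a b h + \<bar>y\<bar>) * N (h, y)"
      if "h \<in> X" for h
    proof
      fix y :: real
      from that have p: "(h, y) \<in> X \<times> UNIV" by simp
      have "play a b r (fst uz + h) (snd uz + y) - play a b r (fst uz) (snd uz) - play_deriv (fst uz) (snd uz) (h, y)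
        = play_remainder (fst uz) (snd uz) (h, y)" by (simp add: play_remainder_def fun_eq_iff)
      then show "Lp_norm a b q (play a b r (fst uz + h) (snd uz + y) - play a b r (fst uz) (snd uz)
          - play_deriv (fst uz) (snd uz) (h, y)) \<le> modulus q (fst uz) (snd uz) (sup_norm a b h + \<bar>y\<bar>) * N (h, y)"
        using M(1)[OF p, of "sup_norm a b h + \<bar>y\<bar>"] by (simp add: msize_def)
    qed
  qed
qed

end

section \<open>Smooth step functions\<close>

text \<open>The polynomial in \<open>1 / x\<close> makes the family closed under differentiation, so
  no formula for higher derivatives is required.\<close>

definition flat_exp :: "real poly \<Rightarrow> real \<Rightarrow> real" where
  "flat_exp p x = (if x > 0 then poly p (inverse x) * exp (- inverse x) else 0)"

lemma poly_exp_tendsto_0: "((\<lambda>y. poly p y * exp (- y)) \<longlongrightarrow> (0::real)) at_top"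
proof -
  have "((\<lambda>y. \<Sum>i\<le>degree p. coeff p i * (y ^ i / exp y)) \<longlongrightarrow> (\<Sum>i\<le>degree p. coeff p i * 0)) at_top"
    by (intro tendsto_sum tendsto_mult tendsto_const tendsto_power_div_exp_0)
  moreover have "(\<Sum>i\<le>degree p. coeff p i * (y ^ i / exp y)) = poly p y * exp (- y)" for y
    by (simp add: poly_altdef sum_distrib_left exp_minus divide_inverse mult_ac)
  ultimately show ?thesis by simp
qed

text \<open>With \<open>y = 1 / x\<close>, differentiating \<open>p(y) * exp(-y)\<close> in
  \<open>x\<close> gives \<open>y^2 * (p(y) - p'(y)) * exp(-y)\<close>; the two
  \<open>pCons 0\<close> stand for \<open>y^2\<close>.\<close>

lemma flat_exp_deriv:
  "(flat_exp p has_real_derivative flat_exp (pCons 0 (pCons 0 (p - pderiv p))) x) (at x)"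
proof -
  consider "x > 0" | "x < 0" | "x = 0" by linarith
  then show ?thesis
  proof cases
    case 1
    have "((\<lambda>x. poly p (inverse x) * exp (- inverse x)) has_real_derivative
        flat_exp (pCons 0 (pCons 0 (p - pderiv p))) x) (at x)"
      using 1 by (auto intro!: derivative_eq_intros simp: flat_exp_def field_simps)
    then show ?thesis
      by (rule has_field_derivative_transform_within_open[of _ _ _ "{0<..}"])
         (use 1 in \<open>auto simp: flat_exp_def\<close>)
  next
    case 2
    have "((\<lambda>x. 0) has_real_derivative flat_exp (pCons 0 (pCons 0 (p - pderiv p))) x) (at x)"
      using 2 by (simp add: flat_exp_def)
    then show ?thesis
      by (rule has_field_derivative_transform_within_open[of _ _ _ "{..<0}"])
         (use 2 in \<open>auto simp: flat_exp_def\<close>)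
  next
    case 3
    \<comment> \<open>Dividing by \<open>h\<close> multiplies the polynomial by
      \<open>inverse h\<close>, hence \<open>pCons 0 p\<close>; exponential decay still
      wins.\<close>
    have "((\<lambda>h. poly (pCons 0 p) (inverse h) * exp (- inverse h)) \<longlongrightarrow> 0) (at_right 0)"
      by (rule filterlim_compose[OF poly_exp_tendsto_0 filterlim_inverse_at_top_right])
    then have r: "((\<lambda>h. flat_exp p h / h) \<longlongrightarrow> 0) (at_right 0)"
      by (rule Lim_transform_eventually)
         (auto simp: flat_exp_def eventually_at_right_field field_simps intro!: exI[of _ 1])
    have l: "((\<lambda>h. flat_exp p h / h) \<longlongrightarrow> 0) (at_left 0)"
      by (rule Lim_transform_eventually[OF tendsto_const])
         (auto simp: flat_exp_def eventually_at_left_field intro!: exI[of _ "-1"])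
    have "((\<lambda>h. flat_exp p h / h) \<longlongrightarrow> 0) (at 0)"
      using l r filterlim_split_at by blast
    then show ?thesis unfolding DERIV_def 3 by (simp add: flat_exp_def)
  qed
qed

lemma flat_exp_smult: "flat_exp (smult k p) x = k * flat_exp p x"
  by (simp add: flat_exp_def)

text \<open>A class of smooth functions containing all rescaled bumps and closed under
  differentiation: the product rule produces sums, and the inner factor \<open>k\<close> is absorbed
  into the polynomials.\<close>

inductive_set flat_exp_sums :: "(real \<Rightarrow> real) set" where
  product: "(\<lambda>x. flat_exp p (k * x - c) * flat_exp q (d - k * x)) \<in> flat_exp_sums"
| sum: "f \<in> flat_exp_sums \<Longrightarrow> g \<in> flat_exp_sums \<Longrightarrow> (\<lambda>x. f x + g x) \<in> flat_exp_sums"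

lemma flat_exp_sums_deriv:
  assumes "f \<in> flat_exp_sums"
  shows "\<exists>g\<in>flat_exp_sums. \<forall>x. (f has_real_derivative g x) (at x)"
  using assms
proof induction
  case (product p k c q d)
  define D where "D p = pCons 0 (pCons 0 (p - pderiv p))" for p :: "real poly"
  define g where "g x = flat_exp (smult k (D p)) (k * x - c) * flat_exp q (d - k * x)
      + flat_exp p (k * x - c) * flat_exp (smult (- k) (D q)) (d - k * x)" for x
  have "((\<lambda>x. flat_exp p (k * x - c) * flat_exp q (d - k * x)) has_real_derivative g x) (at x)" for x
    unfolding g_def flat_exp_smult D_def
    by (auto intro!: derivative_eq_intros DERIV_chain2[OF flat_exp_deriv])
  moreover have "g \<in> flat_exp_sums" unfolding g_def by (intro flat_exp_sums.intros)
  ultimately show ?case by blast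
next
  case (sum f g)
  then obtain f' g' where "f' \<in> flat_exp_sums" "\<And>x. (f has_real_derivative f' x) (at x)"
    "g' \<in> flat_exp_sums" "\<And>x. (g has_real_derivative g' x) (at x)" by blast
  then show ?case by (intro bexI[of _ "\<lambda>x. f' x + g' x"]) (auto intro: flat_exp_sums.sum DERIV_add)
qed

lemma flat_exp_sums_smooth:
  assumes "f \<in> flat_exp_sums"
  shows "(deriv ^^ n) f differentiable (at x)"
proof -
  have "(deriv ^^ n) f \<in> flat_exp_sums"
  proof (induction n)
    case (Suc n)
    then obtain g where g: "g \<in> flat_exp_sums" "\<And>x. ((deriv ^^ n) f has_real_derivative g x) (at x)"
      using flat_exp_sums_deriv by blast
    have "deriv ((deriv ^^ n) f) = g" using DERIV_imp_deriv[OF g(2)] by (simp add: fun_eq_iff)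
    then show ?case using g(1) by simp
  qed (simp add: assms)
  then show ?thesis using flat_exp_sums_deriv real_differentiable_def by blast
qed

text \<open>\<open>H\<close> is the normalized primitive of the bump
  \<open>exp(-1/x) * exp(-1/(1-x))\<close> on \<open>(0,1)\<close>. \<open>H\<close> itself equals 1
  far to the right and is no bump, so the smoothness clause concerns
  \<open>\<kappa>\<close>.\<close>

lemma smooth_step:
  obtains H \<kappa> :: "real \<Rightarrow> real" where
    "\<And>x. (H has_real_derivative \<kappa> x) (at x)" "\<And>x. 0 \<le> \<kappa> x"
    "\<And>x. x \<le> 0 \<Longrightarrow> H x = 0" "\<And>x. x \<ge> 1 \<Longrightarrow> H x = 1" "\<And>x. 0 \<le> H x" "\<And>x. H x \<le> 1"
    "\<And>x. x \<le> 0 \<Longrightarrow> \<kappa> x = 0" "\<And>x. x \<ge> 1 \<Longrightarrow> \<kappa> x = 0"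
    "\<And>l s C. (\<lambda>x. C * \<kappa> (l * (x - s))) \<in> flat_exp_sums"
proof -
  define \<psi> where "\<psi> x = flat_exp 1 x * flat_exp 1 (1 - x)" for x
  have \<psi>0: "\<psi> x = 0" if "x \<le> 0 \<or> x \<ge> 1" for x using that by (auto simp: \<psi>_def flat_exp_def)
  have \<psi>_pos: "\<psi> x > 0" if "0 < x" "x < 1" for x using that by (simp add: \<psi>_def flat_exp_def)
  have \<psi>_nn: "\<psi> x \<ge> 0" for x by (simp add: \<psi>_def flat_exp_def)
  have \<psi>_cont: "continuous_on A \<psi>" for A
  proof -
    have "isCont (flat_exp p) x" for p x using flat_exp_deriv by (rule DERIV_isCont)
    then have c: "continuous_on B (flat_exp p)" for p B by (simp add: continuous_at_imp_continuous_on)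
    have "continuous_on A (\<lambda>x. flat_exp 1 (1 - x))"
      by (rule continuous_on_compose2[OF c[of UNIV]]) (auto intro!: continuous_intros)
    then show ?thesis unfolding \<psi>_def by (intro continuous_on_mult c)
  qed
  \<comment> \<open>Starting at -1 makes 0 an interior point, so the fundamental theorem yields a
    two-sided derivative there.\<close>
  define G where "G x = integral {-1..x} \<psi>" for x
  have G0: "G x = 0" if "x \<le> 0" for x
  proof -
    have "integral {-1..x} \<psi> = integral {-1..x} (\<lambda>_. 0)"
      by (rule integral_cong) (use that \<psi>0 in auto)
    then show ?thesis by (simp add: G_def)
  qed
  have G_deriv: "(G has_real_derivative \<psi> x) (at x)" for x
  proof (cases "x < 0")
    case True
    have "((\<lambda>x. 0) has_real_derivative \<psi> x) (at x)" using True \<psi>0 by simp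
    then show ?thesis
      by (rule has_field_derivative_transform_within_open[of _ _ _ "{..<0}"]) (use True G0 in auto)
  next
    case False
    have "((\<lambda>x. integral {-1..x} \<psi>) has_real_derivative \<psi> x) (at x within {-1..x+1})"
      by (rule integral_has_real_derivative[OF \<psi>_cont]) (use False in auto)
    moreover have "at x within {-1..x+1} = at x" by (rule at_within_interior) (use False in auto)
    ultimately show ?thesis by (simp add: G_def[abs_def])
  qed
  have G_mono: "G x \<le> G y" if "x \<le> y" for x y
    using DERIV_nonneg_imp_nondecreasing[OF that, of G] G_deriv \<psi>_nn by blast
  have G_cont: "continuous_on A G" for A
    using G_deriv by (intro continuous_at_imp_continuous_on ballI DERIV_isCont)
  have G1: "G x = G 1" if "x \<ge> 1" for x
  proof (cases "x = 1")
    case False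
    then have "1 < x" using that by simp
    moreover have "(G has_real_derivative 0) (at y)" if "1 < y" for y
      using G_deriv[of y] \<psi>0[of y] that by simp
    ultimately show ?thesis using DERIV_isconst2[of 1 x G x] G_cont by simp
  qed simp
  have "G 0 < G 1"
  proof (rule DERIV_pos_imp_increasing_open[of 0 1 G])
    fix x :: real assume "0 < x" "x < 1"
    then show "\<exists>y. (G has_real_derivative y) (at x) \<and> 0 < y"
      using G_deriv \<psi>_pos by blast
  qed (use G_cont in auto)
  then have c: "G 1 > 0" using G0[of 0] by simp
  show thesis
  proof (rule that[of "\<lambda>x. G x / G 1" "\<lambda>x. \<psi> x / G 1"])
    show "((\<lambda>x. G x / G 1) has_real_derivative \<psi> x / G 1) (at x)" for x
      by (rule DERIV_cdivide[OF G_deriv])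
    show "0 \<le> G x / G 1" for x using G_mono[of "min x 0" x] G0[of "min x 0"] c by simp
    show "G x / G 1 \<le> 1" for x using G_mono[of x "max x 1"] G1[of "max x 1"] c by simp
    show "(\<lambda>x. C * (\<psi> (l * (x - s)) / G 1)) \<in> flat_exp_sums" for C l s
    proof -
      have "(\<lambda>x. flat_exp (smult (C / G 1) 1) (l * x - l * s) * flat_exp 1 (1 + l * s - l * x)) \<in> flat_exp_sums"
        by (rule flat_exp_sums.product)
      then show ?thesis unfolding \<psi>_def flat_exp_smult by (simp add: algebra_simps)
    qed
    show "G x / G 1 = 0" if "x \<le> 0" for x using G0[OF that] by simp
    show "G x / G 1 = 1" if "x \<ge> 1" for x using G1[OF that] c by simp
    show "0 \<le> \<psi> x / G 1" for x using \<psi>_nn[of x] c by simp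
    show "\<psi> x / G 1 = 0" if "x \<le> 0" for x using \<psi>0 that by simp
    show "\<psi> x / G 1 = 0" if "x \<ge> 1" for x using \<psi>0 that by simp
  qed
qed

section \<open>Weak derivatives\<close>

lemma integrable_continuous_Ioo:
  assumes "continuous_on {a..b::real} (f :: real \<Rightarrow> real)"
  shows "integrable (lebesgue_on {a<..<b}) f"
proof -
  interpret finite_measure "lebesgue_on {a<..<b}" by (rule finite_measure_interval)
  show ?thesis
    by (rule integrable_const_bound[of _ "sup_norm a b f"])
       (use sup_norm_upper[OF assms] measurable_continuous[OF assms] in \<open>auto intro!: AE_I2\<close>)
qed

text \<open>The rescaled \<open>\<kappa>\<close> is a one-sided approximate identity: it lives on
  \<open>[s, s + 1/n]\<close> and has mass 1 once that interval lies in
  \<open>[a,b]\<close>.\<close>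

lemma smooth_step_kernel_limit:
  fixes H \<kappa> :: "real \<Rightarrow> real"
  assumes H: "\<And>x. (H has_real_derivative \<kappa> x) (at x)" "\<And>x. 0 \<le> \<kappa> x"
    "\<And>x. x \<le> 0 \<Longrightarrow> H x = 0" "\<And>x. x \<ge> 1 \<Longrightarrow> H x = 1" "\<And>x. x \<le> 0 \<Longrightarrow> \<kappa> x = 0" "\<And>x. x \<ge> 1 \<Longrightarrow> \<kappa> x = 0"
    and \<kappa>_cont: "continuous_on UNIV \<kappa>"
    and u: "continuous_on {a..b} u" and s: "a < s" "s < b"
  shows "(\<lambda>n. LINT x|lebesgue_on {a<..<b}. u x * (real n * \<kappa> (real n * (x - s)))) \<longlonglongrightarrow> u s"
proof (rule tendstoI)
  fix e :: real assume "e > 0"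
  obtain d where d: "d > 0" "\<And>x. x \<in> {a..b} \<Longrightarrow> dist x s < d \<Longrightarrow> dist (u x) (u s) < e / 2"
    using u s \<open>e > 0\<close> unfolding continuous_on_iff
    by (metis atLeastAtMost_iff half_gt_zero less_eq_real_def)
  \<comment> \<open>Beyond \<open>n0\<close> the support is shorter than \<open>d\<close>, so
    \<open>u\<close> is nearly constant on it, and it ends before \<open>b\<close>.\<close>
  define n0 where "n0 = nat \<lceil>max (1 / d) (1 / (b - s))\<rceil> + 1"
  show "\<forall>\<^sub>F n in sequentially. dist (LINT x|lebesgue_on {a<..<b}. u x * (real n * \<kappa> (real n * (x - s)))) (u s) < e"
  proof (rule eventually_sequentiallyI[of n0])
    fix n assume "n0 \<le> n"
    moreover have "real n0 > max (1 / d) (1 / (b - s))"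
      unfolding n0_def by linarith
    ultimately have n: "real n > 1 / d" "real n > 1 / (b - s)" by linarith+
    have npos: "real n > 0" using n(1) d(1) by (meson less_trans zero_less_divide_1_iff)
    define k where "k x = real n * \<kappa> (real n * (x - s))" for x
    have k_nn: "0 \<le> k x" for x using H(2) by (simp add: k_def)
    have k_cont: "continuous_on A k" for A unfolding k_def
      by (intro continuous_intros continuous_on_compose2[OF \<kappa>_cont]) auto
    have k_deriv: "((\<lambda>x. H (real n * (x - s))) has_real_derivative k x) (at x)" for x
      unfolding k_def by (rule DERIV_cong[OF DERIV_chain2[OF H(1)]]) (auto intro!: derivative_eq_intros)
    have "(k has_integral H (real n * (b - s)) - H (real n * (a - s))) {a..b}"
      by (rule fundamental_theorem_of_calculus)
         (use k_deriv s in \<open>auto simp: has_real_derivative_iff_has_vector_derivative[symmetric] intro: has_field_derivative_at_within\<close>)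
    moreover have "H (real n * (b - s)) = 1" using n(2) s by (intro H(4)) (simp add: field_simps)
    moreover have "H (real n * (a - s)) = 0" using s npos by (intro H(3)) (simp add: mult_le_0_iff)
    ultimately have "integral {a..b} k = 1" by (simp add: integral_unique)
    then have k1: "(LINT x|lebesgue_on {a<..<b}. k x) = 1"
      using lebesgue_integral_eq_integral[OF integrable_continuous_Ioo[OF k_cont]] integral_open_interval_real[of a b k] by simp
    have i1: "integrable (lebesgue_on {a<..<b}) (\<lambda>x. u x * k x)" "integrable (lebesgue_on {a<..<b}) (\<lambda>x. u s * k x)"
      "integrable (lebesgue_on {a<..<b}) (\<lambda>x. e / 2 * k x)"
      by (intro integrable_continuous_Ioo continuous_intros u k_cont)+
    have "\<bar>(u x - u s) * k x\<bar> \<le> e / 2 * k x" if "x \<in> {a<..<b}" for x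
    proof (cases "0 < real n * (x - s) \<and> real n * (x - s) < 1")
      case True
      then have "0 < x - s" "x - s < 1 / real n" using npos by (auto simp: zero_less_mult_iff field_simps)
      moreover have "1 / real n < d" using n(1) d(1) npos by (simp add: field_simps)
      ultimately have "dist (u x) (u s) < e / 2" using that by (intro d(2)) (auto simp: dist_real_def)
      then have "\<bar>u x - u s\<bar> * k x \<le> e / 2 * k x"
        using k_nn[of x] by (intro mult_right_mono) (auto simp: dist_real_def)
      then show ?thesis using k_nn[of x] by (simp add: abs_mult)
    next
      case False
      then have "k x = 0" using H(5,6) by (auto simp: k_def not_less)
      then show ?thesis by simp
    qed
    then have "norm (LINT x|lebesgue_on {a<..<b}. (u x - u s) * k x) \<le> (LINT x|lebesgue_on {a<..<b}. e / 2 * k x)"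
      using i1 by (intro Bochner_Integration.integral_norm_bound_integral) (auto simp: left_diff_distrib)
    also have "\<dots> = e / 2" using k1 by simp
    also have "(LINT x|lebesgue_on {a<..<b}. (u x - u s) * k x) = (LINT x|lebesgue_on {a<..<b}. u x * k x) - u s"
      using i1 k1 by (simp add: left_diff_distrib)
    finally show "dist (LINT x|lebesgue_on {a<..<b}. u x * (real n * \<kappa> (real n * (x - s)))) (u s) < e"
      using \<open>e > 0\<close> by (simp add: dist_real_def k_def)
  qed
qed

text \<open>The test function \<open>\<phi> n\<close> rises from 0 to 1 just after \<open>s\<close>
  and falls back just after \<open>t\<close>. Its derivative is a difference of two approximate
  identities, so the weak identity tends to \<open>u s - u t\<close> on the left and to minus the
  integral of \<open>v\<close> on the right.\<close>

lemma weak_derivative_integral: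
  assumes u: "continuous_on {a..b} u" and v: "integrable (lebesgue_on {a<..<b}) v"
    and w: "weak_derivative a b u v" and st: "a < s" "s < t" "t < b"
  shows "u t - u s = (LINT x|lebesgue_on {a<..<b}. v x * indicator {s<..t} x)"
proof -
  obtain H \<kappa> :: "real \<Rightarrow> real" where
    H: "\<And>x. (H has_real_derivative \<kappa> x) (at x)" "\<And>x. 0 \<le> \<kappa> x"
    "\<And>x. x \<le> 0 \<Longrightarrow> H x = 0" "\<And>x. x \<ge> 1 \<Longrightarrow> H x = 1" "\<And>x. 0 \<le> H x" "\<And>x. H x \<le> 1"
    "\<And>x. x \<le> 0 \<Longrightarrow> \<kappa> x = 0" "\<And>x. x \<ge> 1 \<Longrightarrow> \<kappa> x = 0"
    "\<And>l s C. (\<lambda>x. C * \<kappa> (l * (x - s))) \<in> flat_exp_sums"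
    using smooth_step by blast
  have "(\<lambda>x. 1 * \<kappa> (1 * (x - 0))) \<in> flat_exp_sums" by (rule H(9))
  then obtain g where "\<And>x. (\<kappa> has_real_derivative g x) (at x)" using flat_exp_sums_deriv by fastforce
  then have \<kappa>_cont: "continuous_on A \<kappa>" for A by (intro continuous_at_imp_continuous_on ballI DERIV_isCont)
  have H_cont: "continuous_on A H" for A using H(1) by (intro continuous_at_imp_continuous_on ballI DERIV_isCont)
  define \<phi> where "\<phi> n x = H (real n * (x - s)) - H (real n * (x - t))" for n x
  define k where "k n c x = real n * \<kappa> (real n * (x - c))" for n and c x :: real
  have k_cont: "continuous_on A (k n c)" for A n c unfolding k_def
    by (intro continuous_intros continuous_on_compose2[OF \<kappa>_cont[of UNIV]]) auto
  have \<phi>_cont: "continuous_on A (\<phi> n)" for A n unfolding \<phi>_def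
    by (intro continuous_intros continuous_on_compose2[OF H_cont[of UNIV]]) auto
  have \<phi>_deriv: "(\<phi> n has_real_derivative k n s x - k n t x) (at x)" for n x
  proof -
    have "((\<lambda>x. H (real n * (x - c))) has_real_derivative k n c x) (at x)" for c
      unfolding k_def by (rule DERIV_cong[OF DERIV_chain2[OF H(1)]]) (auto intro!: derivative_eq_intros)
    then show ?thesis unfolding \<phi>_def by (intro DERIV_diff)
  qed
  have d\<phi>: "deriv (\<phi> n) = (\<lambda>x. k n s x - k n t x)" for n
    using DERIV_imp_deriv[OF \<phi>_deriv] by (simp add: fun_eq_iff)
  have d\<phi>_smooth: "deriv (\<phi> n) \<in> flat_exp_sums" for n
    using flat_exp_sums.sum[OF H(9)[of "real n" "real n" s] H(9)[of "- real n" "real n" t]]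
    unfolding d\<phi> k_def by simp
  \<comment> \<open>The falling edge occupies \<open>[t, t + 1/n]\<close>, which must stay inside
    \<open>(a,b)\<close>.\<close>
  have test: "test_function a b (\<phi> n)" if "real n > 1 / (b - t)" for n
    unfolding test_function_def
  proof (intro conjI allI)
    show "(deriv ^^ m) (\<phi> n) differentiable (at x)" for m x
    \<comment> \<open>Only the derivative of \<open>\<phi> n\<close> belongs to
      \<open>flat_exp_sums\<close>, so order 0 is treated separately.\<close>
    proof (cases m)
      case 0
      then show ?thesis using \<phi>_deriv real_differentiable_def by auto
    next
      case (Suc m')
      then have "(deriv ^^ m) (\<phi> n) = (deriv ^^ m') (deriv (\<phi> n))" by (simp add: funpow_swap1)
      then show ?thesis using flat_exp_sums_smooth[OF d\<phi>_smooth] by simp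
    qed
    have npos: "real n > 0" using that st by (meson diff_gt_0_iff_gt less_trans zero_less_divide_1_iff)
    have "\<phi> n x = 0" if "x \<notin> {s..t + 1 / real n}" for x
    proof (cases "x < s")
      case True
      then show ?thesis using npos st by (simp add: \<phi>_def H(3) mult_le_0_iff)
    next
      case False
      then have "x > t + 1 / real n" using that by auto
      then have "real n * (x - t) \<ge> 1" using npos by (simp add: field_simps)
      moreover have "real n * (x - s) \<ge> real n * (x - t)" using st npos by (intro mult_left_mono) auto
      ultimately show ?thesis by (simp add: \<phi>_def H(4))
    qed
    moreover have "1 / real n < b - t" using that npos st by (simp add: field_simps)
    ultimately show "\<exists>c d. a < c \<and> d < b \<and> (\<forall>x. x \<notin> {c..d} \<longrightarrow> \<phi> n x = 0)"
      using st by (intro exI[of _ s] exI[of _ "t + 1 / real n"]) auto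
  qed
  obtain n0 :: nat where n0: "1 / (b - t) < real n0" using reals_Archimedean2 by blast
  have ev: "\<forall>\<^sub>F n in sequentially. (LINT x|lebesgue_on {a<..<b}. u x * k n s x) - (LINT x|lebesgue_on {a<..<b}. u x * k n t x)
      = - (LINT x|lebesgue_on {a<..<b}. v x * \<phi> n x)"
  proof (rule eventually_sequentiallyI[of n0])
    fix n assume "n0 \<le> n"
    then have "test_function a b (\<phi> n)" using n0 by (intro test) linarith
    then have "(LINT x|lebesgue_on {a<..<b}. u x * deriv (\<phi> n) x) = - (LINT x|lebesgue_on {a<..<b}. v x * \<phi> n x)"
      using w unfolding weak_derivative_def by blast
    moreover have "integrable (lebesgue_on {a<..<b}) (\<lambda>x. u x * k n c x)" for c
      by (intro integrable_continuous_Ioo continuous_intros u k_cont)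
    ultimately show "(LINT x|lebesgue_on {a<..<b}. u x * k n s x) - (LINT x|lebesgue_on {a<..<b}. u x * k n t x)
      = - (LINT x|lebesgue_on {a<..<b}. v x * \<phi> n x)"
      by (simp add: d\<phi> right_diff_distrib)
  qed
  have "(\<lambda>n. (LINT x|lebesgue_on {a<..<b}. u x * k n s x) - (LINT x|lebesgue_on {a<..<b}. u x * k n t x)) \<longlonglongrightarrow> u s - u t"
    unfolding k_def
    by (intro tendsto_diff smooth_step_kernel_limit[OF H(1-4) H(7,8) \<kappa>_cont u]) (use st in auto)
  then have L: "(\<lambda>n. - (LINT x|lebesgue_on {a<..<b}. v x * \<phi> n x)) \<longlonglongrightarrow> u s - u t"
    using tendsto_cong[OF ev] by simp
  \<comment> \<open>The value 0 at \<open>y = 0\<close> is what makes the limiting indicator that of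
    the half-open \<open>{s<..t}\<close>.\<close>
  have H_lim: "(\<lambda>n. H (real n * y)) \<longlonglongrightarrow> (if y > 0 then 1 else 0)" for y
  proof (cases "y > 0")
    case True
    obtain m :: nat where m: "1 / y < real m" using reals_Archimedean2 by blast
    have "\<forall>\<^sub>F n in sequentially. H (real n * y) = 1"
    proof (rule eventually_sequentiallyI[of m])
      fix n assume "m \<le> n"
      then have "1 / y \<le> real n" using m by linarith
      then show "H (real n * y) = 1" using True by (intro H(4)) (simp add: field_simps)
    qed
    then show ?thesis using True by (simp add: tendsto_eventually)
  next
    case False
    then have "H (real n * y) = 0" for n by (intro H(3)) (simp add: mult_le_0_iff)
    then show ?thesis using False by simp
  qed
  have "(\<lambda>n. LINT x|lebesgue_on {a<..<b}. v x * \<phi> n x) \<longlonglongrightarrow> (LINT x|lebesgue_on {a<..<b}. v x * indicator {s<..t} x)"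
  proof (rule integral_dominated_convergence[where w = "\<lambda>x. \<bar>v x\<bar>"])
    show "integrable (lebesgue_on {a<..<b}) (\<lambda>x. \<bar>v x\<bar>)" using v by simp
    have "(\<lambda>x. indicator {s<..t} x :: real) \<in> borel_measurable (lebesgue_on {a<..<b})"
      by (intro measurable_restrict_space1 borel_measurable_indicator) auto
    then show "(\<lambda>x. v x * indicator {s<..t} x) \<in> borel_measurable (lebesgue_on {a<..<b})"
      using v by (intro borel_measurable_times) auto
    show "(\<lambda>x. v x * \<phi> n x) \<in> borel_measurable (lebesgue_on {a<..<b})" for n
      by (rule borel_measurable_times[OF borel_measurable_integrable[OF v] measurable_continuous[OF \<phi>_cont]])
    have "\<bar>\<phi> n x\<bar> \<le> 1" for n x
      using H(5)[of "real n * (x - s)"] H(6)[of "real n * (x - s)"] H(5)[of "real n * (x - t)"] H(6)[of "real n * (x - t)"]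
      unfolding \<phi>_def by linarith
    then show "AE x in lebesgue_on {a<..<b}. norm (v x * \<phi> n x) \<le> \<bar>v x\<bar>" for n
      by (intro AE_I2) (simp add: abs_mult mult_left_le)
    have "(\<lambda>n. \<phi> n x) \<longlonglongrightarrow> indicator {s<..t} x" for x
    proof -
      have "(\<lambda>n. \<phi> n x) \<longlonglongrightarrow> (if x - s > 0 then 1 else 0) - (if x - t > 0 then 1 else 0)"
        unfolding \<phi>_def by (intro tendsto_diff H_lim)
      then show ?thesis using st by (auto simp: indicator_def split: if_splits)
    qed
    then show "AE x in lebesgue_on {a<..<b}. (\<lambda>n. v x * \<phi> n x) \<longlonglongrightarrow> v x * indicator {s<..t} x"
      by (intro AE_I2 tendsto_mult tendsto_const)
  qed
  from LIMSEQ_unique[OF tendsto_minus[OF this] L] show ?thesis by simp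
qed

section \<open>Hoelder and Sobolev inputs\<close>

text \<open>The exponent of the one-dimensional Morrey embedding.\<close>

definition sobolev_exponent :: "ennreal \<Rightarrow> real" where
  "sobolev_exponent \<gamma> = (if \<gamma> = \<infinity> then 1 else 1 - 1 / enn2real \<gamma>)"

lemma finite_exponent_gt_1:
  assumes "1 < \<gamma>" "\<gamma> \<noteq> \<infinity>"
  shows "1 < enn2real \<gamma>"
  using assms by (cases \<gamma>) (auto simp: ennreal_less_iff simp flip: ennreal_1)

lemma sobolev_exponent_pos: "1 < \<gamma> \<Longrightarrow> 0 < sobolev_exponent \<gamma>"
  using finite_exponent_gt_1[of \<gamma>] by (auto simp: sobolev_exponent_def)

lemma integral_indicator_Ioc:
  assumes "a < s" "s < t" "t < b"
  shows "integrable (lebesgue_on {a<..<b}) (indicator {s<..t} :: real \<Rightarrow> real)"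
    and "(LINT x|lebesgue_on {a<..<b}. indicator {s<..t} x) = t - s"
proof -
  interpret finite_measure "lebesgue_on {a<..<b}" by (rule finite_measure_interval)
  have sub: "{s<..t} \<subseteq> {a<..<b}" using assms by auto
  then have sets: "{s<..t} \<in> sets (lebesgue_on {a<..<b})"
    by (simp add: sets_restrict_space_iff)
  show "integrable (lebesgue_on {a<..<b}) (indicator {s<..t} :: real \<Rightarrow> real)"
    using sets by (simp add: emeasure_finite less_top[symmetric])
  have "(LINT x|lebesgue_on {a<..<b}. indicator {s<..t} x) = measure (lebesgue_on {a<..<b}) {s<..t}"
    using sets sub by (simp add: Int_absorb2)
  also have "\<dots> = measure lebesgue {s<..t}" by (rule measure_restrict_space) (use sub in auto)
  finally show "(LINT x|lebesgue_on {a<..<b}. indicator {s<..t} x) = t - s" using assms by simp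
qed

text \<open>For finite exponent, \<open>\<bar>v\<bar>\<close> is split at a level \<open>K\<close>
  which is then optimized; the two resulting terms are equal, whence the factor 2.\<close>

lemma Lp_integral_bound:
  assumes \<gamma>: "1 < \<gamma>" and v: "v \<in> Lp_space a b \<gamma>"
  shows "integrable (lebesgue_on {a<..<b}) v"
    and "a < s \<Longrightarrow> s < t \<Longrightarrow> t < b \<Longrightarrow>
      (LINT x|lebesgue_on {a<..<b}. \<bar>v x\<bar> * indicator {s<..t} x) \<le>
        2 * Lp_norm a b \<gamma> v * (t - s) powr sobolev_exponent \<gamma>"
proof -
  interpret finite_measure "lebesgue_on {a<..<b}" by (rule finite_measure_interval)
  have vm: "v \<in> borel_measurable (lebesgue_on {a<..<b})" using v by (simp add: Lp_space_def)
  have "integrable (lebesgue_on {a<..<b}) v \<and> (a < s \<longrightarrow> s < t \<longrightarrow> t < b \<longrightarrow>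
      (LINT x|lebesgue_on {a<..<b}. \<bar>v x\<bar> * indicator {s<..t} x) \<le>
        2 * Lp_norm a b \<gamma> v * (t - s) powr sobolev_exponent \<gamma>)"
  proof (cases "\<gamma> = \<infinity>")
    case True
    define A where "A = Lp_norm a b \<gamma> v"
    have fin: "esssup (lebesgue_on {a<..<b}) (\<lambda>x. ennreal \<bar>v x\<bar>) < \<infinity>" using v True by (simp add: Lp_space_def)
    have A: "A = enn2real (esssup (lebesgue_on {a<..<b}) (\<lambda>x. ennreal \<bar>v x\<bar>))" "A \<ge> 0"
      using True by (simp_all add: A_def Lp_norm_def)
    then have "esssup (lebesgue_on {a<..<b}) (\<lambda>x. ennreal \<bar>v x\<bar>) = ennreal A" using fin by simp
    then have "AE x in lebesgue_on {a<..<b}. ennreal \<bar>v x\<bar> \<le> ennreal A"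
      using esssup_AE[of "\<lambda>x. ennreal \<bar>v x\<bar>" "lebesgue_on {a<..<b}"] by simp
    then have ae: "AE x in lebesgue_on {a<..<b}. \<bar>v x\<bar> \<le> A"
      using A(2) by simp
    have i: "integrable (lebesgue_on {a<..<b}) v"
      by (rule integrable_const_bound[of _ A]) (use ae vm in auto)
    have "(LINT x|lebesgue_on {a<..<b}. \<bar>v x\<bar> * indicator {s<..t} x) \<le> 2 * A * (t - s) powr sobolev_exponent \<gamma>"
      if st: "a < s" "s < t" "t < b"
    proof -
      note ind = integral_indicator_Ioc[OF st]
      have "(LINT x|lebesgue_on {a<..<b}. \<bar>v x\<bar> * indicator {s<..t} x) \<le> (LINT x|lebesgue_on {a<..<b}. A * indicator {s<..t} x)"
        using ae ind(1) A(2) by (intro integral_mono_AE') (auto elim!: eventually_mono intro!: mult_right_mono)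
      also have "\<dots> = A * (t - s)" using ind(2) by simp
      also have "\<dots> \<le> 2 * A * (t - s)" using A(2) st by (intro mult_right_mono) auto
      finally show ?thesis using True st by (simp add: sobolev_exponent_def)
    qed
    then show ?thesis using i unfolding A_def by blast
  next
    case False
    define g where "g = enn2real \<gamma>"
    have g: "g > 1" using finite_exponent_gt_1[OF \<gamma> False] by (simp add: g_def)
    define A where "A = Lp_norm a b \<gamma> v"
    have ig: "integrable (lebesgue_on {a<..<b}) (\<lambda>x. \<bar>v x\<bar> powr g)" using v False by (simp add: Lp_space_def g_def)
    define I where "I = (LINT x|lebesgue_on {a<..<b}. \<bar>v x\<bar> powr g)"
    have I: "I \<ge> 0" "A = I powr (1 / g)" using False by (simp_all add: I_def A_def Lp_norm_def g_def integral_nonneg_AE)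
    have AI: "A powr g = I" using I g by (simp add: powr_powr)
    \<comment> \<open>Replaces Hoelder's inequality: where \<open>\<bar>v\<bar> > K\<close>, the factor \<open>(\<bar>v\<bar> / K) powr (g - 1)\<close> exceeds 1.\<close>
    have young: "\<bar>v x\<bar> \<le> K + K powr (1 - g) * \<bar>v x\<bar> powr g" if "K > 0" for K x
    proof (cases "\<bar>v x\<bar> \<le> K")
      case True
      then show ?thesis by (simp add: add_increasing2)
    next
      case False
      then have "K powr (g - 1) \<le> \<bar>v x\<bar> powr (g - 1)" using that g by (intro powr_mono2) auto
      then have "K powr (1 - g) * K powr (g - 1) \<le> K powr (1 - g) * \<bar>v x\<bar> powr (g - 1)"
        by (rule mult_left_mono) simp
      moreover have "K powr (1 - g) * K powr (g - 1) = 1"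
        unfolding powr_add[symmetric] using that by simp
      ultimately have "1 \<le> K powr (1 - g) * \<bar>v x\<bar> powr (g - 1)" by simp
      then have "\<bar>v x\<bar> \<le> K powr (1 - g) * \<bar>v x\<bar> powr (g - 1) * \<bar>v x\<bar>"
        using mult_right_mono[of 1 _ "\<bar>v x\<bar>"] by simp
      also have "\<dots> = K powr (1 - g) * \<bar>v x\<bar> powr g"
        using False that by (simp add: powr_diff)
      finally show ?thesis using that by simp
    qed
    have i: "integrable (lebesgue_on {a<..<b}) v"
      by (rule Bochner_Integration.integrable_bound[of _ "\<lambda>x. 1 + 1 powr (1 - g) * \<bar>v x\<bar> powr g"])
         (use ig vm young[of 1] in auto)
    have "(LINT x|lebesgue_on {a<..<b}. \<bar>v x\<bar> * indicator {s<..t} x) \<le> 2 * A * (t - s) powr sobolev_exponent \<gamma>"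
      if st: "a < s" "s < t" "t < b"
    proof -
      note ind = integral_indicator_Ioc[OF st]
      define J where "J = (LINT x|lebesgue_on {a<..<b}. \<bar>v x\<bar> * indicator {s<..t} x)"
      have J: "J \<le> K * (t - s) + K powr (1 - g) * I" if "K > 0" for K
      proof -
        have "J \<le> (LINT x|lebesgue_on {a<..<b}. K * indicator {s<..t} x + K powr (1 - g) * \<bar>v x\<bar> powr g)"
          unfolding J_def
        proof (rule integral_mono')
          show "integrable (lebesgue_on {a<..<b}) (\<lambda>x. K * indicator {s<..t} x + K powr (1 - g) * \<bar>v x\<bar> powr g)"
            using ind(1) ig by auto
          show "\<bar>v x\<bar> * indicator {s<..t} x \<le> K * indicator {s<..t} x + K powr (1 - g) * \<bar>v x\<bar> powr g" for x
            using that young[OF that, of x] by (auto simp: indicator_def)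
          show "0 \<le> K * indicator {s<..t} x + K powr (1 - g) * \<bar>v x\<bar> powr g" for x
            using that by simp
        qed
        also have "\<dots> = K * (t - s) + K powr (1 - g) * I" using ind ig by (simp add: I_def)
        finally show ?thesis .
      qed
      define d where "d = t - s"
      have d: "d > 0" using st by (simp add: d_def)
      have "J \<le> 2 * A * d powr (1 - 1 / g)"
      proof (cases "A = 0")
        case True
        then have "I = 0" using AI by simp
        \<comment> \<open>With \<open>A = 0\<close> there is no optimal level; levels tending to 0
          show that \<open>J\<close> is at most 0.\<close>
        have "J \<le> e" if "e > 0" for e
          using J[of "e / d"] that d \<open>I = 0\<close> by (simp add: d_def[symmetric])
        then show ?thesis using True field_le_epsilon[of J 0] by simp
      next
        case False
        then have Apos: "A > 0" using I by simp
        \<comment> \<open>This level balances \<open>K * d\<close> against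
          \<open>K powr (1 - g) * I\<close>; both become
          \<open>A * d powr (1 - 1 / g)\<close>.\<close>
        define K where "K = A * d powr (- 1 / g)"
        have "K > 0" using Apos d by (simp add: K_def)
        have "K * d = A * d powr (1 - 1 / g)"
        proof -
          have "d powr (- 1 / g) * d powr 1 = d powr (1 - 1 / g)"
            unfolding powr_add[symmetric] by (simp add: algebra_simps)
          then show ?thesis using d by (simp add: K_def mult.assoc)
        qed
        moreover have "K powr (1 - g) * I = A * d powr (1 - 1 / g)"
        proof -
          have "K powr (1 - g) * I = (A powr (1 - g) * A powr g) * (d powr (- 1 / g)) powr (1 - g)"
            unfolding K_def AI[symmetric] using Apos d by (simp add: powr_mult)
          also have "A powr (1 - g) * A powr g = A" using Apos by (simp add: powr_add[symmetric])
          also have "(d powr (- 1 / g)) powr (1 - g) = d powr (1 - 1 / g)"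
            unfolding powr_powr using g by (intro arg_cong2[where f = "(powr)"]) (auto simp: field_simps)
          finally show ?thesis .
        qed
        ultimately show ?thesis using J[OF \<open>K > 0\<close>] by (simp add: d_def[symmetric])
      qed
      then show ?thesis using False unfolding J_def d_def sobolev_exponent_def g_def by simp
    qed
    then show ?thesis using i unfolding A_def by blast
  qed
  then show "integrable (lebesgue_on {a<..<b}) v"
    "a < s \<Longrightarrow> s < t \<Longrightarrow> t < b \<Longrightarrow>
      (LINT x|lebesgue_on {a<..<b}. \<bar>v x\<bar> * indicator {s<..t} x) \<le>
        2 * Lp_norm a b \<gamma> v * (t - s) powr sobolev_exponent \<gamma>" by blast+
qed

text \<open>Test functions vanish near \<open>a\<close> and \<open>b\<close>, so the bound is first
  obtained for interior points and then extended by continuity of \<open>u\<close>.\<close>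

lemma sobolev_hoelder_bound:
  assumes \<gamma>: "1 < \<gamma>" and u: "continuous_on {a..b} u" and v: "v \<in> Lp_space a b \<gamma>"
    and w: "weak_derivative a b u v" and st: "s \<in> {a..b}" "t \<in> {a..b}"
  shows "\<bar>u t - u s\<bar> \<le> 2 * Lp_norm a b \<gamma> v * \<bar>t - s\<bar> powr sobolev_exponent \<gamma>"
proof -
  note L = Lp_integral_bound[OF \<gamma> v]
  have inner: "\<bar>u t - u s\<bar> \<le> 2 * Lp_norm a b \<gamma> v * (t - s) powr sobolev_exponent \<gamma>"
    if st: "a < s" "s < t" "t < b" for s t
  proof -
    have "\<bar>u t - u s\<bar> = norm (LINT x|lebesgue_on {a<..<b}. v x * indicator {s<..t} x)"
      using weak_derivative_integral[OF u L(1) w st] by simp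
    also have "\<dots> \<le> (LINT x|lebesgue_on {a<..<b}. norm (v x * indicator {s<..t} x))"
      by (rule integral_norm_bound)
    also have "\<dots> = (LINT x|lebesgue_on {a<..<b}. \<bar>v x\<bar> * indicator {s<..t} x)"
      by (simp add: abs_mult)
    also have "\<dots> \<le> 2 * Lp_norm a b \<gamma> v * (t - s) powr sobolev_exponent \<gamma>" by (rule L(2)[OF st])
    finally show ?thesis .
  qed
  have main: "\<bar>u t - u s\<bar> \<le> 2 * Lp_norm a b \<gamma> v * (t - s) powr sobolev_exponent \<gamma>"
    if st: "a \<le> s" "s < t" "t \<le> b" for s t
  proof -
    \<comment> \<open>The factor 1/3 keeps \<open>s + e n\<close> strictly to the left of
      \<open>t - e n\<close>.\<close>
    define e where "e n = (t - s) * inverse (real (Suc n)) / 3" for n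
    have e_pos: "0 < e n" for n using st by (simp add: e_def)
    have e_le: "e n \<le> (t - s) / 3" for n
      using st mult_left_mono[of "inverse (real (Suc n))" 1 "t - s"] by (simp add: e_def field_simps)
    have e_lim: "e \<longlonglongrightarrow> 0"
      using tendsto_mult_left[OF LIMSEQ_inverse_real_of_nat, of "(t - s) / 3"] by (simp add: e_def[abs_def] mult_ac)
    have mem: "s + e n \<in> {a..b}" "t - e n \<in> {a..b}" for n
      using e_pos[of n] e_le[of n] st by auto
    have "(\<lambda>n. s + e n) \<longlonglongrightarrow> s + 0" "(\<lambda>n. t - e n) \<longlonglongrightarrow> t - 0" by (intro tendsto_intros e_lim)+
    then have "(\<lambda>n. u (s + e n)) \<longlonglongrightarrow> u s" "(\<lambda>n. u (t - e n)) \<longlonglongrightarrow> u t"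
      using continuous_on_tendsto_compose[OF u, of "\<lambda>n. s + e n" s sequentially]
        continuous_on_tendsto_compose[OF u, of "\<lambda>n. t - e n" t sequentially] mem st by simp_all
    then have "(\<lambda>n. \<bar>u (t - e n) - u (s + e n)\<bar>) \<longlonglongrightarrow> \<bar>u t - u s\<bar>" by (intro tendsto_intros)
    moreover have "\<bar>u (t - e n) - u (s + e n)\<bar> \<le> 2 * Lp_norm a b \<gamma> v * (t - s) powr sobolev_exponent \<gamma>" for n
    proof -
      have "\<bar>u (t - e n) - u (s + e n)\<bar> \<le> 2 * Lp_norm a b \<gamma> v * (t - e n - (s + e n)) powr sobolev_exponent \<gamma>"
        using e_pos[of n] e_le[of n] st by (intro inner) auto
      also have "\<dots> \<le> 2 * Lp_norm a b \<gamma> v * (t - s) powr sobolev_exponent \<gamma>"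
        using e_pos[of n] e_le[of n] st sobolev_exponent_pos[OF \<gamma>]
        by (intro mult_left_mono powr_mono2) (auto simp: Lp_norm_nonneg)
      finally show ?thesis .
    qed
    ultimately show ?thesis by (intro LIMSEQ_le_const2) auto
  qed
  show ?thesis
    using main[of s t] main[of t s] st by (cases s t rule: linorder_cases) (auto simp: abs_minus_commute)
qed

text \<open>Common ground of the two kinds of spaces; the factor 2 is the one of
  \<open>Lp_integral_bound\<close>.\<close>

definition hoelder_bounded :: "real \<Rightarrow> real \<Rightarrow> (real \<Rightarrow> real) set \<Rightarrow> ((real \<Rightarrow> real) \<Rightarrow> real) \<Rightarrow> real \<Rightarrow> bool" where
  "hoelder_bounded a b X n \<beta> \<longleftrightarrow>
     (\<forall>h\<in>X. continuous_on {a..b} h \<and> (\<forall>l. l *\<^sub>R h \<in> X) \<and> \<bar>h a\<bar> \<le> n h \<and>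
        (\<forall>s\<in>{a..b}. \<forall>t\<in>{a..b}. \<bar>h t - h s\<bar> \<le> 2 * n h * \<bar>t - s\<bar> powr \<beta>))"

lemma hoelder_continuous_on:
  assumes \<beta>: "0 < \<beta>" and h: "\<And>s t. s \<in> S \<Longrightarrow> t \<in> S \<Longrightarrow> \<bar>h t - h s\<bar> \<le> C * \<bar>t - s\<bar> powr \<beta>"
  shows "continuous_on S (h :: real \<Rightarrow> real)"
  unfolding continuous_on_def
proof
  fix s assume s: "s \<in> S"
  have "((\<lambda>t. \<bar>t - s\<bar>) \<longlongrightarrow> \<bar>s - s\<bar>) (at s within S)" by (intro tendsto_intros)
  then have "((\<lambda>t. \<bar>t - s\<bar> powr \<beta>) \<longlongrightarrow> 0) (at s within S)"
    using \<beta> by (intro tendsto_zero_powrI[OF _ tendsto_const]) auto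
  from tendsto_mult_right[OF this, of C]
  have "((\<lambda>t. C * \<bar>t - s\<bar> powr \<beta>) \<longlongrightarrow> 0) (at s within S)" by (simp add: mult.commute)
  then have "((\<lambda>t. h t - h s) \<longlongrightarrow> 0) (at s within S)"
    by (rule Lim_null_comparison[rotated]) (use h s in \<open>auto simp: eventually_at_filter\<close>)
  then show "(h \<longlongrightarrow> h s) (at s within S)" by (simp add: LIM_zero_iff)
qed

lemma hoelder_space_bounded:
  assumes "a < b" "0 < \<alpha>"
  shows "hoelder_bounded a b (hoelder_space a b \<alpha>) (hoelder_norm a b \<alpha>) \<alpha>"
  unfolding hoelder_bounded_def
proof (intro ballI conjI allI)
  fix h assume "h \<in> hoelder_space a b \<alpha>"
  then obtain C where C: "\<And>s t. s \<in> {a..b} \<Longrightarrow> t \<in> {a..b} \<Longrightarrow> \<bar>h t - h s\<bar> \<le> C * \<bar>t - s\<bar> powr \<alpha>"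
    unfolding hoelder_space_def by blast
  let ?Q = "{\<bar>h t - h s\<bar> / \<bar>t - s\<bar> powr \<alpha> |s t. s \<in> {a..b} \<and> t \<in> {a..b} \<and> s \<noteq> t}"
  have bdd: "bdd_above ?Q" unfolding bdd_above_def
    using C by (intro exI[of _ C]) (auto simp: divide_le_eq)
  have Q: "\<bar>h t - h s\<bar> \<le> Sup ?Q * \<bar>t - s\<bar> powr \<alpha>" if "s \<in> {a..b}" "t \<in> {a..b}" for s t
  proof (cases "s = t")
    case False
    then have "\<bar>h t - h s\<bar> / \<bar>t - s\<bar> powr \<alpha> \<le> Sup ?Q" using that by (intro cSup_upper bdd) blast
    then show ?thesis using False by (simp add: divide_le_eq)
  qed simp
  \<comment> \<open>The pair \<open>(a, b)\<close> exhibits a nonnegative member of the set, so its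
    supremum is nonnegative.\<close>
  have "0 \<le> \<bar>h b - h a\<bar> / \<bar>b - a\<bar> powr \<alpha>" by simp
  also have "\<dots> \<le> Sup ?Q" using \<open>a < b\<close>
    by (intro cSup_upper bdd CollectI exI[of _ a] exI[of _ b]) auto
  finally have S: "0 \<le> Sup ?Q" .
  show "continuous_on {a..b} h" by (rule hoelder_continuous_on[OF \<open>0 < \<alpha>\<close> C])
  show "\<bar>h a\<bar> \<le> hoelder_norm a b \<alpha> h" using S by (simp add: hoelder_norm_def)
  have "\<bar>l * h t - l * h s\<bar> \<le> \<bar>l\<bar> * C * \<bar>t - s\<bar> powr \<alpha>" if "s \<in> {a..b}" "t \<in> {a..b}" for l s t
    using mult_left_mono[OF C[OF that], of "\<bar>l\<bar>"] by (simp add: abs_mult[symmetric] right_diff_distrib mult.assoc)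
  then show "l *\<^sub>R h \<in> hoelder_space a b \<alpha>" for l
    unfolding hoelder_space_def scaleR_fun_def real_scaleR_def by blast
  fix s t assume st: "s \<in> {a..b}" "t \<in> {a..b}"
  have "Sup ?Q \<le> 2 * hoelder_norm a b \<alpha> h" using S by (simp add: hoelder_norm_def)
  then show "\<bar>h t - h s\<bar> \<le> 2 * hoelder_norm a b \<alpha> h * \<bar>t - s\<bar> powr \<alpha>"
    using Q[OF st] mult_right_mono[of "Sup ?Q" "2 * hoelder_norm a b \<alpha> h" "\<bar>t - s\<bar> powr \<alpha>"] by simp
qed

lemma Lp_space_scale:
  assumes "v \<in> Lp_space a b \<gamma>"
  shows "(\<lambda>x. l * v x) \<in> Lp_space a b \<gamma>"
proof (cases "\<gamma> = \<infinity>")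
  case True
  have vm: "v \<in> borel_measurable (lebesgue_on {a<..<b})" using assms by (simp add: Lp_space_def)
  let ?E = "esssup (lebesgue_on {a<..<b}) (\<lambda>x. ennreal \<bar>v x\<bar>)"
  have "?E < \<infinity>" using assms True by (simp add: Lp_space_def)
  then have "ennreal \<bar>l\<bar> * ?E < \<infinity>" by (simp add: ennreal_mult_less_top)
  moreover have "esssup (lebesgue_on {a<..<b}) (\<lambda>x. ennreal \<bar>l * v x\<bar>) \<le> ennreal \<bar>l\<bar> * ?E"
  proof (rule esssup_I)
    show "(\<lambda>x. ennreal \<bar>l * v x\<bar>) \<in> borel_measurable (lebesgue_on {a<..<b})" using vm by measurable
    show "AE x in lebesgue_on {a<..<b}. ennreal \<bar>l * v x\<bar> \<le> ennreal \<bar>l\<bar> * ?E"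
      using esssup_AE[of "\<lambda>x. ennreal \<bar>v x\<bar>" "lebesgue_on {a<..<b}"]
      by eventually_elim (simp add: abs_mult ennreal_mult mult_left_mono)
  qed
  ultimately show ?thesis using True vm by (auto simp: Lp_space_def intro: le_less_trans)
next
  case False
  then show ?thesis using assms by (auto simp: Lp_space_def abs_mult powr_mult)
qed

text \<open>The bound holds for every weak derivative in the \<open>Lp_space\<close>, hence for the
  one that \<open>SOME\<close> selects in the norm.\<close>

lemma sobolev_space_bounded:
  assumes \<gamma>: "1 < \<gamma>"  and "a < b"
  shows "hoelder_bounded a b (sobolev_space a b \<gamma>) (sobolev_norm a b \<gamma>) (sobolev_exponent \<gamma>)"
  unfolding hoelder_bounded_def
proof (intro ballI conjI allI)
  fix h assume h: "h \<in> sobolev_space a b \<gamma>"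
  define v where "v = (SOME v. v \<in> Lp_space a b \<gamma> \<and> weak_derivative a b h v)"
  have "\<exists>v. v \<in> Lp_space a b \<gamma> \<and> weak_derivative a b h v" using h by (auto simp: sobolev_space_def)
  then have "v \<in> Lp_space a b \<gamma> \<and> weak_derivative a b h v" unfolding v_def by (rule someI_ex)
  then have v: "v \<in> Lp_space a b \<gamma>" "weak_derivative a b h v" by auto
  have n: "sobolev_norm a b \<gamma> h = \<bar>h a\<bar> + Lp_norm a b \<gamma> v" by (simp add: sobolev_norm_def v_def)
  show c: "continuous_on {a..b} h" using h by (simp add: sobolev_space_def)
  show "\<bar>h a\<bar> \<le> sobolev_norm a b \<gamma> h" using Lp_norm_nonneg by (simp add: n)
  show "l *\<^sub>R h \<in> sobolev_space a b \<gamma>" for l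
  proof -
    have "weak_derivative a b (\<lambda>x. l * h x) (\<lambda>x. l * v x)"
      using v(2) by (simp add: weak_derivative_def mult.assoc)
    moreover have "continuous_on {a..b} (\<lambda>x. l * h x)" using c by (intro continuous_intros)
    ultimately show ?thesis using Lp_space_scale[OF v(1)]
      unfolding sobolev_space_def scaleR_fun_def real_scaleR_def by blast
  qed
  fix s t assume "s \<in> {a..b}" "t \<in> {a..b}"
  from sobolev_hoelder_bound[OF \<gamma> c v this]
  have "\<bar>h t - h s\<bar> \<le> 2 * Lp_norm a b \<gamma> v * \<bar>t - s\<bar> powr sobolev_exponent \<gamma>" .
  also have "\<dots> \<le> 2 * sobolev_norm a b \<gamma> h * \<bar>t - s\<bar> powr sobolev_exponent \<gamma>"
    by (intro mult_right_mono) (auto simp: n)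
  finally show "\<bar>h t - h s\<bar> \<le> 2 * sobolev_norm a b \<gamma> h * \<bar>t - s\<bar> powr sobolev_exponent \<gamma>" .
qed

lemma hoelder_bounded_play_space:
  assumes "a < b" "r > 0" and X: "hoelder_bounded a b X normX \<beta>" and \<beta>: "0 < \<beta>"
    and N: "product_norm X normX N"
  shows "play_space a b r X N"
proof -
  obtain c where c: "c > 0" "\<And>h y. h \<in> X \<Longrightarrow> c * (normX h + \<bar>y\<bar>) \<le> N (h, y)"
    using N unfolding product_norm_def by blast
  have X': "continuous_on {a..b} h" "l *\<^sub>R h \<in> X" "\<bar>h a\<bar> \<le> normX h"
    "s \<in> {a..b} \<Longrightarrow> t \<in> {a..b} \<Longrightarrow> \<bar>h t - h s\<bar> \<le> 2 * normX h * \<bar>t - s\<bar> powr \<beta>" if "h \<in> X" for h l s t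
    using X that unfolding hoelder_bounded_def by auto
  have nX: "0 \<le> normX h" if "h \<in> X" for h using X'(3)[OF that] by linarith
  have NX: "normX h \<le> N (h, y) / c" if "h \<in> X" for h y
  proof -
    have "c * normX h \<le> c * (normX h + \<bar>y\<bar>)" using c(1) by (intro mult_left_mono) auto
    then have "c * normX h \<le> N (h, y)" using c(2)[OF that, of y] by linarith
    then show ?thesis using c(1) by (simp add: field_simps)
  qed
  show ?thesis
  proof
    show "a < b" "r > 0" by fact+
    show "continuous_on {a..b} h" "l *\<^sub>R h \<in> X" if "h \<in> X" for h l using X'(1,2)[OF that] .
    show "N (l *\<^sub>R (h, y)) = \<bar>l\<bar> * N (h, y)" if "h \<in> X" for h l y
      using N that unfolding product_norm_def by blast
    \<comment> \<open>From \<open>\<bar>h t\<bar> \<le> \<bar>h a\<bar> + \<bar>h t - h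
      a\<bar>\<close> with the longest possible distance \<open>b - a\<close>.\<close>
    define K where "K = 1 + 2 * (b - a) powr \<beta>"
    have K: "K \<ge> 1" by (simp add: K_def)
    have "sup_norm a b h + \<bar>y\<bar> \<le> K / c * N (h, y)" if h: "h \<in> X" for h y
    proof -
      have "sup_norm a b h \<le> K * normX h" unfolding sup_norm_def
      proof (rule cSUP_least)
        fix t assume t: "t \<in> {a..b}"
        have "\<bar>h t - h a\<bar> \<le> 2 * normX h * \<bar>t - a\<bar> powr \<beta>" using X'(4)[OF h, of a t] t \<open>a < b\<close> by auto
        also have "\<dots> \<le> 2 * normX h * (b - a) powr \<beta>"
          using t \<beta> nX[OF h] by (intro mult_left_mono powr_mono2) auto
        finally show "\<bar>h t\<bar> \<le> K * normX h" using X'(3)[OF h] by (simp add: K_def algebra_simps)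
      qed (use \<open>a < b\<close> in auto)
      moreover have "\<bar>y\<bar> \<le> K * \<bar>y\<bar>" using K mult_right_mono[of 1 K "\<bar>y\<bar>"] by simp
      ultimately have "sup_norm a b h + \<bar>y\<bar> \<le> K * (normX h + \<bar>y\<bar>)" by (simp add: distrib_left)
      also have "\<dots> \<le> K * (N (h, y) / c)"
        using c(1) c(2)[OF h, of y] K by (intro mult_left_mono) (auto simp: field_simps)
      finally show ?thesis by simp
    qed
    then show "\<exists>K>0. \<forall>h\<in>X. \<forall>y. sup_norm a b h + \<bar>y\<bar> \<le> K * N (h, y)"
      using K c(1) by (intro exI[of _ "K / c"]) auto
    show "\<exists>d>0. \<forall>h\<in>X. \<forall>y. \<forall>s\<in>{a..b}. \<forall>t\<in>{a..b}. \<bar>s - t\<bar> < d \<longrightarrow> \<bar>h s - h t\<bar> \<le> e * N (h, y)"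
      if "e > 0" for e
    proof (intro exI conjI ballI allI impI)
      \<comment> \<open>Solves \<open>2 / c * d powr \<beta> = e\<close> for \<open>d\<close>, where
        \<open>1 / c\<close> is the price of passing from \<open>normX\<close> to
        \<open>N\<close>.\<close>
      let ?d = "(e * c / 2) powr (1 / \<beta>)"
      show "?d > 0" using that c(1) by simp
      fix h y s t assume h: "h \<in> X" and st: "s \<in> {a..b}" "t \<in> {a..b}" and "\<bar>s - t\<bar> < ?d"
      then have "\<bar>s - t\<bar> powr \<beta> \<le> ?d powr \<beta>" using \<beta> by (intro powr_mono2) auto
      also have "\<dots> = e * c / 2" using \<beta> that c(1) by (simp add: powr_powr)
      finally have p: "\<bar>s - t\<bar> powr \<beta> \<le> e * c / 2" .
      have "\<bar>h s - h t\<bar> \<le> 2 * normX h * \<bar>s - t\<bar> powr \<beta>" by (rule X'(4)[OF h st(2,1)])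
      also have "\<dots> \<le> 2 * (N (h, y) / c) * (e * c / 2)"
        using p NX[OF h, of y] nX[OF h] by (intro mult_mono) auto
      also have "\<dots> = e * N (h, y)" using c(1) by simp
      finally show "\<bar>h s - h t\<bar> \<le> e * N (h, y)" .
    qed
  qed
qed

theorem theorem8p2:
  fixes a b r :: real and q :: ennreal
    and X :: "(real \<Rightarrow> real) set" and normX :: "(real \<Rightarrow> real) \<Rightarrow> real"
    and N :: "(real \<Rightarrow> real) \<times> real \<Rightarrow> real"
  assumes "a < b" and "r > 0" and "1 \<le> q" and "q < \<infinity>"
    and "(\<exists>\<alpha>. 0 < \<alpha> \<and> \<alpha> \<le> 1 \<and> X = hoelder_space a b \<alpha> \<and> normX = hoelder_norm a b \<alpha>) \<or>
         (\<exists>\<gamma>. 1 < \<gamma> \<and> X = sobolev_space a b \<gamma> \<and> normX = sobolev_norm a b \<gamma>)"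
    and "product_norm X normX N"
  shows "\<exists>(P' :: (real \<Rightarrow> real) \<times> real \<Rightarrow> (real \<Rightarrow> real) \<times> real \<Rightarrow> real \<Rightarrow> real)
          (\<rho> :: (real \<Rightarrow> real) \<times> real \<Rightarrow> real \<Rightarrow> real) (C :: real).
      (\<forall>uz \<in> X \<times> UNIV.
         has_bouligand_derivative_at (X \<times> UNIV) N (X \<times> UNIV) (Lp_space a b q) (Lp_norm a b q)
           (\<lambda>(v, \<zeta>). play a b r v \<zeta>) uz (P' uz) \<and>
         (\<forall>hy \<in> X \<times> UNIV. given_by_recursion a b r uz hy (P' uz hy)) \<and>
         (\<forall>h \<in> X. \<forall>y.
            Lp_norm a b q (play a b r (fst uz + h) (snd uz + y) - play a b r (fst uz) (snd uz)
                             - P' uz (h, y))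
              \<le> \<rho> uz (sup_norm a b h + \<bar>y\<bar>) * N (h, y)) \<and>
         mono_on {0..} (\<rho> uz) \<and> (\<rho> uz \<longlongrightarrow> 0) (at_right 0) \<and>
         (\<forall>\<delta>\<ge>0. 0 \<le> \<rho> uz \<delta> \<and> \<rho> uz \<delta> \<le> C))"
proof -
  have "\<exists>\<beta>>0. hoelder_bounded a b X normX \<beta>"
    using assms(5) hoelder_space_bounded[OF assms(1)] sobolev_space_bounded[OF _ assms(1)] sobolev_exponent_pos
    by blast
  then have "play_space a b r X N"
    using hoelder_bounded_play_space[OF assms(1,2) _ _ assms(6)] by blast
  from play_space.play_bouligand_estimate[OF this assms(3,4)] show ?thesis .
qed

end
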